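(* Let $K$ be a local field of positive characteristic, let $\Psi=\{\psi^1,\dots,\psi^L\}\subset L^2(K)$ be such that $X(\Psi)$ is an affine Bessel family, and let $\Phi=\{\varphi^1,\dots,\varphi^L\}\subset L^2(K)$. Then $\Phi$ is an affine dual of $\Psi$ if and only if $\Phi$ is a quasi-affine dual of $\Psi$.
   Context: Local field: a field $K$ with a topology that is locally compact, nondiscrete and totally disconnected; here $K$ has characteristic $p>0$. $dx$ is Haar measure on the additive group $K^+$, and the absolute value is defined by $d(\alpha x)=|\alpha|\,dx$, $|0|=0$; it is ultrametric. $\mathfrak{D}=\{x\in K:|x|\le 1\}$ is the ring of integers, $\mathfrak{P}=\{x\in K:|x|<1\}$ the prime ideal, $\mathfrak{D}^*=\mathfrak{D}\setminus\mathfrak{P}$. $\mathfrak{p}$ is a fixed element of maximal absolute value in $\mathfrak{P}$ (prime element). $\mathfrak{D}/\mathfrak{P}\cong GF(q)$ with $q=p^c$, $c\in\mathbb{N}$; Haar measure is normalized so that $\mathfrak{D}$ has measure $1$; then $|\mathfrak{p}|=q^{-1}$. $\mathbb{N}_0=\mathbb{N}\cup\{0\}$. Translation set: fix $1=\epsilon_0,\epsilon_1,\dots,\epsilon_{c-1}\in\mathfrak{D}^*$ whose $GF(p)$-span is isomorphic to $GF(q)\cong\mathfrak{D}/\mathfrak{P}$ (their classes form a basis of $\mathfrak{D}/\mathfrak{P}$ over $GF(p)$). For $0\le n<q$, write $n=a_0+a_1p+\cdots+a_{c-1}p^{c-1}$ with $0\le a_k<p$, and set $u(n)=(a_0+a_1\epsilon_1+\cdots+a_{c-1}\epsilon_{c-1})\mathfrak{p}^{-1}$.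 For general $n\ge 0$, write $n=b_0+b_1q+\cdots+b_sq^s$ with $0\le b_k<q$, and set $u(n)=u(b_0)+u(b_1)\mathfrak{p}^{-1}+\cdots+u(b_s)\mathfrak{p}^{-s}$. ($\{u(n):n\in\mathbb{N}_0\}$ is a complete list of distinct coset representatives of $\mathfrak{D}$ in $K^+$.) Operators on $L^2(K)$: for $j\in\mathbb{Z}$, $y\in K$, $\delta_jf(x)=q^{j/2}f(\mathfrak{p}^{-j}x)$ and $\tau_yf(x)=f(x-y)$. For $f\in L^2(K)$, $j\in\mathbb{Z}$, $k\in\mathbb{N}_0$, let $f_{j,k}=\delta_j\tau_{u(k)}f$; let $\tilde f_{j,k}=\delta_j\tau_{u(k)}f$ if $j\ge0$, and $\tilde f_{j,k}=q^{j/2}\tau_{u(k)}\delta_jf$ if $j<0$. The affine system generated by $\Psi$ is the indexed family $X(\Psi)=\{\psi^l_{j,k}:1\le l\le L,\,j\in\mathbb{Z},\,k\in\mathbb{N}_0\}$. It is an affine Bessel family if there is $B>0$ with $\sum_{l=1}^L\sum_{j\in\mathbb{Z}}\sum_{k\in\mathbb{N}_0}|\langle f,\psi^l_{j,k}\rangle|^2\le B\|f\|_2^2$ for all $f\in L^2(K)$. Duals: let $\Psi=\{\psi^1,\dots,\psi^L\}$ and $\Phi=\{\varphi^1,\dots,\varphi^L\}$ be subsets of $L^2(K)$ such that $X(\Psi)$ and $X(\Phi)$ are Bessel families (this requirement is part of the definition of both kinds of dual). $\Phi$ is an affine dual of $\Psi$ if $$\sum_{l=1}^L\sum_{j\in\mathbb{Z}}\sum_{k\in\mathbb{N}_0}\langle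 f,\psi^l_{j,k}\rangle\langle\varphi^l_{j,k},g\rangle=\langle f,g\rangle\quad\text{for all }f,g\in L^2(K),$$ and $\Phi$ is a quasi-affine dual of $\Psi$ if $$\sum_{l=1}^L\sum_{j\in\mathbb{Z}}\sum_{k\in\mathbb{N}_0}\langle f,\tilde\psi^l_{j,k}\rangle\langle\tilde\varphi^l_{j,k},g\rangle=\langle f,g\rangle\quad\text{for all }f,g\in L^2(K).$$ *)

theory Defs
  imports "HOL-Analysis.Analysis"
begin

class local_field = field + t2_space + topological_ab_group_add + topological_semigroup_mult +
  assumes tendsto_inverse_nhds: "a \<noteq> 0 \<Longrightarrow> filterlim inverse (nhds (inverse a)) (nhds a)"
    and locally_compact: "\<exists>U C. open U \<and> compact C \<and> x \<in> U \<and> U \<subseteq> C"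
    and nondiscrete: "\<exists>S. \<not> open S"
    and totally_disconnected: "connected S \<Longrightarrow> \<exists>x. S \<subseteq> {x}"

text \<open>A Haar measure on the additive group: a nonzero translation invariant Radon measure.\<close>

definition haar_measure :: "'a :: {topological_ab_group_add, t2_space} measure \<Rightarrow> bool" where
  "haar_measure M \<longleftrightarrow>
     sets M = sets borel \<and>
     emeasure M UNIV \<noteq> 0 \<and>
     (\<forall>a. \<forall>A \<in> sets borel. emeasure M ((\<lambda>x. a + x) ` A) = emeasure M A) \<and>
     (\<forall>C. compact C \<longrightarrow> emeasure M C < \<infinity>) \<and>
     (\<forall>A \<in> sets borel. emeasure M A = (INF U \<in> {U. open U \<and> A \<subseteq> U}. emeasure M U)) \<and>
     (\<forall>U. open U \<longrightarrow> emeasure M U = (SUP C \<in> {C. compact C \<and> C \<subseteq> U}. emeasure M C))"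

text \<open>
  The property \<open>d(\<alpha> x) = |\<alpha>| dx\<close>, together with \<open>|0| = 0\<close>, determines the absolute value.
\<close>

definition haar_absolute_value :: "'a :: local_field measure \<Rightarrow> ('a \<Rightarrow> real) \<Rightarrow> bool" where
  "haar_absolute_value M av \<longleftrightarrow>
     av 0 = 0 \<and>
     (\<forall>\<alpha>. \<alpha> \<noteq> 0 \<longrightarrow>
        (\<forall>A \<in> sets borel. emeasure M ((\<lambda>x. \<alpha> * x) ` A) = ennreal (av \<alpha>) * emeasure M A))"

definition integer_ring :: "('a :: local_field \<Rightarrow> real) \<Rightarrow> 'a set" where
  "integer_ring av = {x. av x \<le> 1}"

definition prime_ideal :: "('a :: local_field \<Rightarrow> real) \<Rightarrow> 'a set" where
  "prime_ideal av = {x. av x < 1}"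

definition residue_classes :: "('a :: local_field \<Rightarrow> real) \<Rightarrow> 'a set set" where
  "residue_classes av =
     integer_ring av // {(x, y) \<in> integer_ring av \<times> integer_ring av. x - y \<in> prime_ideal av}"

text \<open>
  \<open>\<epsilon> 0 = 1, \<dots>, \<epsilon> (c - 1)\<close> are units whose classes form a basis of the residue field over
  \<open>GF(p) = {of_nat 0, \<dots>, of_nat (p - 1)}\<close>, where \<open>p = CHAR('a)\<close>.  Linear independence and spanning
  are written out with coefficients in \<open>{0, \<dots>, p - 1}\<close> and congruence modulo the prime ideal.
\<close>

locale local_field_char_p =
  fixes M :: "'a :: local_field measure"
    and av :: "'a \<Rightarrow> real"
    and \<pp> :: 'a
    and c :: nat
    and \<epsilon> :: "nat \<Rightarrow> 'a"
  assumes char_pos: "CHAR('a) > 0"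
    and haar: "haar_measure M"
    and absolute_value: "haar_absolute_value M av"
    and normalised: "emeasure M (integer_ring av) = 1"
    and prime_element: "\<pp> \<in> prime_ideal av" "\<And>x. x \<in> prime_ideal av \<Longrightarrow> av x \<le> av \<pp>"
    and c_pos: "c \<ge> 1"
    and card_residue_field: "card (residue_classes av) = CHAR('a) ^ c"
    and eps_0: "\<epsilon> 0 = 1"
    and eps_unit: "\<And>k. k < c \<Longrightarrow> \<epsilon> k \<in> integer_ring av - prime_ideal av"
    and eps_independent:
      "\<And>a :: nat \<Rightarrow> nat. (\<And>k. k < c \<Longrightarrow> a k < CHAR('a)) \<Longrightarrow>
         (\<Sum>k<c. of_nat (a k) * \<epsilon> k) \<in> prime_ideal av \<Longrightarrow> (\<And>k. k < c \<Longrightarrow> a k = 0)"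
    and eps_spanning:
      "\<And>x. x \<in> integer_ring av \<Longrightarrow>
         \<exists>a :: nat \<Rightarrow> nat. (\<forall>k<c. a k < CHAR('a)) \<and>
           x - (\<Sum>k<c. of_nat (a k) * \<epsilon> k) \<in> prime_ideal av"
begin

definition q :: nat where
  "q = CHAR('a) ^ c"

definition u_digit :: "nat \<Rightarrow> 'a" where
  "u_digit n = (\<Sum>k<c. of_nat ((n div CHAR('a) ^ k) mod CHAR('a)) * \<epsilon> k) * inverse \<pp>"

text \<open>
  \<open>(n div q ^ k) mod q\<close> is the \<open>k\<close>-th base \<open>q\<close> digit of \<open>n\<close>.  Letting \<open>k\<close> run up to \<open>n\<close> includes all
  nonzero digits, and the superfluous terms vanish since \<open>u_digit 0 = 0\<close>.
\<close>

definition u :: "nat \<Rightarrow> 'a" where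
  "u n = (\<Sum>k\<le>n. u_digit ((n div q ^ k) mod q) * inverse \<pp> ^ k)"

text \<open>
  Elements of \<open>L\<^sup>2(K)\<close> are represented by Borel functions; everything below depends on them only
  up to equality almost everywhere.
\<close>

definition L2 :: "('a \<Rightarrow> complex) set" where
  "L2 = {f \<in> borel_measurable M. integrable M (\<lambda>x. (cmod (f x))\<^sup>2)}"

definition L2_inner :: "('a \<Rightarrow> complex) \<Rightarrow> ('a \<Rightarrow> complex) \<Rightarrow> complex" where
  "L2_inner f g = (\<integral>x. f x * cnj (g x) \<partial>M)"

definition L2_norm :: "('a \<Rightarrow> complex) \<Rightarrow> real" where
  "L2_norm f = sqrt (\<integral>x. (cmod (f x))\<^sup>2 \<partial>M)"

definition dilation :: "int \<Rightarrow> ('a \<Rightarrow> complex) \<Rightarrow> 'a \<Rightarrow> complex" where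
  "dilation j f = (\<lambda>x. of_real (real q powr (real_of_int j / 2)) * f (\<pp> powi (- j) * x))"

definition translation :: "'a \<Rightarrow> ('a \<Rightarrow> complex) \<Rightarrow> 'a \<Rightarrow> complex" where
  "translation y f = (\<lambda>x. f (x - y))"

definition affine_elem :: "('a \<Rightarrow> complex) \<Rightarrow> int \<Rightarrow> nat \<Rightarrow> 'a \<Rightarrow> complex" where
  "affine_elem f j k = dilation j (translation (u k) f)"

definition quasi_affine_elem :: "('a \<Rightarrow> complex) \<Rightarrow> int \<Rightarrow> nat \<Rightarrow> 'a \<Rightarrow> complex" where
  "quasi_affine_elem f j k =
     (if j \<ge> 0 then dilation j (translation (u k) f)
      else (\<lambda>x. of_real (real q powr (real_of_int j / 2)) * translation (u k) (dilation j f) x))"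

text \<open>
  A family \<open>\<psi>\<^sup>1, \<dots>, \<psi>\<^sup>L\<close> is a function on \<open>nat\<close> of which only the values on \<open>{1..L}\<close> are used.
  The Bessel sum has nonnegative terms and is taken in \<open>ennreal\<close>, where it always exists.
\<close>

definition affine_bessel :: "nat \<Rightarrow> (nat \<Rightarrow> 'a \<Rightarrow> complex) \<Rightarrow> bool" where
  "affine_bessel L \<psi> \<longleftrightarrow>
     (\<exists>B>0. \<forall>f \<in> L2.
        (\<Sum>l=1..L. \<Sum>\<^sub>\<infinity>j\<in>UNIV. \<Sum>\<^sub>\<infinity>k\<in>UNIV. ennreal ((cmod (L2_inner f (affine_elem (\<psi> l) j k)))\<^sup>2))
          \<le> ennreal (B * (L2_norm f)\<^sup>2))"

text \<open>
  The duality sums are asserted to converge (unconditionally) over the whole index set; a plain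
  \<open>infsum\<close> would silently be \<open>0\<close> in case of divergence.
\<close>

definition affine_dual ::
    "nat \<Rightarrow> (nat \<Rightarrow> 'a \<Rightarrow> complex) \<Rightarrow> (nat \<Rightarrow> 'a \<Rightarrow> complex) \<Rightarrow> bool" where
  "affine_dual L \<phi> \<psi> \<longleftrightarrow>
     (\<forall>l \<in> {1..L}. \<psi> l \<in> L2 \<and> \<phi> l \<in> L2) \<and>
     affine_bessel L \<psi> \<and> affine_bessel L \<phi> \<and>
     (\<forall>f \<in> L2. \<forall>g \<in> L2.
        ((\<lambda>(l, j, k). L2_inner f (affine_elem (\<psi> l) j k) * L2_inner (affine_elem (\<phi> l) j k) g)
          has_sum L2_inner f g) ({1..L} \<times> UNIV \<times> UNIV))"

definition quasi_affine_dual ::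
    "nat \<Rightarrow> (nat \<Rightarrow> 'a \<Rightarrow> complex) \<Rightarrow> (nat \<Rightarrow> 'a \<Rightarrow> complex) \<Rightarrow> bool" where
  "quasi_affine_dual L \<phi> \<psi> \<longleftrightarrow>
     (\<forall>l \<in> {1..L}. \<psi> l \<in> L2 \<and> \<phi> l \<in> L2) \<and>
     affine_bessel L \<psi> \<and> affine_bessel L \<phi> \<and>
     (\<forall>f \<in> L2. \<forall>g \<in> L2.
        ((\<lambda>(l, j, k). L2_inner f (quasi_affine_elem (\<psi> l) j k) * L2_inner (quasi_affine_elem (\<phi> l) j k) g)
          has_sum L2_inner f g) ({1..L} \<times> UNIV \<times> UNIV))"

end

end

theory Submission
  imports Defs "HOL-Computational_Algebra.Primes"
begin

text \<open>
  Everything rests on comparing the sum over the levels \<open>j \<ge> -N\<close>, as \<open>N \<rightarrow> \<infinity>\<close>, with the full sum, for \<open>f\<close>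
  and \<open>g\<close> indicators of balls; density and the Bessel bounds then give the general case.  In
  characteristic \<open>p\<close> the translation set \<open>\<Lambda> = {u k}\<close> is a group with \<open>\<pp>\<^sup>-\<^sup>1 \<Lambda> \<subseteq> \<Lambda>\<close> of index \<open>q\<close>, so for
  \<open>j \<ge> -N\<close> the quasi-affine sum at level \<open>j\<close> is the average of the affine sums of the translates of
  \<open>f\<close>, \<open>g\<close> by representatives of \<open>\<Lambda> / \<pp>\<^sup>-\<^sup>N \<Lambda>\<close>.

  From affine to quasi-affine: average the affine identity over these translates.  The averaged
  remainder \<open>j < -N\<close> is \<open>q\<^sup>-\<^sup>N\<close> times a sum of squared norms of conditional expectations of \<open>\<psi>\<^sup>l\<close> (and \<open>\<phi>\<^sup>l\<close>)
  over balls.  That sum grows at most linearly in \<open>N\<close>: its increments telescope because the squared norms of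
  the conditional expectations increase with the level and are bounded by \<open>\<parallel>\<psi>\<^sup>l\<parallel>\<^sup>2\<close>, and for \<open>N = 0\<close> it is
  controlled by the Bessel bound.

  From quasi-affine to affine: apply the quasi-affine identity to the dilates of \<open>f\<close>, \<open>g\<close> by \<open>\<pp>\<^sup>N\<close>.  The
  levels \<open>j \<ge> 0\<close> become the affine levels \<open>j \<ge> -N\<close> of \<open>f\<close>, \<open>g\<close>, and the levels \<open>j < 0\<close> only see \<open>\<psi>\<^sup>l\<close> and \<open>\<phi>\<^sup>l\<close>
  on sets shrinking to a countable set.
\<close>

subsection \<open>Preliminaries\<close>

text \<open>The hypotheses give \<open>av\<close> only as the factor by which multiplication scales
  Haar measure, so multiplicativity, the ultrametric inequality and the fact that \<open>av\<close>
  defines the topology are all derived. Characteristic p enters there through the Frobenius map, and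
  again through digit addition without carries, which makes the translation set a group.

  In the duality argument the Bessel bound alone leaves only a bounded remainder for each translate,
  and since the set of translates grows with N, convergence for each fixed translate does not help.
  What is controlled is the total over all q^N translates: it is at most linear in N, and division
  by q^N wins. In the converse direction the average cannot be undone. Dilation replaces it: it is
  unitary and moves the break at j = 0, above which the two systems agree, to -N.

  In both directions the products of coefficients in the remainder are bounded by half the sum of
  the squares, so the two families separate and every estimate concerns a single function h.\<close>

lemma open_compact_multipliers:
  fixes U X :: "'a :: {topological_space, topological_semigroup_mult} set"
  assumes "compact X" "open U"
  shows "open {a. \<forall>x\<in>X. a * x \<in> U}"
proof (subst open_subopen, intro ballI)
  fix a assume a: "a \<in> {a. \<forall>x\<in>X. a * x \<in> U}"
  have op: "open ((\<lambda>z. fst z * snd z) -` U :: ('a \<times> 'a) set)"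
    using assms(2) by (intro open_vimage) (auto intro!: continuous_intros)
  have "\<forall>x\<in>X. \<exists>A B. open A \<and> open B \<and> a \<in> A \<and> x \<in> B \<and> (\<forall>y\<in>A. \<forall>z\<in>B. y * z \<in> U)"
  proof
    fix x assume "x \<in> X"
    with a have "(a, x) \<in> (\<lambda>z. fst z * snd z) -` U" by auto
    from open_prod_elim[OF op this] obtain A B where
      "open A" "open B" "(a, x) \<in> A \<times> B" "A \<times> B \<subseteq> (\<lambda>z. fst z * snd z) -` U" by metis
    then show "\<exists>A B. open A \<and> open B \<and> a \<in> A \<and> x \<in> B \<and> (\<forall>y\<in>A. \<forall>z\<in>B. y * z \<in> U)"
      by (intro exI[of _ A] exI[of _ B]) auto
  qed
  then obtain A B where AB: "\<And>x. x \<in> X \<Longrightarrow> open (A x) \<and> open (B x) \<and> a \<in> A x \<and> x \<in> B x \<and>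
      (\<forall>y\<in>A x. \<forall>z\<in>B x. y * z \<in> U)" by metis
  \<comment> \<open>Tube lemma: finitely many of the \<open>B x\<close> cover X, and the
    intersection of the corresponding \<open>A x\<close> is the neighbourhood of a that is
    sought.\<close>
  obtain C where C: "C \<subseteq> X" "finite C" "X \<subseteq> (\<Union>c\<in>C. B c)"
    using compactE_image[OF assms(1), of X B] AB by (metis (no_types, lifting) UN_iff subsetI)
  show "\<exists>T. open T \<and> a \<in> T \<and> T \<subseteq> {a. \<forall>x\<in>X. a * x \<in> U}"
  proof (intro exI conjI)
    show "open (\<Inter>c\<in>C. A c)" using C AB by (intro open_INT) auto
    show "a \<in> (\<Inter>c\<in>C. A c)" using C AB by auto
    show "(\<Inter>c\<in>C. A c) \<subseteq> {a. \<forall>x\<in>X. a * x \<in> U}"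
    proof safe
      fix b x assume "b \<in> (\<Inter>c\<in>C. A c)" "x \<in> X"
      then obtain c where "c \<in> C" "x \<in> B c" "b \<in> A c" using C by blast
      then show "b * x \<in> U" using AB C by blast
    qed
  qed
qed

lemma not_open_zero: "\<not> open {0 :: 'a :: local_field}"
proof
  assume o: "open {0 :: 'a}"
  have "open {x}" for x :: 'a
  proof -
    have "open ((\<lambda>y. y - x) -` {0})" by (intro open_vimage o) (auto intro!: continuous_intros)
    also have "(\<lambda>y. y - x) -` {0} = {x}" by auto
    finally show ?thesis .
  qed
  then have "open S" for S :: "'a set"
    using open_UN[of S "\<lambda>x. {x}"] by simp
  with nondiscrete show False by blast
qed

lemma open_zero_infinite:
  fixes U :: "'a :: local_field set"
  assumes "open U" "0 \<in> U"
  shows "infinite U"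
proof
  assume "finite U"
  then have "closed (U - {0})" by (simp add: finite_imp_closed)
  then have "open (U - (U - {0}))" using assms(1) by (rule open_Diff[rotated])
  also have "U - (U - {0}) = {0}" using assms by auto
  finally show False using not_open_zero by blast
qed

lemma continuous_inverse_punctured: "continuous_on (- {0}) (inverse :: 'a :: local_field \<Rightarrow> 'a)"
proof (intro continuous_at_imp_continuous_on ballI)
  fix a :: 'a assume "a \<in> - {0}"
  then have "filterlim inverse (nhds (inverse a)) (nhds a)"
    using tendsto_inverse_nhds by auto
  then show "isCont inverse a"
    unfolding continuous_at by (metis at_within_def filterlim_mono inf_le1 order_refl)
qed

section \<open>Base p digits and multiples of the characteristic\<close>

lemma digits_exist:
  fixes a :: "nat \<Rightarrow> nat"
  assumes "p > 0" "\<And>k. k < c \<Longrightarrow> a k < p"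
  shows "\<exists>n<p ^ c. \<forall>k<c. (n div p ^ k) mod p = a k"
  using assms(2)
proof (induction c arbitrary: a)
  case 0
  then show ?case by auto
next
  case (Suc c)
  obtain n where n: "n < p ^ c" "\<And>k. k < c \<Longrightarrow> (n div p ^ k) mod p = a (Suc k)"
    using Suc.IH[of "\<lambda>k. a (Suc k)"] Suc.prems by auto
  have a0: "a 0 < p" using Suc.prems by auto
  have "a 0 + p * n < p * (n + 1)" using a0 by simp
  also have "\<dots> \<le> p * p ^ c" using n by (intro mult_left_mono) auto
  finally have lt: "a 0 + p * n < p ^ Suc c" by simp
  have "((a 0 + p * n) div p ^ k) mod p = a k" if "k < Suc c" for k
  proof (cases k)
    case 0
    then show ?thesis using a0 by simp
  next
    case (Suc k')
    have "(a 0 + p * n) div p ^ k = (a 0 + p * n) div p div p ^ k'"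
      unfolding Suc by (simp add: div_mult2_eq)
    also have "(a 0 + p * n) div p = n" using a0 by simp
    finally show ?thesis using n that Suc by simp
  qed
  with lt show ?case by blast
qed

lemma digits_eqD:
  fixes m n p :: nat
  assumes "m < p ^ c" "n < p ^ c" "\<And>k. k < c \<Longrightarrow> (m div p ^ k) mod p = (n div p ^ k) mod p"
  shows "m = n"
  using assms
proof (induction c arbitrary: m n)
  case (Suc c)
  have "m div p < p ^ c" "n div p < p ^ c"
    using Suc.prems by (simp_all add: less_mult_imp_div_less mult.commute)
  moreover have "(m div p div p ^ k) mod p = (n div p div p ^ k) mod p" if "k < c" for k
    using Suc.prems(3)[of "Suc k"] that by (simp add: div_mult2_eq)
  ultimately have "m div p = n div p" by (rule Suc.IH)
  moreover have "m mod p = n mod p" using Suc.prems(3)[of 0] by simp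
  ultimately show ?case by (metis div_mult_mod_eq)
qed auto

lemma of_nat_mod_CHAR: "of_nat (n mod CHAR('a)) = (of_nat n :: 'a :: semiring_1)"
proof -
  have "of_nat n = (of_nat (CHAR('a) * (n div CHAR('a)) + n mod CHAR('a)) :: 'a)" by simp
  also have "\<dots> = of_nat (n mod CHAR('a))" by (simp only: of_nat_add of_nat_mult of_nat_CHAR) simp
  finally show ?thesis by simp
qed

section \<open>Unconditionally convergent sums\<close>

lemma infsum_le_if_finite_sums_le:
  fixes f :: "'b \<Rightarrow> real"
  assumes "\<And>i. i \<in> I \<Longrightarrow> f i \<ge> 0" "\<And>F. finite F \<Longrightarrow> F \<subseteq> I \<Longrightarrow> sum f F \<le> b"
  shows "f summable_on I" "infsum f I \<le> b"
proof -
  show s: "f summable_on I"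
    by (rule nonneg_bdd_above_summable_on) (use assms in \<open>auto intro!: bdd_aboveI2[where M = b]\<close>)
  show "infsum f I \<le> b" by (rule infsum_le_finite_sums[OF s assms(2)])
qed

text \<open>A finite set carries all but e/2 of the sum of the norms, and \<open>J N\<close>
  eventually contains it. The exhaustions used later are by the levels j >= -N.\<close>

lemma infsum_tendsto_exhaustion:
  fixes f :: "'b \<Rightarrow> 'c :: banach"
  assumes abs: "(\<lambda>i. norm (f i)) summable_on I"
    and sub: "\<And>N :: nat. J N \<subseteq> I"
    and exh: "\<And>i. i \<in> I \<Longrightarrow> \<forall>\<^sub>F N in sequentially. i \<in> J N"
  shows "(\<lambda>N. infsum f (J N)) \<longlonglongrightarrow> infsum f I"
proof (rule metric_LIMSEQ_I)
  fix e :: real assume e: "e > 0"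
  obtain F where F: "finite F" "F \<subseteq> I" "dist (\<Sum>i\<in>F. norm (f i)) (\<Sum>\<^sub>\<infinity>i\<in>I. norm (f i)) \<le> e / 2"
    using infsum_finite_approximation[OF abs, of "e / 2"] e by auto
  have "\<forall>\<^sub>F N in sequentially. \<forall>i\<in>F. i \<in> J N"
    using F exh by (intro eventually_ball_finite) auto
  then obtain N0 where N0: "\<And>N. N \<ge> N0 \<Longrightarrow> F \<subseteq> J N"
    unfolding eventually_sequentially by blast
  have sumN: "(\<lambda>i. norm (f i)) summable_on A" if "A \<subseteq> I" for A
    using summable_on_subset_banach[OF abs that] .
  have fsum: "f summable_on A" if "A \<subseteq> I" for A
    using abs_summable_summable[OF sumN[OF that]] .
  show "\<exists>N0. \<forall>N\<ge>N0. dist (infsum f (J N)) (infsum f I) < e"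
  proof (intro exI allI impI)
    fix N assume "N \<ge> N0"
    then have FN: "F \<subseteq> J N" using N0 by blast
    have "infsum f (J N \<union> (I - J N)) = infsum f (J N) + infsum f (I - J N)"
      using sub[of N] by (intro infsum_Un_disjoint fsum) auto
    then have "infsum f I - infsum f (J N) = infsum f (I - J N)"
      using sub[of N] by (simp add: Un_absorb1)
    then have "dist (infsum f (J N)) (infsum f I) = norm (infsum f (I - J N))"
      by (simp add: dist_norm norm_minus_commute)
    also have "\<dots> \<le> (\<Sum>\<^sub>\<infinity>i\<in>I - J N. norm (f i))"
      by (rule norm_infsum_bound, rule sumN) auto
    also have "\<dots> \<le> (\<Sum>\<^sub>\<infinity>i\<in>I - F. norm (f i))"
      by (rule infsum_mono_neutral) (use FN in \<open>auto intro!: sumN\<close>)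
    also have "\<dots> = (\<Sum>\<^sub>\<infinity>i\<in>I. norm (f i)) - (\<Sum>i\<in>F. norm (f i))"
    proof -
      have "(\<Sum>\<^sub>\<infinity>i\<in>F \<union> (I - F). norm (f i)) = (\<Sum>\<^sub>\<infinity>i\<in>F. norm (f i)) + (\<Sum>\<^sub>\<infinity>i\<in>I - F. norm (f i))"
        by (rule infsum_Un_disjoint) (use F in \<open>auto intro!: sumN\<close>)
      then show ?thesis using F by (simp add: Un_absorb1)
    qed
    also have "\<dots> \<le> e / 2" using F(3) unfolding dist_real_def by linarith
    finally show "dist (infsum f (J N)) (infsum f I) < e" using e by simp
  qed
qed

lemma infsum_sum_swap:
  fixes F :: "'i \<Rightarrow> 'b \<Rightarrow> 'c :: banach"
  assumes "finite R" "\<And>r. r \<in> R \<Longrightarrow> F r summable_on A"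
  shows "(\<Sum>r\<in>R. infsum (F r) A) = (\<Sum>\<^sub>\<infinity>x\<in>A. \<Sum>r\<in>R. F r x)"
    and "(\<lambda>x. \<Sum>r\<in>R. F r x) summable_on A"
proof -
  have "((\<lambda>x. \<Sum>r\<in>R. F r x) has_sum (\<Sum>r\<in>R. infsum (F r) A)) A"
    using assms by (induction R rule: finite_induct) (auto intro: has_sum_add)
  then show "(\<Sum>r\<in>R. infsum (F r) A) = (\<Sum>\<^sub>\<infinity>x\<in>A. \<Sum>r\<in>R. F r x)"
    and "(\<lambda>x. \<Sum>r\<in>R. F r x) summable_on A"
    using infsumI has_sum_imp_summable by metis+
qed

lemma infsum_triple:
  fixes F :: "'i \<times> 'j \<times> 'k \<Rightarrow> 'c :: banach"
  assumes "(\<lambda>i. norm (F i)) summable_on (A \<times> B \<times> C)"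
  shows "infsum F (A \<times> B \<times> C) = (\<Sum>\<^sub>\<infinity>l\<in>A. \<Sum>\<^sub>\<infinity>j\<in>B. \<Sum>\<^sub>\<infinity>k\<in>C. F (l, j, k))"
    and "\<And>l. l \<in> A \<Longrightarrow> (\<lambda>x. norm (F (l, x))) summable_on (B \<times> C)"
    and "\<And>l j. l \<in> A \<Longrightarrow> j \<in> B \<Longrightarrow> (\<lambda>k. norm (F (l, j, k))) summable_on C"
proof -
  show slice: "(\<lambda>x. norm (F (l, x))) summable_on (B \<times> C)" if "l \<in> A" for l
    using assms that unfolding Infinite_Sum.abs_summable_on_Sigma_iff[of F A] by blast
  show "(\<lambda>k. norm (F (l, j, k))) summable_on C" if "l \<in> A" "j \<in> B" for l j
    using slice[OF that(1)] that(2)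
    unfolding Infinite_Sum.abs_summable_on_Sigma_iff[of "\<lambda>x. F (l, x)" B] by blast
  have "infsum F (A \<times> B \<times> C) = (\<Sum>\<^sub>\<infinity>l\<in>A. infsum (\<lambda>x. F (l, x)) (B \<times> C))"
    by (rule infsum_Sigma_banach[symmetric]) (rule abs_summable_summable[OF assms])
  also have "\<dots> = (\<Sum>\<^sub>\<infinity>l\<in>A. \<Sum>\<^sub>\<infinity>j\<in>B. \<Sum>\<^sub>\<infinity>k\<in>C. F (l, j, k))"
  proof (intro infsum_cong)
    fix l assume "l \<in> A"
    from slice[OF this]
    show "infsum (\<lambda>x. F (l, x)) (B \<times> C) = (\<Sum>\<^sub>\<infinity>j\<in>B. \<Sum>\<^sub>\<infinity>k\<in>C. F (l, j, k))"
      by (rule infsum_Sigma_banach[symmetric, OF abs_summable_summable])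
  qed
  finally show "infsum F (A \<times> B \<times> C) = (\<Sum>\<^sub>\<infinity>l\<in>A. \<Sum>\<^sub>\<infinity>j\<in>B. \<Sum>\<^sub>\<infinity>k\<in>C. F (l, j, k))" .
qed

lemma summable_on_finite_box:
  fixes F :: "'i \<times> 'j \<times> 'k \<Rightarrow> 'c :: banach"
  assumes "finite A" "finite B" "\<And>l j. l \<in> A \<Longrightarrow> j \<in> B \<Longrightarrow> (\<lambda>k. norm (F (l, j, k))) summable_on C"
  shows "(\<lambda>i. norm (F i)) summable_on (A \<times> B \<times> C)"
proof -
  have "(\<lambda>x. norm (F (l, x))) summable_on (B \<times> C)" if "l \<in> A" for l
    unfolding Infinite_Sum.abs_summable_on_Sigma_iff[of "\<lambda>x. F (l, x)" B] using assms that by simp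
  then show ?thesis
    unfolding Infinite_Sum.abs_summable_on_Sigma_iff[of F A] using assms(1) by simp
qed

text \<open>Preferred to Cauchy-Schwarz for the remainders: the bound is linear in the two squares,
  so it is compatible with summation over translates.\<close>

lemma norm_mult_le_half_squares:
  fixes x y :: complex
  shows "norm (x * y) \<le> ((cmod x)\<^sup>2 + (cmod y)\<^sup>2) / 2"
  using sum_squares_bound[of "cmod x" "cmod y"] by (simp add: norm_mult)

lemma infsum_triple_summable:
  fixes F :: "'i \<times> 'j \<times> 'k \<Rightarrow> 'c :: banach"
  assumes "(\<lambda>i. norm (F i)) summable_on (A \<times> B \<times> C)" "l \<in> A"
  shows "(\<lambda>j. \<Sum>\<^sub>\<infinity>k\<in>C. F (l, j, k)) summable_on B"
  by (rule summable_on_Sigma_banach)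
     (use abs_summable_summable[OF infsum_triple(2)[OF assms]] in \<open>simp add: case_prod_unfold\<close>)

context local_field_char_p
begin

subsection \<open>The absolute value\<close>

lemma prime_char: "prime CHAR('a)"
  using char_pos prime_CHAR_semidom by blast

lemmas haar_conjuncts = haar[unfolded haar_measure_def]

lemma sets_M: "sets M = sets borel"
  by (rule haar_conjuncts[THEN conjunct1])

lemma space_M [simp]: "space M = UNIV"
  using sets_M sets_eq_imp_space_eq by (metis space_borel)

lemma open_sets_M: "open U \<Longrightarrow> U \<in> sets M"
  by (simp add: sets_M)

lemma emeasure_translate: "A \<in> sets M \<Longrightarrow> emeasure M ((\<lambda>x. a + x) ` A) = emeasure M A"
  by (rule haar_conjuncts[THEN conjunct2, THEN conjunct2, THEN conjunct1, rule_format])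
     (simp add: sets_M)

lemma emeasure_scale:
  "\<alpha> \<noteq> 0 \<Longrightarrow> A \<in> sets M \<Longrightarrow> emeasure M ((\<lambda>x. \<alpha> * x) ` A) = ennreal (av \<alpha>) * emeasure M A"
  using absolute_value by (simp add: haar_absolute_value_def sets_M)

lemma emeasure_UNIV_nonzero: "emeasure M UNIV \<noteq> 0"
  by (rule haar_conjuncts[THEN conjunct2, THEN conjunct1])

lemma emeasure_compact_finite: "compact C \<Longrightarrow> emeasure M C < \<infinity>"
  by (rule haar_conjuncts[THEN conjunct2, THEN conjunct2, THEN conjunct2, THEN conjunct1, rule_format])

lemma outer_regular: "A \<in> sets M \<Longrightarrow> emeasure M A = (INF U \<in> {U. open U \<and> A \<subseteq> U}. emeasure M U)"
  by (rule haar_conjuncts[THEN conjunct2, THEN conjunct2, THEN conjunct2, THEN conjunct2,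
        THEN conjunct1, rule_format]) (simp add: sets_M)

lemma inner_regular: "open U \<Longrightarrow> emeasure M U = (SUP C \<in> {C. compact C \<and> C \<subseteq> U}. emeasure M C)"
  by (rule haar_conjuncts[THEN conjunct2, THEN conjunct2, THEN conjunct2, THEN conjunct2,
        THEN conjunct2, rule_format])

lemma av_0 [simp]: "av 0 = 0"
  using absolute_value by (simp add: haar_absolute_value_def)

lemma av_pos: "\<alpha> \<noteq> 0 \<Longrightarrow> av \<alpha> > 0"
proof (rule ccontr)
  assume a: "\<alpha> \<noteq> 0" and "\<not> av \<alpha> > 0"
  \<comment> \<open>\<open>ennreal\<close> sends negative numbers to 0, so a negative factor is
    excluded in the same way as 0: K = \<alpha> K would be a null set.\<close>
  then have "ennreal (av \<alpha>) = 0" by (simp add: ennreal_neg)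
  then have "emeasure M ((\<lambda>x. \<alpha> * x) ` UNIV) = 0"
    using emeasure_scale[OF a, of UNIV] by (simp add: sets_M)
  moreover have "(\<lambda>x. \<alpha> * x) ` UNIV = UNIV"
  proof -
    have "x \<in> range (\<lambda>x. \<alpha> * x)" for x by (rule image_eqI[of _ _ "x / \<alpha>"]) (use a in auto)
    then show ?thesis by auto
  qed
  ultimately show False using emeasure_UNIV_nonzero by simp
qed

lemma av_nonneg [simp]: "av x \<ge> 0"
  by (cases "x = 0") (auto simp: less_imp_le av_pos)

lemma av_eq_0_iff [simp]: "av x = 0 \<longleftrightarrow> x = 0"
  using av_pos by (metis av_0 less_irrefl)

text \<open>A set that is not measurable has \<open>emeasure\<close> 0 by convention, so measure 1
  forces measurability. No relation between \<open>av\<close> and the topology is known yet.\<close>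

lemma integer_ring_sets: "integer_ring av \<in> sets M"
  using normalised emeasure_notin_sets by fastforce

lemma scale_sets: "\<alpha> \<noteq> 0 \<Longrightarrow> A \<in> sets M \<Longrightarrow> (\<lambda>x. \<alpha> * x) ` A \<in> sets M"
proof -
  assume a: "\<alpha> \<noteq> 0" and A: "A \<in> sets M"
  have "(\<lambda>x. \<alpha> * x) ` A = (\<lambda>x. inverse \<alpha> * x) -` A \<inter> space borel"
    using a by (auto simp: image_iff field_simps intro!: bexI[of _ "inverse \<alpha> * _"])
  also have "\<dots> \<in> sets borel"
    by (rule measurable_sets[OF borel_measurable_continuous_onI])
       (use A in \<open>auto simp: sets_M intro!: continuous_intros\<close>)
  finally show ?thesis by (simp add: sets_M)
qed

text \<open>Compare the measures of (a b) D and a (b D); D has measure 1, so only the factors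
  remain.\<close>

lemma av_mult: "av (a * b) = av a * av b"
proof (cases "a = 0 \<or> b = 0")
  case False
  let ?D = "integer_ring av"
  have "ennreal (av (a * b)) = emeasure M ((\<lambda>x. (a * b) * x) ` ?D)"
    using emeasure_scale[of "a * b" ?D] False integer_ring_sets normalised by simp
  also have "(\<lambda>x. (a * b) * x) ` ?D = (\<lambda>x. a * x) ` (\<lambda>x. b * x) ` ?D"
    by (simp add: image_image mult.assoc)
  also have "emeasure M \<dots> = ennreal (av a) * ennreal (av b)"
    using emeasure_scale False integer_ring_sets normalised scale_sets by simp
  also have "\<dots> = ennreal (av a * av b)" by (simp add: ennreal_mult)
  finally show ?thesis by (simp add: ennreal_inj)
qed auto

lemma av_1 [simp]: "av 1 = 1"
  using av_mult[of 1 1] by (metis av_eq_0_iff mult_cancel_left1 mult_1 zero_neq_one)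

lemma av_power: "av (x ^ n) = av x ^ n"
  by (induction n) (auto simp: av_mult)

lemma av_inverse: "av (inverse x) = inverse (av x)"
proof (cases "x = 0")
  case False
  then have "av (inverse x) * av x = 1" by (metis av_1 av_mult left_inverse)
  then show ?thesis by (simp add: inverse_eq_divide eq_divide_eq False)
qed auto

lemma av_divide: "av (x / y) = av x / av y"
  by (simp add: divide_inverse av_mult av_inverse)

text \<open>By translation invariance all points have the same mass, and a compact neighbourhood of
  0 contains infinitely many points but has finite measure.\<close>

lemma emeasure_singleton: "emeasure M {x} = 0"
proof -
  have sing: "{y} \<in> sets M" for y by (simp add: sets_M)
  have eq: "emeasure M {y} = emeasure M {0}" for y
    using emeasure_translate[OF sing, of y 0] by simp
  obtain U C where UC: "open U" "compact C" "(0::'a) \<in> U" "U \<subseteq> C" using locally_compact by blast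
  have inf: "infinite C" using open_zero_infinite[OF UC(1,3)] finite_subset[OF UC(4)] by blast
  have le: "of_nat n * emeasure M {0} \<le> emeasure M C" for n
  proof -
    obtain F where F: "finite F" "card F = n" "F \<subseteq> C" using infinite_arbitrarily_large[OF inf] by blast
    have "of_nat n * emeasure M {0} = (\<Sum>y\<in>F. emeasure M {y})"
    proof -
      have "(\<Sum>y\<in>F. emeasure M {y}) = (\<Sum>y\<in>F. emeasure M {0})" by (intro sum.cong refl eq)
      then show ?thesis using F by simp
    qed
    also have "\<dots> = emeasure M (\<Union>y\<in>F. {y})"
      by (rule sum_emeasure) (use F sing in \<open>auto simp: disjoint_family_on_def\<close>)
    also have "\<dots> \<le> emeasure M C"
      by (rule emeasure_mono) (use F UC in \<open>auto simp: sets_M borel_compact\<close>)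
    finally show ?thesis .
  qed
  have fin: "emeasure M C < \<infinity>" using UC emeasure_compact_finite by blast
  have "emeasure M {0} = 0"
  proof (rule ccontr)
    assume "emeasure M {0} \<noteq> 0"
    then have S: "(SUP n. of_nat n * emeasure M {0}) = \<infinity>"
      by (simp add: SUP_mult_right_ennreal[symmetric] ennreal_SUP_of_nat_eq_top ennreal_top_mult)
    have "\<infinity> \<le> emeasure M C"
      unfolding S[symmetric] by (rule SUP_least) (rule le)
    then show False using fin by (simp add: leD)
  qed
  then show ?thesis using eq[of x] by simp
qed

text \<open>Upper semicontinuity of \<open>av\<close>. With X compact of positive measure m, the set
  a X has measure \<open>av a\<close> m. Outer regularity puts it into an open U of measure below t
  m, and b X stays inside U for all b near a.\<close>

lemma open_av_less: "open {x. av x < t}"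
proof (subst open_subopen, intro ballI)
  fix a assume a: "a \<in> {x. av x < t}"
  obtain X where X: "compact X" "emeasure M X \<noteq> 0"
  proof -
    have "emeasure M UNIV = (SUP C \<in> {C. compact C \<and> C \<subseteq> UNIV}. emeasure M C)"
      by (rule inner_regular) simp
    moreover have "0 < emeasure M UNIV" using emeasure_UNIV_nonzero by (simp add: zero_less_iff_neq_zero)
    ultimately have "\<exists>C. compact C \<and> 0 < emeasure M C"
      by (auto simp: less_SUP_iff)
    then show ?thesis using that by (auto simp: zero_less_iff_neq_zero)
  qed
  define m where "m = measure M X"
  have fin: "emeasure M X < \<infinity>" using X emeasure_compact_finite by blast
  have m: "emeasure M X = ennreal m" "m > 0"
    using X fin by (auto simp: m_def emeasure_eq_ennreal_measure zero_less_measure_iff less_top)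
  have Xs: "X \<in> sets M" using X(1) by (simp add: sets_M borel_compact)
  have aX: "emeasure M ((\<lambda>x. a * x) ` X) = ennreal (av a * m)"
  \<comment> \<open>The scaling law is assumed only for nonzero factors; for a = 0 the image is a
    point, which is null.\<close>
  proof (cases "a = 0")
    case True
    have "X \<noteq> {}" using X by auto
    then have "(\<lambda>x. a * x) ` X = {0}" using True by auto
    then show ?thesis by (simp add: emeasure_singleton True)
  next
    case False
    then show ?thesis using emeasure_scale[OF False Xs] m by (simp add: ennreal_mult)
  qed
  have aXs: "(\<lambda>x. a * x) ` X \<in> sets M"
    unfolding sets_M by (intro borel_compact compact_continuous_image X(1) continuous_intros)
  have "emeasure M ((\<lambda>x. a * x) ` X) < ennreal (t * m)"
    unfolding aX using a m by (auto simp: ennreal_less_iff)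
  then obtain U where U: "open U" "(\<lambda>x. a * x) ` X \<subseteq> U" "emeasure M U < ennreal (t * m)"
    unfolding outer_regular[OF aXs] INF_less_iff by auto
  show "\<exists>T. open T \<and> a \<in> T \<and> T \<subseteq> {x. av x < t}"
  proof (intro exI conjI)
    show "open {b. \<forall>x\<in>X. b * x \<in> U}" by (rule open_compact_multipliers[OF X(1) U(1)])
    show "a \<in> {b. \<forall>x\<in>X. b * x \<in> U}" using U by auto
    show "{b. \<forall>x\<in>X. b * x \<in> U} \<subseteq> {x. av x < t}"
    proof safe
      fix b assume b: "\<forall>x\<in>X. b * x \<in> U"
      show "av b < t"
      proof (cases "b = 0")
        case False
        have "ennreal (av b * m) = emeasure M ((\<lambda>x. b * x) ` X)"
          using emeasure_scale[OF False Xs] m by (simp add: ennreal_mult)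
        also have "\<dots> \<le> emeasure M U" by (rule emeasure_mono) (use b U sets_M in auto)
        also note U(3)
        finally show ?thesis using m by (simp add: ennreal_less_iff)
      next
        case True
        have "t > 0" using a av_nonneg[of a] by (metis (lifting) le_less_trans mem_Collect_eq)
        then show ?thesis using True by simp
      qed
    qed
  qed
qed

lemma av_bounded_on_compact:
  assumes "compact X"
  obtains b where "b > 0" "\<And>x. x \<in> X \<Longrightarrow> av x < b"
proof -
  have "X \<subseteq> (\<Union>n\<in>UNIV. {x. av x < real n})" using reals_Archimedean2 by auto
  then obtain C where C: "finite C" "X \<subseteq> (\<Union>n\<in>C. {x. av x < real n})"
    using compactE_image[OF assms, of UNIV "\<lambda>n. {x. av x < real n}"] open_av_less by metis
  show ?thesis
  proof (rule that[of "real (Max (insert 1 C))"])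
    show "real (Max (insert 1 C)) > 0"
      using Max_ge[of "insert 1 C" 1] C by (simp add: Suc_le_eq)
    fix x assume "x \<in> X"
    then obtain n where "n \<in> C" "av x < real n" using C by auto
    moreover have "real n \<le> real (Max (insert 1 C))" using C \<open>n \<in> C\<close> by simp
    ultimately show "av x < real (Max (insert 1 C))" by linarith
  qed
qed

text \<open>Together with \<open>open_av_less\<close> this identifies the topology with the one
  given by \<open>av\<close>. Take r nonzero with \<open>av r\<close> < 1 and r V contained in U, U
  open inside the compact V. By compactness the sets r^n V shrink to 0. It remains to absorb the
  unit ball into a single r^-N V. If r^n x is the first iterate in U and n > 0, it lies in a compact
  set avoiding 0, so its absolute value is bounded below; being at most \<open>av r\<close> ^ n, it
  bounds n independently of x.\<close>

lemma av_nhds_zero: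
  assumes W: "open W" "0 \<in> W"
  obtains \<delta> where "\<delta> > 0" "\<And>y. av y \<le> \<delta> \<Longrightarrow> y \<in> W"
proof -
  obtain U V where UV: "open U" "compact V" "(0::'a) \<in> U" "U \<subseteq> V" using locally_compact by blast
  define O' where "O' = {r. \<forall>v\<in>V. r * v \<in> U} \<inter> {x. av x < 1} \<inter> U"
  have "open O'" unfolding O'_def
    by (intro open_Int open_compact_multipliers open_av_less UV)
  moreover have "0 \<in> O'" using UV by (auto simp: O'_def)
  ultimately have "infinite O'" by (rule open_zero_infinite)
  then obtain r where r: "r \<in> O'" "r \<noteq> 0"
    by (metis finite.emptyI finite.insertI finite_subset singletonI subsetI insertCI)
  then have r1: "av r < 1" and rV: "\<And>v. v \<in> V \<Longrightarrow> r * v \<in> U" and rU: "r \<in> U"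
    by (auto simp: O'_def)
  have ar: "av r > 0" using r av_pos by blast
  have powV: "r ^ n * v \<in> V" if "v \<in> V" for n v
    using that by (induction n) (use rV UV in \<open>auto simp: mult.assoc\<close>)
  have shrink: "\<exists>n. \<forall>v\<in>V. r ^ n * v \<in> W'" if W': "open W'" "0 \<in> W'" for W'
  proof -
    define Z where "Z n = (\<lambda>v. r ^ n * v) ` V" for n
    have Zc: "compact (Z n)" for n
      unfolding Z_def by (intro compact_continuous_image UV continuous_intros)
    have Zdec: "Z (n + k) \<subseteq> Z n" for n k
    proof
      fix z assume "z \<in> Z (n + k)"
      then obtain v where "v \<in> V" "z = r ^ n * (r ^ k * v)" by (auto simp: Z_def power_add mult.assoc)
      then show "z \<in> Z n" using powV by (auto simp: Z_def)
    qed
    obtain b where b: "b > 0" "\<And>x. x \<in> V \<Longrightarrow> av x < b" using av_bounded_on_compact[OF UV(2)] by metis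
    have zero: "z = 0" if zZ: "\<And>n. z \<in> Z n" for z
    proof (rule ccontr)
      assume "z \<noteq> 0"
      then have "av z / b > 0" using b av_pos by simp
      then obtain n where n: "av r ^ n < av z / b" using real_arch_pow_inv r1 by metis
      obtain v where "v \<in> V" "z = r ^ n * v" using zZ[of n] by (auto simp: Z_def)
      then have "av z \<le> av r ^ n * b" using b ar by (simp add: av_mult av_power less_imp_le)
      also have "\<dots> < av z" using n b by (simp add: field_simps)
      finally show False by simp
    qed
    have "V \<subseteq> (\<Union>n\<in>UNIV. W' \<union> - Z n)" using zero W' by blast
    moreover have "open (W' \<union> - Z n)" for n
      using W' compact_imp_closed[OF Zc] by (auto simp: open_Compl)
    ultimately obtain C where C: "finite C" "V \<subseteq> (\<Union>n\<in>C. W' \<union> - Z n)"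
      using compactE_image[OF UV(2), of UNIV "\<lambda>n. W' \<union> - Z n"] by metis
    define N where "N = Max (insert 0 C)"
    have "r ^ N * v \<in> W'" if v: "v \<in> V" for v
    proof -
      have "r ^ N * v \<in> V" using powV v by blast
      then obtain n where n: "n \<in> C" "r ^ N * v \<in> W' \<union> - Z n" using C by blast
      have "n \<le> N" using C n by (simp add: N_def)
      then have "Z N \<subseteq> Z n" using Zdec[of n "N - n"] by simp
      then show ?thesis using n v by (auto simp: Z_def)
    qed
    then show ?thesis by blast
  qed
  \<comment> \<open>A shell: an orbit that enters U at a positive exponent does so inside X. As X is
    compact without 0, the inverse is bounded on it.\<close>
  define X where "X = V - (\<lambda>v. r * v) ` U"
  have "(\<lambda>v. r * v) ` U = (\<lambda>x. inverse r * x) -` U"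
    using r by (auto simp: image_iff field_simps intro!: bexI[of _ "inverse r * _"])
  then have "open ((\<lambda>v. r * v) ` U)"
    using UV by (auto intro!: open_vimage continuous_intros)
  then have Xc: "compact X" unfolding X_def by (intro compact_diff UV)
  have X0: "0 \<notin> X" using UV by (auto simp: X_def)
  have "compact (inverse ` X)"
    by (rule compact_continuous_image[OF _ Xc])
       (rule continuous_on_subset[OF continuous_inverse_punctured], use X0 in auto)
  then obtain b where b: "b > 0" "\<And>x. x \<in> inverse ` X \<Longrightarrow> av x < b"
    using av_bounded_on_compact by metis
  obtain N where N: "av r ^ N < inverse b" using real_arch_pow_inv[OF positive_imp_inverse_positive[OF b(1)] r1] by blast
  have DN: "r ^ N * x \<in> V" if x: "av x \<le> 1" for x
  proof -
    have "open ((\<lambda>y. y * x) -` U)" "0 \<in> (\<lambda>y. y * x) -` U"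
      using UV by (auto intro!: open_vimage continuous_intros)
    from shrink[OF this] obtain n where n: "\<And>v. v \<in> V \<Longrightarrow> r ^ n * v \<in> (\<lambda>y. y * x) -` U" by blast
    have "r ^ Suc n * x \<in> U" using n[of r] rU UV by (auto simp: mult.commute)
    then have ex: "\<exists>\<nu>. r ^ \<nu> * x \<in> U" by blast
    define \<nu> where "\<nu> = (LEAST \<nu>. r ^ \<nu> * x \<in> U)"
    have \<nu>: "r ^ \<nu> * x \<in> U" unfolding \<nu>_def by (rule LeastI_ex[OF ex])
    have "\<nu> \<le> N"
    proof (cases \<nu>)
      case (Suc k)
      then have "r ^ k * x \<notin> U" using not_less_Least[of k "\<lambda>\<nu>. r ^ \<nu> * x \<in> U"] \<nu>_def by simp
      then have "r ^ \<nu> * x \<notin> (\<lambda>v. r * v) ` U" using r Suc by (auto simp: mult.assoc)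
      then have inX: "r ^ \<nu> * x \<in> X" using \<nu> UV by (auto simp: X_def)
      then have "av (inverse (r ^ \<nu> * x)) < b" using b by blast
      moreover have "r ^ \<nu> * x \<noteq> 0" using inX X0 by metis
      ultimately have "inverse (av (r ^ \<nu> * x)) < b" "av (r ^ \<nu> * x) > 0"
        using av_pos by (simp_all only: av_inverse)
      then have "1 < b * av (r ^ \<nu> * x)" by (simp only: field_simps)
      also have "\<dots> \<le> b * av r ^ \<nu>" using x b ar by (simp add: av_mult av_power mult_left_le)
      finally have "inverse b < av r ^ \<nu>" using b by (simp add: field_simps)
      then have "av r ^ N < av r ^ \<nu>" using N by linarith
      then show ?thesis using r1 ar by (meson less_imp_le linorder_not_le power_decreasing not_less)
    qed auto
    then have "r ^ N * x = r ^ (N - \<nu>) * (r ^ \<nu> * x)"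
      by (simp add: mult.assoc[symmetric] power_add[symmetric])
    also have "\<dots> \<in> V" using powV \<nu> UV by blast
    finally show ?thesis .
  qed
  obtain k where k: "\<And>v. v \<in> V \<Longrightarrow> r ^ k * v \<in> W" using shrink[OF W] by blast
  show ?thesis
  proof (rule that[of "av r ^ (k + N)"])
    show "av r ^ (k + N) > 0" using ar by simp
    fix y assume y: "av y \<le> av r ^ (k + N)"
    define x where "x = y / r ^ (k + N)"
    have "av x \<le> 1" using y ar by (simp add: x_def av_divide av_power divide_le_eq)
    then have "r ^ k * (r ^ N * x) \<in> W" using DN k by blast
    also have "r ^ k * (r ^ N * x) = y" using r by (simp add: x_def mult.assoc[symmetric] power_add)
    finally show "y \<in> W" .
  qed
qed

subsection \<open>The ring of integers and the translation lattice\<close>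

lemma char_ge_2: "CHAR('a) \<ge> 2"
  using prime_char prime_ge_2_nat by blast

lemma q_ge_2: "q \<ge> 2"
proof -
  have "CHAR('a) ^ 1 \<le> CHAR('a) ^ c" using char_pos c_pos by (intro power_increasing) auto
  then show ?thesis using char_ge_2 by (simp add: q_def)
qed

lemma q_pos [simp]: "q > 0"
  using q_ge_2 by simp

section \<open>Residue representatives and the ultrametric inequality\<close>

definition eps_comb :: "(nat \<Rightarrow> nat) \<Rightarrow> 'a" where
  "eps_comb a = (\<Sum>k<c. of_nat (a k) * \<epsilon> k)"

text \<open>The numerator of \<open>u_digit\<close>. Coefficients matter only modulo p, so the q
  values on \<open>{..<q}\<close> form an additive subgroup and not merely a set of representatives;
  the group properties of the translation set come from this.\<close>

definition resid :: "nat \<Rightarrow> 'a" where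
  "resid n = eps_comb (\<lambda>k. (n div CHAR('a) ^ k) mod CHAR('a))"

lemma eps_comb_add: "eps_comb a + eps_comb b = eps_comb (\<lambda>k. a k + b k)"
  by (simp add: eps_comb_def sum.distrib algebra_simps)

lemma eps_comb_mod: "eps_comb (\<lambda>k. a k mod CHAR('a)) = eps_comb a"
  by (simp add: eps_comb_def of_nat_mod_CHAR)

lemma resid_surj:
  obtains n where "n < q" "resid n = eps_comb a"
proof -
  obtain n where n: "n < CHAR('a) ^ c" "\<forall>k<c. (n div CHAR('a) ^ k) mod CHAR('a) = a k mod CHAR('a)"
    using digits_exist[of "CHAR('a)" c "\<lambda>k. a k mod CHAR('a)"] char_pos by auto
  have "resid n = eps_comb (\<lambda>k. a k mod CHAR('a))"
    unfolding resid_def eps_comb_def using n by (intro sum.cong) auto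
  then show ?thesis using that n by (simp add: eps_comb_mod q_def)
qed

lemma eps_comb_prime_ideal:
  assumes "eps_comb a \<in> prime_ideal av" "k < c"
  shows "a k mod CHAR('a) = 0"
proof -
  have "eps_comb (\<lambda>k. a k mod CHAR('a)) \<in> prime_ideal av" using assms by (simp add: eps_comb_mod)
  then show ?thesis
    unfolding eps_comb_def
    by (rule eps_independent[rotated]) (use char_pos assms(2) in auto)
qed

text \<open>Inside the prime ideal independence makes every coefficient divisible by p, so the
  combination is exactly 0 and not merely small.\<close>

lemma eps_comb_zero_or_unit: "eps_comb a = 0 \<or> av (eps_comb a) \<ge> 1"
proof (cases "eps_comb a \<in> prime_ideal av")
  case True
  have "eps_comb (\<lambda>k. a k mod CHAR('a)) = 0"
    unfolding eps_comb_def using eps_comb_prime_ideal[OF True] by (intro sum.neutral) simp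
  then show ?thesis by (simp add: eps_comb_mod)
qed (simp add: prime_ideal_def)

lemma av_one_plus_power: "av (1 + y) ^ (CHAR('a) ^ k) = av (1 + y ^ (CHAR('a) ^ k))"
  by (simp only: av_power[symmetric] freshmans_dream'[OF prime_char refl] power_one)

lemma less_char_power: "n < CHAR('a) ^ n"
  using less_exp[of n] power_mono[OF char_ge_2, of n] by linarith

text \<open>
  The Frobenius map turns any bound \<open>|1 + y| \<le> C\<close>, valid for all \<open>y\<close> in a set closed under \<open>p\<close>-th
  powers, into \<open>|1 + y| \<le> C\<^sup>1\<^sup>/\<^sup>m\<close> for arbitrarily large \<open>m\<close>, hence into \<open>|1 + y| \<le> 1\<close>.
\<close>

lemma av_one_plus_le_1_if_bounded:
  assumes "\<And>n. n \<ge> N \<Longrightarrow> av (1 + y ^ n) \<le> C"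
  shows "av (1 + y) \<le> 1"
proof (rule ccontr)
  assume "\<not> av (1 + y) \<le> 1"
  then have gt: "av (1 + y) > 1" by simp
  then obtain n where n: "C < av (1 + y) ^ n" using real_arch_pow by blast
  define k where "k = max n N"
  have k: "n \<le> CHAR('a) ^ k" "N \<le> CHAR('a) ^ k"
    using less_char_power[of k] by (auto simp: k_def)
  have "av (1 + y) ^ n \<le> av (1 + y) ^ (CHAR('a) ^ k)"
    using gt k by (intro power_increasing) auto
  also have "\<dots> \<le> C" using assms[OF k(2)] by (simp add: av_one_plus_power)
  finally show False using n by simp
qed

text \<open>The powers of y tend to 0, so semicontinuity of \<open>av\<close> at 1 already gives the
  crude bound 2 for all large exponents, and Frobenius improves it to 1.\<close>

lemma av_one_plus_prime_ideal:
  assumes "av y < 1"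
  shows "av (1 + y) \<le> 1"
proof -
  have "open ((\<lambda>y. 1 + y) -` {x. av x < 2})"
    by (rule open_vimage[OF open_av_less]) (intro continuous_intros)
  from av_nhds_zero[OF this] obtain \<delta> where \<delta>: "\<delta> > 0" "\<And>y. av y \<le> \<delta> \<Longrightarrow> av (1 + y) < 2"
    by auto
  obtain N where N: "av y ^ N < \<delta>" using real_arch_pow_inv[OF \<delta>(1) assms] by blast
  show ?thesis
  proof (rule av_one_plus_le_1_if_bounded[where C = 2 and N = N])
    fix n assume "n \<ge> N"
    then have "av y ^ n \<le> av y ^ N" using assms by (intro power_decreasing) auto
    then show "av (1 + y ^ n) \<le> 2" using \<delta>(2)[of "y ^ n"] N by (simp add: av_power)
  qed
qed

text \<open>Write 1 + x = e + y with e one of the finitely many residue representatives and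
  \<open>av y\<close> < 1. A nonzero e satisfies \<open>av e\<close> >= 1, so e + y = e (1 + y / e)
  is covered by the previous case and bounded by the largest \<open>av e\<close>. This uniform bound
  C is all that the Frobenius argument requires.\<close>

lemma av_one_plus_integer:
  assumes "av x \<le> 1"
  shows "av (1 + x) \<le> 1"
proof -
  define C where "C = 1 + (\<Sum>n<q. av (resid n))"
  have C1: "av (resid n) \<le> C" if "n < q" for n
    using member_le_sum[of n "{..<q}" "\<lambda>n. av (resid n)"] that by (simp add: C_def)
  have bound: "av (1 + x) \<le> C" if x: "av x \<le> 1" for x
  proof -
    obtain a where a: "x - eps_comb a \<in> prime_ideal av"
      using eps_spanning[of x] x by (auto simp: integer_ring_def eps_comb_def)
    define y where "y = x - eps_comb a"
    have y: "av y < 1" using a by (simp add: y_def prime_ideal_def)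
    define a' where "a' k = a k + (if k = 0 then 1 else 0)" for k
    have "eps_comb (\<lambda>k. if k = 0 then 1 else 0) = (\<Sum>k<c. if k = 0 then \<epsilon> k else 0)"
      unfolding eps_comb_def by (intro sum.cong) auto
    also have "\<dots> = 1" using c_pos eps_0 by (simp add: sum.delta)
    finally have "1 + x = eps_comb a' + y"
      by (simp add: y_def a'_def[abs_def] eps_comb_add[symmetric])
    obtain n where n: "n < q" "resid n = eps_comb a'" by (rule resid_surj)
    show ?thesis
    proof (cases "eps_comb a' = 0")
      case True
      have "1 \<le> C" by (simp add: C_def sum_nonneg)
      then show ?thesis using \<open>1 + x = _\<close> True y by simp
    next
      case False
      then have ge: "av (eps_comb a') \<ge> 1" using eps_comb_zero_or_unit by blast
      have "1 + x = eps_comb a' * (1 + y / eps_comb a')"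
        using False \<open>1 + x = _\<close> by (simp add: field_simps)
      then have "av (1 + x) = av (eps_comb a') * av (1 + y / eps_comb a')" by (simp add: av_mult)
      also have "av (1 + y / eps_comb a') \<le> 1"
        using y ge by (intro av_one_plus_prime_ideal) (simp add: av_divide divide_less_eq)
      also have "av (eps_comb a') * 1 \<le> C" using C1[OF n(1)] n by simp
      finally show ?thesis by (simp add: mult_left_mono)
    qed
  qed
  show ?thesis
  proof (rule av_one_plus_le_1_if_bounded[where C = C and N = 0])
    fix n show "av (1 + x ^ n) \<le> C"
      by (rule bound) (simp add: av_power assms power_le_one)
  qed
qed

lemma av_minus [simp]: "av (- x) = av x"
proof -
  have "av (- 1) ^ 2 = 1" by (simp flip: av_power)
  then have "av (- 1) = 1" using av_nonneg[of "- 1"] by (auto simp: power2_eq_1_iff)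
  then show ?thesis using av_mult[of "- 1" x] by simp
qed

lemma av_add: "av (x + y) \<le> max (av x) (av y)"
proof -
  have *: "av (x + y) \<le> av y" if "av x \<le> av y" "y \<noteq> 0" for x y
  proof -
    have "x + y = y * (1 + x / y)" using that by (simp add: field_simps)
    then have "av (x + y) = av y * av (1 + x / y)" by (simp add: av_mult)
    also have "\<dots> \<le> av y * 1"
      using that av_pos[of y] by (intro mult_left_mono av_one_plus_integer) (auto simp: av_divide)
    finally show ?thesis by simp
  qed
  show ?thesis
    using *[of x y] *[of y x] by (cases "x = 0 \<or> y = 0") (auto simp: add.commute max_def not_le)
qed

section \<open>The ring of integers and its cosets modulo the prime ideal\<close>

abbreviation "D \<equiv> integer_ring av"

lemma D_iff: "x \<in> D \<longleftrightarrow> av x \<le> 1"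
  by (simp add: integer_ring_def)

lemma D_0 [simp]: "0 \<in> D" and D_1 [simp]: "1 \<in> D"
  by (simp_all add: D_iff)

lemma D_minus: "x \<in> D \<Longrightarrow> - x \<in> D"
  by (simp add: D_iff)

lemma D_add: "x \<in> D \<Longrightarrow> y \<in> D \<Longrightarrow> x + y \<in> D"
  using av_add[of x y] by (simp add: D_iff)

lemma D_diff: "x \<in> D \<Longrightarrow> y \<in> D \<Longrightarrow> x - y \<in> D"
  using D_add[of x "- y"] D_minus[of y] by simp

lemma D_mult: "x \<in> D \<Longrightarrow> y \<in> D \<Longrightarrow> x * y \<in> D"
  by (simp add: D_iff av_mult mult_le_one)

lemma D_sum: "(\<And>i. i \<in> I \<Longrightarrow> f i \<in> D) \<Longrightarrow> sum f I \<in> D"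
  by (induction I rule: infinite_finite_induct) (auto intro: D_add)

lemma resid_D: "resid n \<in> D"
proof -
  have "of_nat m \<in> D" for m by (induction m) (auto intro: D_add)
  then show ?thesis
    unfolding resid_def eps_comb_def using eps_unit by (intro D_sum D_mult) auto
qed

text \<open>Otherwise the prime ideal is 0. The inverse of an element with \<open>av\<close> > 1
  would lie in it, so K equals D and consists of the finitely many residues, contradicting
  nondiscreteness.\<close>

lemma prime_nonzero [simp]: "\<pp> \<noteq> 0"
proof
  assume "\<pp> = 0"
  then have P0: "x = 0" if "av x < 1" for x
    using prime_element(2)[of x] that \<open>\<pp> = 0\<close> av_nonneg[of x]
    by (simp add: prime_ideal_def order.antisym)
  have "x \<in> resid ` {..<q}" for x
  proof -
    have "av x \<le> 1"
    proof (rule ccontr)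
      assume "\<not> av x \<le> 1"
      then have "av (inverse x) < 1" by (simp add: av_inverse inverse_less_1_iff)
      then have "x = 0" using P0 by force
      then show False using \<open>\<not> av x \<le> 1\<close> by simp
    qed
    then obtain a where a: "x - eps_comb a \<in> prime_ideal av"
      using eps_spanning[of x] by (auto simp: integer_ring_def eps_comb_def)
    then have "x = eps_comb a" using P0[of "x - eps_comb a"] by (simp add: prime_ideal_def)
    moreover obtain n where "n < q" "resid n = eps_comb a" by (rule resid_surj)
    ultimately show ?thesis by (intro image_eqI[of _ _ n]) auto
  qed
  then have "finite (UNIV :: 'a set)" by (intro finite_subset[of UNIV "resid ` {..<q}"]) auto
  then show False using open_zero_infinite[of "UNIV :: 'a set"] by simp
qed

lemma prime_ideal_iff: "x \<in> prime_ideal av \<longleftrightarrow> x / \<pp> \<in> D"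
proof
  assume "x \<in> prime_ideal av"
  then show "x / \<pp> \<in> D"
    using prime_element(2) av_pos[OF prime_nonzero] by (simp add: D_iff av_divide divide_le_eq)
next
  assume "x / \<pp> \<in> D"
  then have "av x \<le> av \<pp>" using av_pos[OF prime_nonzero] by (simp add: D_iff av_divide divide_le_eq)
  then show "x \<in> prime_ideal av" using prime_element(1) by (simp add: prime_ideal_def)
qed

lemma resid_exists:
  assumes "x \<in> D"
  obtains n where "n < q" "(x - resid n) / \<pp> \<in> D"
proof -
  obtain a where a: "x - eps_comb a \<in> prime_ideal av"
    using eps_spanning[of x] assms by (auto simp: eps_comb_def)
  obtain n where n: "n < q" "resid n = eps_comb a" by (rule resid_surj)
  then show ?thesis using a that prime_ideal_iff by simp
qed

lemma resid_unique:
  assumes "m < q" "n < q" "(resid m - resid n) / \<pp> \<in> D"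
  shows "m = n"
proof (rule digits_eqD)
  show "m < CHAR('a) ^ c" "n < CHAR('a) ^ c" using assms by (auto simp: q_def)
  fix k assume k: "k < c"
  let ?d = "\<lambda>n k. (n div CHAR('a) ^ k) mod CHAR('a)"
  \<comment> \<open>Coefficients are natural numbers, so a difference is written as a sum with the
    factor p - 1.\<close>
  have "of_nat (CHAR('a) - 1) = (- 1 :: 'a)" using char_pos by (simp add: of_nat_diff)
  then have eq: "eps_comb (\<lambda>k. ?d m k + (CHAR('a) - 1) * ?d n k) = resid m - resid n"
    unfolding resid_def eps_comb_def sum_subtractf[symmetric] of_nat_add of_nat_mult
    by (simp only: distrib_right mult_minus1 minus_mult_left[symmetric] add_uminus_conv_diff)
       (simp add: left_diff_distrib)
  have "(?d m k + (CHAR('a) - 1) * ?d n k) mod CHAR('a) = 0"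
    by (rule eps_comb_prime_ideal[OF _ k]) (use eq assms prime_ideal_iff in simp)
  then have "(?d m k + (CHAR('a) - 1) * ?d n k + ?d n k) mod CHAR('a) = ?d n k mod CHAR('a)"
    by (metis add.left_neutral mod_add_left_eq)
  moreover have "?d m k + (CHAR('a) - 1) * ?d n k + ?d n k = ?d m k + CHAR('a) * ?d n k"
    using char_pos by (cases "CHAR('a)") auto
  ultimately show "?d m k = ?d n k" by (simp only: mod_mult_self2 mod_mod_trivial)
qed

text \<open>D is the disjoint union of q cosets of \<pp> D, each of measure
  \<open>av \<pp>\<close>.\<close>

lemma av_prime: "av \<pp> = 1 / real q"
proof -
  define S where "S n = (\<lambda>x. resid n + x) ` (\<lambda>x. \<pp> * x) ` D" for n
  have pD: "(\<lambda>x. \<pp> * x) ` D \<in> sets M"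
    by (rule scale_sets[OF prime_nonzero integer_ring_sets])
  have S_iff: "x \<in> S n \<longleftrightarrow> (x - resid n) / \<pp> \<in> D" for x n
    using prime_nonzero by (auto simp: S_def image_iff field_simps intro!: bexI[of _ "(x - resid n) / \<pp>"])
  have Ss: "S n \<in> sets M" for n
  proof -
    have "S n = (\<lambda>x. x - resid n) -` ((\<lambda>x. \<pp> * x) ` D) \<inter> space borel"
      by (auto simp: S_def image_iff algebra_simps)
    also have "\<dots> \<in> sets borel"
      by (rule measurable_sets[OF borel_measurable_continuous_onI])
         (use pD in \<open>auto simp: sets_M intro!: continuous_intros\<close>)
    finally show ?thesis by (simp add: sets_M)
  qed
  have disj: "disjoint_family_on S {..<q}"
    unfolding disjoint_family_on_def
  proof (intro ballI impI)
    fix m n assume mn: "m \<in> {..<q}" "n \<in> {..<q}" "m \<noteq> n"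
    have False if "x \<in> S m" "x \<in> S n" for x
    proof -
      have "(x - resid n) / \<pp> - (x - resid m) / \<pp> \<in> D" using that S_iff by (intro D_diff) blast+
      then have "(resid m - resid n) / \<pp> \<in> D" by (simp flip: diff_divide_distrib)
      then show False using resid_unique mn by blast
    qed
    then show "S m \<inter> S n = {}" by blast
  qed
  have "(\<Union>n<q. S n) = D"
  proof safe
    fix n x assume "x \<in> S n"
    moreover have "\<pp> \<in> D" using prime_element(1) by (simp add: D_iff prime_ideal_def)
    ultimately show "x \<in> D"
      using resid_D \<open>x \<in> S n\<close> by (auto simp: S_def intro!: D_add D_mult)
  next
    fix x assume "x \<in> D"
    then obtain n where "n < q" "(x - resid n) / \<pp> \<in> D" by (rule resid_exists)
    then show "x \<in> (\<Union>n<q. S n)" using S_iff by auto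
  qed
  then have "1 = emeasure M (\<Union>n<q. S n)" using normalised by simp
  also have "\<dots> = (\<Sum>n<q. emeasure M (S n))"
    by (rule sum_emeasure[symmetric]) (use Ss disj in auto)
  also have "\<dots> = (\<Sum>n<q. ennreal (av \<pp>))"
    by (intro sum.cong)
       (simp_all add: S_def emeasure_translate[OF pD] normalised emeasure_scale[OF prime_nonzero integer_ring_sets])
  also have "\<dots> = ennreal (real q * av \<pp>)" by (simp add: ennreal_mult ennreal_of_nat_eq_real_of_nat)
  finally have "real q * av \<pp> = 1" by (metis av_nonneg ennreal_1 ennreal_inj mult_nonneg_nonneg of_nat_0_le_iff zero_le_one)
  then show ?thesis by (simp add: field_simps)
qed

lemma av_prime_powi: "av (\<pp> powi j) = real q powi (- j)"
  by (simp add: power_int_def av_power av_inverse av_divide av_prime power_one_over inverse_eq_divide)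

section \<open>The translation set as a discrete group\<close>

lemma resid_0 [simp]: "resid 0 = 0"
  by (simp add: resid_def eps_comb_def)

lemma u_digit_eq: "u_digit n = resid n * inverse \<pp>"
  by (simp add: u_digit_def resid_def eps_comb_def)

lemma u_eq_sum:
  assumes "n < q ^ N"
  shows "u n = (\<Sum>k<N. u_digit ((n div q ^ k) mod q) * inverse \<pp> ^ k)"
proof -
  define t where "t k = u_digit ((n div q ^ k) mod q) * inverse \<pp> ^ k" for k
  have t0: "t k = 0" if "n < q ^ k" for k
    using that by (simp add: t_def u_digit_eq)
  have big: "t k = 0" if "k \<ge> N" for k
    using assms power_increasing[OF that, of q] q_pos by (intro t0) (simp del: q_pos)
  have big': "t k = 0" if "k > n" for k
    using that q_ge_2 less_exp[of k] power_mono[of 2 q k] by (intro t0) linarith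
  have "u n = sum t {..n}" by (simp add: u_def t_def)
  also have "\<dots> = sum t {..n + N}"
    by (rule sum.mono_neutral_left) (use big' in auto)
  also have "\<dots> = sum t {..<N}"
    by (rule sum.mono_neutral_right) (use big in auto)
  finally show ?thesis by (simp add: t_def)
qed

lemma less_q_power: "n < q ^ n"
  using less_exp[of n] power_mono[OF q_ge_2, of n] by linarith

text \<open>Peels off the lowest digit; the inductions on the number of digits below rest on this
  recursion.\<close>

lemma u_digit_split:
  assumes "b < q"
  shows "u (b + q * n) = (resid b + u n) / \<pp>"
proof -
  have "b + q * n < q * (n + 1)" using assms by simp
  also have "\<dots> \<le> q * q ^ n" using less_q_power[of n] by (intro mult_left_mono) auto
  finally have "b + q * n < q ^ Suc n" by simp
  then have "u (b + q * n) = (\<Sum>k<Suc n. u_digit (((b + q * n) div q ^ k) mod q) * inverse \<pp> ^ k)"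
    by (rule u_eq_sum)
  also have "\<dots> = u_digit b + (\<Sum>k<n. u_digit (((b + q * n) div q ^ Suc k) mod q) * inverse \<pp> ^ Suc k)"
    unfolding sum.lessThan_Suc_shift using assms by simp
  also have "(\<Sum>k<n. u_digit (((b + q * n) div q ^ Suc k) mod q) * inverse \<pp> ^ Suc k)
      = inverse \<pp> * (\<Sum>k<n. u_digit ((n div q ^ k) mod q) * inverse \<pp> ^ k)"
    unfolding sum_distrib_left
  proof (intro sum.cong refl)
    fix k
    have "(b + q * n) div q ^ Suc k = n div q ^ k" using assms by (simp add: div_mult2_eq)
    then show "u_digit (((b + q * n) div q ^ Suc k) mod q) * inverse \<pp> ^ Suc k
        = inverse \<pp> * (u_digit ((n div q ^ k) mod q) * inverse \<pp> ^ k)"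
      by (simp add: algebra_simps)
  qed
  also have "(\<Sum>k<n. u_digit ((n div q ^ k) mod q) * inverse \<pp> ^ k) = u n"
    using u_eq_sum[OF less_q_power] by simp
  finally show ?thesis by (simp add: u_digit_eq divide_inverse algebra_simps)
qed

lemma u_0 [simp]: "u 0 = 0"
  using u_eq_sum[of 0 0] by simp

text \<open>Low and high digits do not interact. Here a < q^N runs through representatives of the
  lattice modulo its sublattice, and n through the sublattice.\<close>

lemma u_split: "a < q ^ N \<Longrightarrow> u (a + q ^ N * n) = u a + u n / \<pp> ^ N"
proof (induction N arbitrary: a)
  case (Suc N)
  define b a' where "b = a mod q" and "a' = a div q"
  have a: "a = b + q * a'" by (simp add: a'_def b_def)
  have b: "b < q" by (simp add: b_def)
  have a': "a' < q ^ N" using Suc.prems by (simp add: a'_def less_mult_imp_div_less mult.commute)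
  have "a + q ^ Suc N * n = b + q * (a' + q ^ N * n)" by (simp add: a algebra_simps)
  then have "u (a + q ^ Suc N * n) = (resid b + (u a' + u n / \<pp> ^ N)) / \<pp>"
    using u_digit_split[OF b] Suc.IH[OF a'] by simp
  also have "\<dots> = u a + u n / \<pp> ^ Suc N"
    unfolding a u_digit_split[OF b] by (simp add: add_divide_distrib)
  finally show ?case .
qed auto

lemma u_shift: "u (q ^ N * n) = u n / \<pp> ^ N"
  using u_split[of 0 N n] by simp

text \<open>Addition has no carries: the lowest digits add within the group of residues and the
  remaining digits add by induction. Hence the first q^N lattice points form a subgroup.\<close>

lemma u_add_level: "a < q ^ N \<Longrightarrow> b < q ^ N \<Longrightarrow> \<exists>d<q ^ N. u d = u a + u b"
proof (induction N arbitrary: a b)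
  case (Suc N)
  have lt: "a div q < q ^ N" "b div q < q ^ N"
    using Suc.prems by (simp_all add: less_mult_imp_div_less mult.commute)
  then obtain d where d: "d < q ^ N" "u d = u (a div q) + u (b div q)" using Suc.IH by blast
  obtain r where r: "r < q" "resid r = resid (a mod q) + resid (b mod q)"
  proof -
    let ?d = "\<lambda>n k. (n div CHAR('a) ^ k) mod CHAR('a)"
    obtain r where "r < q" "resid r = eps_comb (\<lambda>k. ?d (a mod q) k + ?d (b mod q) k)"
      by (rule resid_surj)
    then show ?thesis using that by (simp add: eps_comb_add[symmetric] resid_def[symmetric])
  qed
  have "r + q * d < q * (d + 1)" using r by simp
  also have "\<dots> \<le> q * q ^ N" using d by (intro mult_left_mono) auto
  finally have "r + q * d < q ^ Suc N" by simp
  moreover have "u (r + q * d) = u a + u b"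
    using u_digit_split[OF r(1), of d] u_digit_split[of "a mod q" "a div q"]
      u_digit_split[of "b mod q" "b div q"] r d
    by (simp add: add_divide_distrib)
  ultimately show ?case by blast
qed auto

text \<open>In characteristic p negation is multiplication by p - 1, that is, repeated
  addition.\<close>

lemma u_minus_level:
  assumes "a < q ^ N"
  shows "\<exists>d<q ^ N. u d = - u a"
proof -
  have "\<exists>d<q ^ N. u d = of_nat m * u a" for m
  proof (induction m)
    case 0
    show ?case by (rule exI[of _ 0]) simp
  next
    case (Suc m)
    then obtain d where d: "d < q ^ N" "u d = of_nat m * u a" by blast
    then obtain e where "e < q ^ N" "u e = u a + u d" using u_add_level[OF assms] by blast
    then show ?case using d by (auto simp: algebra_simps)
  qed
  then obtain d where "d < q ^ N" "u d = of_nat (CHAR('a) - 1) * u a" by blast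
  moreover have "of_nat (CHAR('a) - 1) = (- 1 :: 'a)" using char_pos by (simp add: of_nat_diff)
  ultimately show ?thesis by auto
qed

lemma u_exists_level: "\<pp> ^ N * x \<in> D \<Longrightarrow> \<exists>n<q ^ N. x - u n \<in> D"
proof (induction N arbitrary: x)
  case (Suc N)
  then have "\<pp> ^ N * (\<pp> * x) \<in> D" by (simp add: mult_ac)
  then obtain n where n: "n < q ^ N" "\<pp> * x - u n \<in> D" using Suc.IH by blast
  obtain b where b: "b < q" "(\<pp> * x - u n - resid b) / \<pp> \<in> D" using resid_exists[OF n(2)] by blast
  have "b + q * n < q * (n + 1)" using b by simp
  also have "\<dots> \<le> q * q ^ N" using n by (intro mult_left_mono) auto
  finally have "b + q * n < q ^ Suc N" by simp
  moreover have "x - u (b + q * n) = (\<pp> * x - u n - resid b) / \<pp>"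
    unfolding u_digit_split[OF b(1)] using prime_nonzero by (simp add: diff_divide_distrib add_divide_distrib)
  ultimately show ?case using b by auto
qed auto

lemma av_prime_less_1: "av \<pp> < 1"
  using prime_element(1) by (simp add: prime_ideal_def)

lemma prime_power_D: "\<pp> ^ N \<in> D"
  using av_prime_less_1 by (simp add: D_iff av_power power_le_one)

lemma prime_power_mult_D_ex: "\<exists>N. \<pp> ^ N * x \<in> D"
proof (cases "x = 0")
  case False
  then obtain N where "av \<pp> ^ N < inverse (av x)"
    using real_arch_pow_inv[OF _ av_prime_less_1, of "inverse (av x)"] av_pos by auto
  then have "av (\<pp> ^ N * x) \<le> 1"
    using av_pos[OF False] by (simp add: av_mult av_power field_simps)
  then show ?thesis by (auto simp: D_iff)
qed auto

lemma u_exists: "\<exists>n. x - u n \<in> D"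
  using prime_power_mult_D_ex u_exists_level by metis

lemma u_level: "n < q ^ N \<Longrightarrow> \<pp> ^ N * u n \<in> D"
proof (induction N arbitrary: n)
  case (Suc N)
  have "n div q < q ^ N"
    using Suc.prems by (simp add: less_mult_imp_div_less mult.commute)
  then have "\<pp> ^ N * u (n div q) \<in> D" by (rule Suc.IH)
  then have "\<pp> ^ N * resid (n mod q) + \<pp> ^ N * u (n div q) \<in> D"
    by (rule D_add[OF D_mult[OF prime_power_D resid_D]])
  also have "\<pp> ^ N * resid (n mod q) + \<pp> ^ N * u (n div q) = \<pp> ^ N * (\<pp> * u n)"
    using u_digit_split[of "n mod q" "n div q"] prime_nonzero by (simp add: distrib_left[symmetric])
  finally show ?case by (simp add: mult_ac)
qed auto

text \<open>Multiplication by \<pp> keeps the difference in D and turns the lowest digits into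
  residues, which lie in D as well. So the shortened indices satisfy the hypothesis and agree by
  induction; \<open>resid_unique\<close> then settles the lowest digit.\<close>

lemma u_unique: "u m - u n \<in> D \<Longrightarrow> m = n"
proof (induction "m + n" arbitrary: m n rule: less_induct)
  case less
  show ?case
  proof (cases "m + n = 0")
    case False
    have "m div q + n div q < m + n"
    proof (cases "m = 0")
      case True
      then show ?thesis using False q_ge_2 by simp
    next
      case False
      then have "m div q < m" using q_ge_2 by simp
      then show ?thesis using div_le_dividend[of n q] by linarith
    qed
    have eqm: "\<pp> * u m = resid (m mod q) + u (m div q)" for m
      using u_digit_split[of "m mod q" "m div q"] prime_nonzero by simp
    have "\<pp> * (u m - u n) \<in> D" using prime_power_D[of 1] less.prems by (intro D_mult) auto
    then have "(resid (m mod q) - resid (n mod q)) + (u (m div q) - u (n div q)) \<in> D"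
      by (simp add: right_diff_distrib eqm algebra_simps)
    from D_diff[OF this D_diff[OF resid_D[of "m mod q"] resid_D[of "n mod q"]]]
    have "u (m div q) - u (n div q) \<in> D" by simp
    from less.hyps[OF _ this] \<open>m div q + n div q < m + n\<close> have div: "m div q = n div q" by blast
    have "u m - u n = (resid (m mod q) - resid (n mod q)) / \<pp>"
      using eqm[of m] eqm[of n] div prime_nonzero
      by (simp add: field_simps)
    then have "m mod q = n mod q" using less.prems by (intro resid_unique) auto
    with div show ?thesis by (metis div_mult_mod_eq)
  qed auto
qed

lemma inj_u: "inj u"
  by (intro injI) (metis D_0 cancel_comm_monoid_add_class.diff_cancel u_unique)

lemma u_range_add: "x \<in> range u \<Longrightarrow> y \<in> range u \<Longrightarrow> x + y \<in> range u"
proof -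
  assume "x \<in> range u" "y \<in> range u"
  then obtain a b where ab: "x = u a" "y = u b" by auto
  have "max a b < q ^ max a b" by (rule less_q_power)
  then have "a < q ^ max a b" "b < q ^ max a b" by linarith+
  then show ?thesis using u_add_level ab by (metis rangeI)
qed

lemma u_range_minus: "x \<in> range u \<Longrightarrow> - x \<in> range u"
proof -
  assume "x \<in> range u"
  then obtain a where a: "x = u a" by auto
  obtain d where "u d = - u a" using u_minus_level[OF less_q_power] by blast
  then show ?thesis using a by (metis rangeI)
qed

lemma u_range_diff: "x \<in> range u \<Longrightarrow> y \<in> range u \<Longrightarrow> x - y \<in> range u"
  using u_range_add[of x "- y"] u_range_minus[of y] by simp

lemma u_range_shift: "x \<in> range u \<Longrightarrow> x / \<pp> ^ N \<in> range u"
proof -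
  assume "x \<in> range u"
  then obtain a where "x = u a" by auto
  then have "x / \<pp> ^ N = u (q ^ N * a)" by (simp only: u_shift)
  then show ?thesis by (metis rangeI)
qed

subsection \<open>Square integrable functions\<close>

lemma affine_measurable [measurable]: "(\<lambda>x. \<alpha> * x + \<beta>) \<in> measurable M M"
  unfolding measurable_cong_sets[OF sets_M sets_M]
  by (intro borel_measurable_continuous_onI continuous_intros)

lemma distr_affine:
  assumes "\<alpha> \<noteq> 0"
  shows "distr M M (\<lambda>x. \<alpha> * x + \<beta>) = density M (\<lambda>_. ennreal (1 / av \<alpha>))"
proof (rule measure_eqI)
  fix A assume "A \<in> sets (distr M M (\<lambda>x. \<alpha> * x + \<beta>))"
  then have A: "A \<in> sets M" by simp
  have A': "(\<lambda>x. - \<beta> + x) ` A \<in> sets M"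
  proof -
    have "(\<lambda>x. - \<beta> + x) ` A = (\<lambda>x. 1 * x + \<beta>) -` A \<inter> space M"
      by (force simp: image_iff algebra_simps)
    then show ?thesis using measurable_sets[OF affine_measurable A] by metis
  qed
  have "(\<lambda>x. \<alpha> * x + \<beta>) -` A \<inter> space M = (\<lambda>x. inverse \<alpha> * x) ` (\<lambda>x. - \<beta> + x) ` A"
    using assms by (force simp: image_iff field_simps)
  then have "emeasure (distr M M (\<lambda>x. \<alpha> * x + \<beta>)) A = emeasure M ((\<lambda>x. inverse \<alpha> * x) ` (\<lambda>x. - \<beta> + x) ` A)"
    by (subst emeasure_distr[OF affine_measurable A]) simp
  also have "\<dots> = ennreal (av (inverse \<alpha>)) * emeasure M A"
    by (simp only: emeasure_scale[OF nonzero_imp_inverse_nonzero[OF assms] A'] emeasure_translate[OF A])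
  also have "\<dots> = ennreal (1 / av \<alpha>) * emeasure M A"
    unfolding av_inverse by (simp add: inverse_eq_divide)
  also have "\<dots> = emeasure (density M (\<lambda>_. ennreal (1 / av \<alpha>))) A"
    using A by (simp add: emeasure_density_const)
  finally show "emeasure (distr M M (\<lambda>x. \<alpha> * x + \<beta>)) A = emeasure (density M (\<lambda>_. ennreal (1 / av \<alpha>))) A" .
qed simp

lemma measurable_affine_comp: "f \<in> measurable M N \<Longrightarrow> (\<lambda>x. f (\<alpha> * x + \<beta>)) \<in> measurable M N"
  using affine_measurable by (rule measurable_compose)

lemma integral_affine:
  fixes f :: "'a \<Rightarrow> 'b :: {banach, second_countable_topology}"
  assumes "\<alpha> \<noteq> 0" "f \<in> borel_measurable M"
  shows "(\<integral>x. f (\<alpha> * x + \<beta>) \<partial>M) = (1 / av \<alpha>) *\<^sub>R (\<integral>x. f x \<partial>M)"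
proof -
  have "(\<integral>x. f (\<alpha> * x + \<beta>) \<partial>M) = integral\<^sup>L (distr M M (\<lambda>x. \<alpha> * x + \<beta>)) f"
    by (rule integral_distr[symmetric]) (use assms in simp_all)
  also have "\<dots> = integral\<^sup>L (density M (\<lambda>_. ennreal (1 / av \<alpha>))) f"
    by (simp add: distr_affine[OF assms(1)])
  also have "\<dots> = (\<integral>x. (1 / av \<alpha>) *\<^sub>R f x \<partial>M)"
    by (rule integral_density) (use assms in auto)
  finally show ?thesis by simp
qed

lemma integrable_affine:
  fixes f :: "'a \<Rightarrow> 'b :: {banach, second_countable_topology}"
  assumes "\<alpha> \<noteq> 0" "integrable M f"
  shows "integrable M (\<lambda>x. f (\<alpha> * x + \<beta>))"
proof -
  have "integrable (density M (\<lambda>_. ennreal (1 / av \<alpha>))) f"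
    by (subst integrable_density) (use assms in auto)
  then have "integrable (distr M M (\<lambda>x. \<alpha> * x + \<beta>)) f"
    by (simp add: distr_affine[OF assms(1)])
  then show ?thesis by (subst (asm) integrable_distr_eq) (use assms in auto)
qed

definition nsq :: "('a \<Rightarrow> complex) \<Rightarrow> real" where
  "nsq f = (\<integral>x. (cmod (f x))\<^sup>2 \<partial>M)"

lemma nsq_nonneg [simp]: "nsq f \<ge> 0"
  by (simp add: nsq_def)

lemma L2_norm_sq: "(L2_norm f)\<^sup>2 = nsq f"
  by (simp add: L2_norm_def nsq_def)

lemma L2_meas: "f \<in> L2 \<Longrightarrow> f \<in> borel_measurable M"
  by (simp add: L2_def)

lemma L2_int: "f \<in> L2 \<Longrightarrow> integrable M (\<lambda>x. (cmod (f x))\<^sup>2)"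
  by (simp add: L2_def)

lemma L2_dominated:
  assumes "f \<in> borel_measurable M" "integrable M g" "\<And>x. (cmod (f x))\<^sup>2 \<le> g x"
  shows "f \<in> L2"
  unfolding L2_def
proof (intro CollectI conjI)
  show "integrable M (\<lambda>x. (cmod (f x))\<^sup>2)"
    by (rule Bochner_Integration.integrable_bound[OF assms(2)])
       (use assms(1) in measurable, use assms(3) in \<open>auto intro: order_trans[OF _ abs_ge_self]\<close>)
qed fact

lemma cmod_add_sq_le: "(cmod (x + y))\<^sup>2 \<le> 2 * (cmod x)\<^sup>2 + 2 * (cmod y)\<^sup>2"
proof -
  have "(cmod (x + y))\<^sup>2 \<le> (cmod x + cmod y)\<^sup>2" by (intro power_mono norm_triangle_ineq) auto
  also have "\<dots> \<le> 2 * (cmod x)\<^sup>2 + 2 * (cmod y)\<^sup>2"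
    using sum_squares_bound[of "cmod x" "cmod y"] by (simp add: power2_sum)
  finally show ?thesis .
qed

lemma L2_add: "f \<in> L2 \<Longrightarrow> g \<in> L2 \<Longrightarrow> (\<lambda>x. f x + g x) \<in> L2"
  by (rule L2_dominated[where g = "\<lambda>x. 2 * (cmod (f x))\<^sup>2 + 2 * (cmod (g x))\<^sup>2"])
     (auto simp: cmod_add_sq_le L2_def)

lemma L2_cmult: "f \<in> L2 \<Longrightarrow> (\<lambda>x. z * f x) \<in> L2"
  by (auto simp: L2_def norm_mult power_mult_distrib)

lemma L2_diff: "f \<in> L2 \<Longrightarrow> g \<in> L2 \<Longrightarrow> (\<lambda>x. f x - g x) \<in> L2"
  using L2_add[of f "\<lambda>x. - 1 * g x"] L2_cmult[of g "- 1"] by simp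

lemma L2_affine: "f \<in> L2 \<Longrightarrow> \<alpha> \<noteq> 0 \<Longrightarrow> (\<lambda>x. f (\<alpha> * x + \<beta>)) \<in> L2"
  by (auto simp: L2_def intro: measurable_affine_comp integrable_affine)

lemma nsq_affine: "f \<in> L2 \<Longrightarrow> \<alpha> \<noteq> 0 \<Longrightarrow> nsq (\<lambda>x. f (\<alpha> * x + \<beta>)) = nsq f / av \<alpha>"
  using integral_affine[OF _ borel_measurable_integrable[OF L2_int], of \<alpha> f \<beta>] by (simp add: nsq_def)

lemma L2_prod_integrable:
  assumes "f \<in> L2" "g \<in> L2"
  shows "integrable M (\<lambda>x. f x * cnj (g x))"
proof (rule Bochner_Integration.integrable_bound)
  show "integrable M (\<lambda>x. (cmod (f x))\<^sup>2 + (cmod (g x))\<^sup>2)"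
    using assms by (simp add: L2_def)
  have [measurable]: "f \<in> borel_measurable M" "g \<in> borel_measurable M" using assms by (auto simp: L2_def)
  have "cnj \<in> borel_measurable borel" by (intro borel_measurable_continuous_onI continuous_intros)
  then have [measurable]: "(\<lambda>x. cnj (g x)) \<in> borel_measurable M" by measurable
  show "(\<lambda>x. f x * cnj (g x)) \<in> borel_measurable M" by measurable
  show "AE x in M. norm (f x * cnj (g x)) \<le> norm ((cmod (f x))\<^sup>2 + (cmod (g x))\<^sup>2)"
  proof (intro AE_I2)
    fix x
    have "2 * cmod (f x) * cmod (g x) \<le> (cmod (f x))\<^sup>2 + (cmod (g x))\<^sup>2"
      by (rule sum_squares_bound)
    moreover have "0 \<le> cmod (f x) * cmod (g x)" by simp
    ultimately have "cmod (f x) * cmod (g x) \<le> (cmod (f x))\<^sup>2 + (cmod (g x))\<^sup>2" by linarith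
    then show "norm (f x * cnj (g x)) \<le> norm ((cmod (f x))\<^sup>2 + (cmod (g x))\<^sup>2)"
      by (simp add: norm_mult mult.assoc)
  qed
qed

lemma inner_add_left: "f \<in> L2 \<Longrightarrow> f' \<in> L2 \<Longrightarrow> g \<in> L2 \<Longrightarrow>
    L2_inner (\<lambda>x. f x + f' x) g = L2_inner f g + L2_inner f' g"
  by (simp add: L2_inner_def distrib_right L2_prod_integrable)

lemma inner_cmult_left: "L2_inner (\<lambda>x. z * f x) g = z * L2_inner f g"
  by (simp add: L2_inner_def mult.assoc)

lemma inner_cmult_right: "L2_inner f (\<lambda>x. z * g x) = cnj z * L2_inner f g"
  by (simp add: L2_inner_def mult_ac flip: integral_mult_right_zero)

lemma inner_cnj: "L2_inner g f = cnj (L2_inner f g)"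
  unfolding L2_inner_def
  by (subst Bochner_Integration.integral_cnj[symmetric]) (simp only: complex_cnj_mult complex_cnj_cnj mult.commute)

lemma inner_affine: "f \<in> L2 \<Longrightarrow> g \<in> L2 \<Longrightarrow> \<alpha> \<noteq> 0 \<Longrightarrow>
    L2_inner (\<lambda>x. f (\<alpha> * x + \<beta>)) (\<lambda>x. g (\<alpha> * x + \<beta>)) = L2_inner f g / av \<alpha>"
  using integral_affine[of \<alpha> "\<lambda>x. f x * cnj (g x)" \<beta>] L2_prod_integrable[of f g]
  by (simp add: L2_inner_def scaleR_conv_of_real borel_measurable_integrable)

lemma inner_Cauchy_Schwarz:
  assumes "f \<in> L2" "g \<in> L2"
  shows "(cmod (L2_inner f g))\<^sup>2 \<le> nsq f * nsq g"
proof -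
  define C where "C = (\<integral>x. cmod (f x) * cmod (g x) \<partial>M)"
  have ifg: "integrable M (\<lambda>x. cmod (f x) * cmod (g x))"
    using integrable_norm[OF L2_prod_integrable[OF assms]] by (simp add: norm_mult)
  have if': "integrable M (\<lambda>x. (cmod (f x))\<^sup>2)" and ig: "integrable M (\<lambda>x. (cmod (g x))\<^sup>2)"
    using assms by (auto simp: L2_def)
  have pos: "0 \<le> nsq f - 2 * s * C + s\<^sup>2 * nsq g" for s
  proof -
    have "0 \<le> (\<integral>x. (cmod (f x) - s * cmod (g x))\<^sup>2 \<partial>M)" by simp
    also have "\<dots> = (\<integral>x. (cmod (f x))\<^sup>2 - 2 * s * (cmod (f x) * cmod (g x)) + s\<^sup>2 * (cmod (g x))\<^sup>2 \<partial>M)"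
      by (intro Bochner_Integration.integral_cong) (auto simp: power2_eq_square algebra_simps)
    also have "\<dots> = nsq f - 2 * s * C + s\<^sup>2 * nsq g"
      using ifg if' ig by (simp add: nsq_def C_def)
    finally show ?thesis .
  qed
  have C0: "C \<ge> 0" by (simp add: C_def)
  have "C\<^sup>2 \<le> nsq f * nsq g"
  proof (cases "nsq g = 0")
    case True
    have "C = 0"
    proof (rule ccontr)
      \<comment> \<open>For this s the expression in \<open>pos\<close>, which is linear as
        \<open>nsq g\<close> = 0, takes the value -1.\<close>
      assume "C \<noteq> 0"
      then show False using pos[of "(nsq f + 1) / (2 * C)"] True by simp
    qed
    then show ?thesis by simp
  next
    case False
    then have "nsq g > 0" using nsq_nonneg[of g] by linarith
    have "0 \<le> nsq f - 2 * (C / nsq g) * C + (C / nsq g)\<^sup>2 * nsq g" by (rule pos)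
    also have "\<dots> = nsq f - C\<^sup>2 / nsq g"
      using False by (simp add: power2_eq_square)
    finally show ?thesis using \<open>nsq g > 0\<close> by (simp add: divide_le_eq mult.commute)
  qed
  moreover have "cmod (L2_inner f g) \<le> C"
    unfolding L2_inner_def C_def
    using integral_norm_bound[of M "\<lambda>x. f x * cnj (g x)"] by (simp add: norm_mult)
  then have "(cmod (L2_inner f g))\<^sup>2 \<le> C\<^sup>2" by (intro power_mono) auto
  ultimately show ?thesis by linarith
qed

text \<open>This is \<pp>^n (v + D), of measure q^-n. For v = \<open>u a\<close> with natural a
  these are all balls of that size, each exactly once, so that balls can be summed over by their
  indices.\<close>

definition Ball :: "int \<Rightarrow> 'a \<Rightarrow> 'a set" where
  "Ball n v = {x. \<pp> powi (- n) * x - v \<in> D}"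

lemma D_sets: "D \<in> sets M"
  by (rule integer_ring_sets)

lemma Ball_eq_vimage: "Ball n v = (\<lambda>x. \<pp> powi (- n) * x + (- v)) -` D \<inter> space M"
  by (auto simp: Ball_def)

lemma Ball_sets [measurable]: "Ball n v \<in> sets M"
  unfolding Ball_eq_vimage by (rule measurable_sets[OF affine_measurable D_sets])

lemma emeasure_Ball: "emeasure M (Ball n v) = ennreal (real q powi (- n))"
proof -
  have "emeasure M (Ball n v) = emeasure (distr M M (\<lambda>x. \<pp> powi (- n) * x + (- v))) D"
    unfolding Ball_eq_vimage by (subst emeasure_distr[OF affine_measurable D_sets]) simp
  also have "\<dots> = ennreal (1 / av (\<pp> powi (- n)))"
    by (subst distr_affine) (simp_all add: emeasure_density_const D_sets normalised prime_nonzero)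
  also have "1 / av (\<pp> powi (- n)) = real q powi (- n)"
    unfolding av_prime_powi by (simp add: power_int_minus inverse_eq_divide)
  finally show ?thesis .
qed

lemma measure_Ball: "measure M (Ball n v) = real q powi (- n)"
  by (simp add: measure_def emeasure_Ball)

lemma Ball_D_diff: "x \<in> Ball n v \<Longrightarrow> x \<in> Ball n w \<Longrightarrow> v - w \<in> D"
  unfolding Ball_def using D_diff[of "\<pp> powi (- n) * x - w" "\<pp> powi (- n) * x - v"] by simp

lemma Ball_u_disjoint: "a \<noteq> b \<Longrightarrow> Ball n (u a) \<inter> Ball n (u b) = {}"
  using Ball_D_diff u_unique by blast

lemma Ball_u_cover: "\<exists>a. x \<in> Ball n (u a)"
  using u_exists[of "\<pp> powi (- n) * x"] by (simp add: Ball_def)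

lemma powi_Suc_shift: "\<pp> powi (- (n + 1)) = \<pp> powi (- n) / \<pp>"
proof -
  have "- (n + 1) = - n - 1" by simp
  then show ?thesis
    by (simp only:) (subst power_int_diff, use prime_nonzero in auto)
qed

text \<open>On indices, refinement by one level appends a lowest digit; the parent of the ball with
  index a has index \<open>a div q\<close>.\<close>

lemma Ball_children: "Ball n (u a) = (\<Union>b<q. Ball (n + 1) (u (b + q * a)))"
proof safe
  fix x assume "x \<in> Ball n (u a)"
  then have "\<pp> powi (- n) * x - u a \<in> D" by (simp add: Ball_def)
  then obtain b where b: "b < q" "(\<pp> powi (- n) * x - u a - resid b) / \<pp> \<in> D"
    by (rule resid_exists)
  have "\<pp> powi (- (n + 1)) * x - u (b + q * a) = (\<pp> powi (- n) * x - u a - resid b) / \<pp>"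
    unfolding powi_Suc_shift u_digit_split[OF b(1)] using prime_nonzero
    by (simp add: field_simps)
  then have "x \<in> Ball (n + 1) (u (b + q * a))" unfolding Ball_def using b by simp
  then show "x \<in> (\<Union>b<q. Ball (n + 1) (u (b + q * a)))" using b by blast
next
  fix x b assume b: "b < q" "x \<in> Ball (n + 1) (u (b + q * a))"
  define y where "y = \<pp> powi (- (n + 1)) * x - u (b + q * a)"
  have "\<pp> * y + resid b \<in> D"
    using b resid_D prime_power_D[of 1] by (intro D_add D_mult) (auto simp: Ball_def y_def)
  also have "\<pp> * y + resid b = \<pp> powi (- n) * x - u a"
    unfolding y_def powi_Suc_shift u_digit_split[OF b(1)] using prime_nonzero
    by (simp add: field_simps)
  finally show "x \<in> Ball n (u a)" by (simp add: Ball_def)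
qed

lemma Ball_nested:
  assumes "x \<in> Ball m v" "x \<in> Ball n w" "n \<le> m"
  shows "Ball m v \<subseteq> Ball n w"
proof
  fix y assume "y \<in> Ball m v"
  then have "\<pp> powi (- m) * y - \<pp> powi (- m) * x \<in> D"
    using assms(1) D_diff[of "\<pp> powi (- m) * y - v" "\<pp> powi (- m) * x - v"] by (simp add: Ball_def)
  then have "\<pp> ^ nat (m - n) * (\<pp> powi (- m) * y - \<pp> powi (- m) * x) \<in> D"
    using prime_power_D by (intro D_mult)
  also have "\<pp> ^ nat (m - n) = \<pp> powi (m - n)" using assms by (simp add: power_int_def)
  also have "\<pp> powi (m - n) * (\<pp> powi (- m) * y - \<pp> powi (- m) * x) = \<pp> powi (- n) * y - \<pp> powi (- n) * x"
    using prime_nonzero by (simp add: right_diff_distrib mult.assoc[symmetric] power_int_add[symmetric])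
  finally have "(\<pp> powi (- n) * y - \<pp> powi (- n) * x) + (\<pp> powi (- n) * x - w) \<in> D"
    using assms(2) by (intro D_add) (auto simp: Ball_def)
  then show "y \<in> Ball n w" by (simp add: Ball_def)
qed

lemma Ball_nhds:
  assumes "open U" "x \<in> U"
  shows "\<exists>n :: nat. \<forall>a. x \<in> Ball (int n) (u a) \<longrightarrow> Ball (int n) (u a) \<subseteq> U"
proof -
  have "open ((\<lambda>y. x + y) -` U)" "0 \<in> (\<lambda>y. x + y) -` U"
    using assms by (auto intro!: open_vimage continuous_intros)
  from av_nhds_zero[OF this] obtain \<delta> where \<delta>: "\<delta> > 0" "\<And>y. av y \<le> \<delta> \<Longrightarrow> x + y \<in> U" by auto
  obtain n where n: "av \<pp> ^ n < \<delta>" using real_arch_pow_inv[OF \<delta>(1) av_prime_less_1] by blast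
  show ?thesis
  proof (intro exI allI impI subsetI)
    fix a y assume "x \<in> Ball (int n) (u a)" "y \<in> Ball (int n) (u a)"
    then have "\<pp> powi (- int n) * y - \<pp> powi (- int n) * x \<in> D"
      using D_diff[of "\<pp> powi (- int n) * y - u a" "\<pp> powi (- int n) * x - u a"] by (simp add: Ball_def)
    then have "av (\<pp> powi (- int n) * (y - x)) \<le> 1" by (simp add: D_iff right_diff_distrib)
    then have "av (y - x) \<le> av \<pp> ^ n"
      using av_pos[OF prime_nonzero]
      by (simp add: av_mult power_int_minus av_inverse av_divide av_power field_simps)
    then show "y \<in> U" using \<delta>(2)[of "y - x"] n by simp
  qed
qed

section \<open>Density of the indicators of balls\<close>

lemma indicator_L2:
  assumes "A \<in> sets M" "emeasure M A < \<infinity>"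
  shows "(indicator A :: 'a \<Rightarrow> complex) \<in> L2" "nsq (indicator A) = measure M A"
proof -
  have eq: "(\<lambda>x. (cmod (indicator A x))\<^sup>2) = (indicator A :: 'a \<Rightarrow> real)"
    by (auto simp: fun_eq_iff indicator_def)
  show "(indicator A :: 'a \<Rightarrow> complex) \<in> L2"
    unfolding L2_def using assms by (simp add: eq integrable_real_indicator)
  show "nsq (indicator A) = measure M A"
    unfolding nsq_def eq using assms by simp
qed

abbreviation ball_fun :: "nat \<Rightarrow> nat \<Rightarrow> 'a \<Rightarrow> complex" where
  "ball_fun n a \<equiv> indicator (Ball (int n) (u a))"

lemma indicator_Ball_L2: "(indicator (Ball n v) :: 'a \<Rightarrow> complex) \<in> L2"
  by (rule indicator_L2) (auto simp: emeasure_Ball)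

text \<open>
  Outer regularity reduces Borel sets to open sets, and an open set is the increasing union of the
  finite unions of balls \<open>V N\<close> below.
\<close>

lemma L2_ball_induct [consumes 1, case_names add cmult lim ball]:
  assumes f: "f \<in> L2"
    and add: "\<And>f g. f \<in> L2 \<Longrightarrow> g \<in> L2 \<Longrightarrow> P f \<Longrightarrow> P g \<Longrightarrow> P (\<lambda>x. f x + g x)"
    and cmult: "\<And>f z. f \<in> L2 \<Longrightarrow> P f \<Longrightarrow> P (\<lambda>x. z * f x)"
    and lim: "\<And>f s. f \<in> L2 \<Longrightarrow> (\<And>i :: nat. s i \<in> L2) \<Longrightarrow> (\<And>i. P (s i)) \<Longrightarrow>
        (\<lambda>i. nsq (\<lambda>x. f x - s i x)) \<longlonglongrightarrow> 0 \<Longrightarrow> P f"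
    and ball: "\<And>(n :: nat) a. P (ball_fun n a)"
  shows "P f"
proof -
  have zero: "P (\<lambda>x. 0)"
    using cmult[OF indicator_Ball_L2 ball, of 0] by simp
  have L2_zero: "(\<lambda>x. 0) \<in> L2" by (simp add: L2_def)
  have sum: "P (\<lambda>x. \<Sum>i\<in>I. h i x) \<and> (\<lambda>x. \<Sum>i\<in>I. h i x) \<in> L2"
    if "finite I" "\<And>i. i \<in> I \<Longrightarrow> P (h i) \<and> h i \<in> L2" for I :: "'i set" and h :: "'i \<Rightarrow> 'a \<Rightarrow> complex"
    using that by (induction I rule: finite_induct) (auto simp: zero L2_zero intro!: add L2_add)
  \<comment> \<open>Since each \<open>S i\<close> is comparable with A, convergence of measures is
    convergence in norm. This serves both approximations: of open sets from inside and of Borel sets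
    from outside.\<close>
  have indicator_lim: "P (indicator A)"
    if A: "A \<in> sets M" "emeasure M A < \<infinity>"
      and S: "\<And>i :: nat. S i \<in> sets M" "\<And>i. emeasure M (S i) < \<infinity>" "\<And>i. P (indicator (S i))"
      and lim0: "(\<lambda>i. \<bar>measure M A - measure M (S i)\<bar>) \<longlonglongrightarrow> 0"
      and nest: "\<And>i. A \<subseteq> S i \<or> S i \<subseteq> A" for A S
  proof (rule lim[where s = "\<lambda>i. indicator (S i)"])
    have "nsq (\<lambda>x. indicator A x - indicator (S i) x) = \<bar>measure M A - measure M (S i)\<bar>" for i
    proof -
      have eq: "(\<lambda>x. (cmod (indicator A x - indicator (S i) x))\<^sup>2) = (indicator ((A - S i) \<union> (S i - A)) :: 'a \<Rightarrow> real)"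
        by (auto simp: fun_eq_iff indicator_def)
      have "nsq (\<lambda>x. indicator A x - indicator (S i) x) = measure M ((A - S i) \<union> (S i - A))"
        unfolding nsq_def eq using A S by simp
      also have "\<dots> = \<bar>measure M A - measure M (S i)\<bar>"
      proof -
        have finS: "emeasure M (S i) \<noteq> \<infinity>" and finA: "emeasure M A \<noteq> \<infinity>"
          using S(2)[of i] A(2) by auto
        show ?thesis using nest[of i]
      proof
        assume *: "A \<subseteq> S i"
        then have "(A - S i) \<union> (S i - A) = S i - A" by auto
        then show ?thesis
          using * measure_Diff[OF finS S(1) A(1) *] measure_mono_fmeasurable[OF * A(1)] S
          by (simp add: fmeasurable_def)
      next
        assume *: "S i \<subseteq> A"
        then have "(A - S i) \<union> (S i - A) = A - S i" by auto
        then show ?thesis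
          using * measure_Diff[OF finA A(1) S(1) *] measure_mono_fmeasurable[OF * S(1)] A
          by (simp add: fmeasurable_def)
      qed
      qed
      finally show ?thesis .
    qed
    then show "(\<lambda>i. nsq (\<lambda>x. indicator A x - indicator (S i) x)) \<longlonglongrightarrow> 0" using lim0 by simp
  qed (use A S in \<open>auto intro: indicator_L2\<close>)
  have P_open: "P (indicator U)" if U: "open U" "emeasure M U < \<infinity>" for U
  proof -
    \<comment> \<open>The bound q^(2N) selects the balls of level N that lie in \<pp>^-N D: finitely
      many for each N, yet exhausting K as N grows.\<close>
    define I where "I N = {a. a < q ^ (2 * N) \<and> Ball (int N) (u a) \<subseteq> U}" for N
    define V where "V N = (\<Union>a\<in>I N. Ball (int N) (u a))" for N
    have finI: "finite (I N)" for N by (simp add: I_def)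
    have Vs: "V N \<in> sets M" for N unfolding V_def using finI by auto
    have VU: "V N \<subseteq> U" for N by (auto simp: V_def I_def)
    have Us: "U \<in> sets M" using U open_sets_M by blast
    have "V N \<subseteq> V (Suc N)" for N
    proof
      fix x assume "x \<in> V N"
      then obtain a where a: "a < q ^ (2 * N)" "Ball (int N) (u a) \<subseteq> U" "x \<in> Ball (int N) (u a)"
        by (auto simp: V_def I_def)
      then obtain b where b: "b < q" "x \<in> Ball (int N + 1) (u (b + q * a))"
        unfolding Ball_children[of "int N" a] by auto
      have "b + q * a < q * (a + 1)" using b by simp
      also have "\<dots> \<le> q * q ^ (2 * N)" using a by (intro mult_left_mono) auto
      also have "\<dots> \<le> q ^ (2 * Suc N)" by (simp add: Suc_le_eq)
      finally have "b + q * a < q ^ (2 * Suc N)" .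
      moreover have "Ball (int N + 1) (u (b + q * a)) \<subseteq> U"
        using a(2) b(1) unfolding Ball_children[of "int N" a] by auto
      ultimately show "x \<in> V (Suc N)"
        using b unfolding V_def I_def by (auto simp: add.commute intro!: exI[of _ "b + q * a"])
    qed
    then have inc: "incseq V" by (rule incseq_SucI)
    have UV: "(\<Union>N. V N) = U"
    proof
      show "U \<subseteq> (\<Union>N. V N)"
      proof
        fix x assume "x \<in> U"
        then obtain n where n: "\<forall>a. x \<in> Ball (int n) (u a) \<longrightarrow> Ball (int n) (u a) \<subseteq> U"
          using Ball_nhds[OF U(1)] by blast
        obtain K where K: "\<pp> ^ K * x \<in> D" using prime_power_mult_D_ex by blast
        define N where "N = max n K"
        have "\<pp> ^ (2 * N) * (\<pp> powi (- int N) * x) = \<pp> ^ (N - K) * (\<pp> ^ K * x)"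
          using prime_nonzero by (simp add: N_def power_int_minus field_simps power_add[symmetric] mult_2)
        also have "\<dots> \<in> D" by (rule D_mult[OF prime_power_D K])
        finally obtain a where a: "a < q ^ (2 * N)" "\<pp> powi (- int N) * x - u a \<in> D"
          using u_exists_level by blast
        then have xN: "x \<in> Ball (int N) (u a)" by (simp add: Ball_def)
        obtain b where b: "x \<in> Ball (int n) (u b)" using Ball_u_cover by blast
        have "Ball (int N) (u a) \<subseteq> Ball (int n) (u b)"
          by (rule Ball_nested[OF xN b]) (simp add: N_def)
        then have "Ball (int N) (u a) \<subseteq> U" using n b by blast
        then show "x \<in> (\<Union>N. V N)" using a xN by (auto simp: V_def I_def)
      qed
    qed (use VU in blast)
    have Vfin: "emeasure M (V N) < \<infinity>" for N
      using emeasure_mono[OF VU Us, of N] U(2) by (rule le_less_trans)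
    have "(\<lambda>N. emeasure M (V N)) \<longlonglongrightarrow> emeasure M U"
      using Lim_emeasure_incseq[OF _ inc, of M] Vs UV by auto
    then have "(\<lambda>N. measure M (V N)) \<longlonglongrightarrow> measure M U"
      unfolding measure_def using U(2) by (intro tendsto_enn2real) auto
    then have "(\<lambda>N. \<bar>measure M U - measure M (V N)\<bar>) \<longlonglongrightarrow> \<bar>measure M U - measure M U\<bar>"
      by (intro tendsto_intros)
    then have lim0: "(\<lambda>N. \<bar>measure M U - measure M (V N)\<bar>) \<longlonglongrightarrow> 0" by simp
    have "P (indicator (V N))" for N
    proof -
      have "indicator (V N) = (\<lambda>x. \<Sum>a\<in>I N. ball_fun N a x :: complex)"
        unfolding V_def fun_eq_iff
        using indicator_UN_disjoint[OF finI, of "\<lambda>a. Ball (int N) (u a)" N] Ball_u_disjoint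
        by (auto simp: disjoint_family_on_def)
      then show ?thesis using sum[OF finI, of N "\<lambda>a. ball_fun N a"] ball indicator_Ball_L2
        by simp
    qed
    then show ?thesis
      by (intro indicator_lim[of U V]) (use Us U Vs Vfin lim0 VU in auto)
  qed
  have P_set: "P (indicator A)" if A: "A \<in> sets M" "emeasure M A < \<infinity>" for A
  proof -
    have "\<exists>U. open U \<and> A \<subseteq> U \<and> emeasure M U < emeasure M A + ennreal (1 / real (Suc i))" for i
    proof -
      have "emeasure M A < emeasure M A + ennreal (1 / real (Suc i))"
        using A(2) emeasure_eq_ennreal_measure[of M A]
        by (simp add: ennreal_plus[symmetric] ennreal_less_iff del: ennreal_plus)
      then have "(INF U \<in> {U. open U \<and> A \<subseteq> U}. emeasure M U) < emeasure M A + ennreal (1 / real (Suc i))"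
        using outer_regular[OF A(1)] by simp
      then show ?thesis unfolding INF_less_iff by auto
    qed
    then obtain U where U: "\<And>i. open (U i)" "\<And>i. A \<subseteq> U i"
      "\<And>i. emeasure M (U i) < emeasure M A + ennreal (1 / real (Suc i))" by metis
    have Ufin: "emeasure M (U i) < \<infinity>" for i
    proof -
      have "emeasure M A + ennreal (1 / real (Suc i)) < \<infinity>" using A(2) by simp
      then show ?thesis using U(3)[of i] by (rule less_trans[rotated])
    qed
    have meas: "measure M (U i) \<le> measure M A + 1 / real (Suc i)" "measure M A \<le> measure M (U i)" for i
    proof -
      have "ennreal (measure M (U i)) \<le> ennreal (measure M A + 1 / real (Suc i))"
        using U(3)[of i] Ufin[of i] A(2)
        by (simp add: emeasure_eq_ennreal_measure ennreal_plus less_imp_le del: of_nat_Suc)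
      then show "measure M (U i) \<le> measure M A + 1 / real (Suc i)"
        by (subst (asm) ennreal_le_iff) auto
      show "measure M A \<le> measure M (U i)"
        using U Ufin A open_sets_M by (intro measure_mono_fmeasurable) (auto simp: fmeasurable_def)
    qed
    have "(\<lambda>i. \<bar>measure M A - measure M (U i)\<bar>) \<longlonglongrightarrow> 0"
    proof (rule tendsto_sandwich[OF _ _ tendsto_const LIMSEQ_Suc[OF lim_inverse_n']])
      show "\<forall>\<^sub>F i in sequentially. \<bar>measure M A - measure M (U i)\<bar> \<le> 1 / real (Suc i)"
        using meas by (auto simp: abs_if algebra_simps intro!: always_eventually) (smt (verit) meas)+
    qed auto
    then show ?thesis
      by (intro indicator_lim[of A U])
         (use A U Ufin open_sets_M P_open in auto)
  qed
  have P_simple: "P s" if s: "simple_function M s" "s \<in> L2" for s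
  proof -
    have s_eq: "s = (\<lambda>x. \<Sum>y\<in>range s. y * indicator (s -` {y}) x)"
    proof
      fix x
      have "(\<Sum>y\<in>range s. y * indicator (s -` {y}) x) = (\<Sum>y\<in>range s. if y = s x then y else 0)"
        by (intro sum.cong) (auto simp: indicator_def)
      then show "s x = (\<Sum>y\<in>range s. y * indicator (s -` {y}) x)"
        using s by (simp add: simple_function_def)
    qed
    have fin: "finite (range s)" using s by (simp add: simple_function_def)
    have each: "P (\<lambda>x. y * indicator (s -` {y}) x) \<and> (\<lambda>x. y * indicator (s -` {y}) x) \<in> L2" for y
    proof (cases "y = 0")
      case True
      then show ?thesis using zero L2_zero by simp
    next
      case False
      have sets: "s -` {y} \<in> sets M"
        using measurable_sets[OF L2_meas[OF s(2)], of "{y}"] by simp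
      have "integrable M (\<lambda>x. (cmod (s x))\<^sup>2 / (cmod y)\<^sup>2)" using L2_int[OF s(2)] by simp
      then have "integrable M (indicator (s -` {y}) :: 'a \<Rightarrow> real)"
        by (rule Bochner_Integration.integrable_bound)
           (use sets False in \<open>auto simp: indicator_def\<close>)
      then have fin: "emeasure M (s -` {y}) < \<infinity>"
        by (simp add: integrable_indicator_iff)
      show ?thesis
        using cmult[OF indicator_L2(1)[OF sets fin] P_set[OF sets fin]]
          L2_cmult[OF indicator_L2(1)[OF sets fin]] by blast
    qed
    show ?thesis
      by (subst s_eq) (use sum[OF fin, of "\<lambda>y x. y * indicator (s -` {y}) x"] each in blast)
  qed
  \<comment> \<open>The approximants satisfy |s i| <= 2 |f|, which explains the constants 4 = 2^2
    and 9 = (1 + 2)^2 in the dominating functions.\<close>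
  obtain s where s: "\<And>i. simple_function M (s i)" "\<And>x. x \<in> space M \<Longrightarrow> (\<lambda>i. s i x) \<longlonglongrightarrow> f x"
    "\<And>i x. x \<in> space M \<Longrightarrow> norm (s i x) \<le> 2 * norm (f x)"
    using borel_measurable_implies_sequence_metric[OF L2_meas[OF f], of 0] by (auto simp: dist_norm)
  have sm [measurable]: "s i \<in> borel_measurable M" for i using s(1) by (rule borel_measurable_simple_function)
  have fm [measurable]: "f \<in> borel_measurable M" by (rule L2_meas[OF f])
  have sL2: "s i \<in> L2" for i
  proof (rule L2_dominated[where g = "\<lambda>x. 4 * (cmod (f x))\<^sup>2"])
    fix x
    have "(cmod (s i x))\<^sup>2 \<le> (2 * cmod (f x))\<^sup>2" using s(3) by (intro power_mono) auto
    then show "(cmod (s i x))\<^sup>2 \<le> 4 * (cmod (f x))\<^sup>2" by (simp add: power_mult_distrib)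
  qed (use L2_int[OF f] in auto)
  show "P f"
  proof (rule lim[OF f sL2])
    show "P (s i)" for i using P_simple s(1) sL2 by blast
    have "(\<lambda>i. \<integral>x. (cmod (f x - s i x))\<^sup>2 \<partial>M) \<longlonglongrightarrow> (\<integral>x. 0 \<partial>M)"
    proof (rule integral_dominated_convergence[where w = "\<lambda>x. 9 * (cmod (f x))\<^sup>2"])
      show "integrable M (\<lambda>x. 9 * (cmod (f x))\<^sup>2)" using L2_int[OF f] by simp
      show "AE x in M. (\<lambda>i. (cmod (f x - s i x))\<^sup>2) \<longlonglongrightarrow> 0"
      proof (intro AE_I2)
        fix x assume "x \<in> space M"
        then have "(\<lambda>i. (cmod (f x - s i x))\<^sup>2) \<longlonglongrightarrow> (cmod (f x - f x))\<^sup>2"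
          by (intro tendsto_intros s(2))
        then show "(\<lambda>i. (cmod (f x - s i x))\<^sup>2) \<longlonglongrightarrow> 0" by simp
      qed
      show "AE x in M. norm ((cmod (f x - s i x))\<^sup>2) \<le> 9 * (cmod (f x))\<^sup>2" for i
      proof (intro AE_I2)
        fix x assume "x \<in> space M"
        then have "cmod (f x - s i x) \<le> 3 * cmod (f x)"
          using s(3)[of x i] norm_triangle_ineq4[of "f x" "s i x"] by linarith
        then have "(cmod (f x - s i x))\<^sup>2 \<le> (3 * cmod (f x))\<^sup>2" by (intro power_mono) auto
        then show "norm ((cmod (f x - s i x))\<^sup>2) \<le> 9 * (cmod (f x))\<^sup>2" by (simp add: power_mult_distrib)
      qed
    qed measurable
    then show "(\<lambda>i. nsq (\<lambda>x. f x - s i x)) \<longlonglongrightarrow> 0" by (simp add: nsq_def)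
  qed
qed

subsection \<open>Bessel families\<close>

text \<open>The bound is imposed on finite partial sums, so that summability is a consequence and
  restriction to smaller index sets is immediate.\<close>

definition bessel_family :: "'i set \<Rightarrow> ('i \<Rightarrow> 'a \<Rightarrow> complex) \<Rightarrow> real \<Rightarrow> bool" where
  "bessel_family I e B \<longleftrightarrow> B \<ge> 0 \<and> (\<forall>i\<in>I. e i \<in> L2) \<and>
     (\<forall>f\<in>L2. \<forall>F. finite F \<longrightarrow> F \<subseteq> I \<longrightarrow> (\<Sum>i\<in>F. (cmod (L2_inner f (e i)))\<^sup>2) \<le> B * nsq f)"

lemma bessel_sum_le:
  assumes "bessel_family I e B" "f \<in> L2" "J \<subseteq> I"
  shows "(\<lambda>i. (cmod (L2_inner f (e i)))\<^sup>2) summable_on J"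
    and "(\<Sum>\<^sub>\<infinity>i\<in>J. (cmod (L2_inner f (e i)))\<^sup>2) \<le> B * nsq f"
proof -
  have *: "sum (\<lambda>i. (cmod (L2_inner f (e i)))\<^sup>2) F \<le> B * nsq f" if "finite F" "F \<subseteq> J" for F
    using assms that unfolding bessel_family_def by (meson order_trans)
  show "(\<lambda>i. (cmod (L2_inner f (e i)))\<^sup>2) summable_on J"
    and "(\<Sum>\<^sub>\<infinity>i\<in>J. (cmod (L2_inner f (e i)))\<^sup>2) \<le> B * nsq f"
    using infsum_le_if_finite_sums_le[of J "\<lambda>i. (cmod (L2_inner f (e i)))\<^sup>2" "B * nsq f"] * by auto
qed

lemma bessel_products:
  assumes a: "bessel_family I a A" and b: "bessel_family I b B" and f: "f \<in> L2" and g: "g \<in> L2"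
  shows "(\<lambda>i. norm (L2_inner f (a i) * L2_inner (b i) g)) summable_on I"
    and "cmod (\<Sum>\<^sub>\<infinity>i\<in>I. L2_inner f (a i) * L2_inner (b i) g) \<le> sqrt (A * nsq f) * sqrt (B * nsq g)"
proof -
  have *: "(\<Sum>i\<in>F. norm (L2_inner f (a i) * L2_inner (b i) g)) \<le> sqrt (A * nsq f) * sqrt (B * nsq g)"
    if "finite F" "F \<subseteq> I" for F
  proof -
    have "(\<Sum>i\<in>F. norm (L2_inner f (a i) * L2_inner (b i) g))
        = (\<Sum>i\<in>F. \<bar>cmod (L2_inner f (a i))\<bar> * \<bar>cmod (L2_inner g (b i))\<bar>)"
      by (intro sum.cong) (simp_all add: norm_mult inner_cnj[of "b _" g])
    also have "\<dots> \<le> L2_set (\<lambda>i. cmod (L2_inner f (a i))) F * L2_set (\<lambda>i. cmod (L2_inner g (b i))) F"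
      by (rule L2_set_mult_ineq)
    also have "\<dots> \<le> sqrt (A * nsq f) * sqrt (B * nsq g)"
      unfolding L2_set_def using a b f g that
      by (intro mult_mono real_sqrt_le_mono) (auto simp: bessel_family_def intro!: sum_nonneg)
    finally show ?thesis .
  qed
  show s: "(\<lambda>i. norm (L2_inner f (a i) * L2_inner (b i) g)) summable_on I"
    by (rule infsum_le_if_finite_sums_le[OF _ *]) auto
  have "cmod (\<Sum>\<^sub>\<infinity>i\<in>I. L2_inner f (a i) * L2_inner (b i) g)
      \<le> (\<Sum>\<^sub>\<infinity>i\<in>I. norm (L2_inner f (a i) * L2_inner (b i) g))"
    by (rule norm_infsum_bound[OF s])
  also have "\<dots> \<le> sqrt (A * nsq f) * sqrt (B * nsq g)"
    by (rule infsum_le_if_finite_sums_le[OF _ *]) auto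
  finally show "cmod (\<Sum>\<^sub>\<infinity>i\<in>I. L2_inner f (a i) * L2_inner (b i) g) \<le> sqrt (A * nsq f) * sqrt (B * nsq g)" .
qed

text \<open>For fixed g both sides are linear in f and, by the two Bessel bounds and Cauchy-Schwarz,
  continuous in norm, so the identity spreads from indicators of balls to all f.\<close>

lemma dual_extend_left:
  assumes a: "bessel_family I a A" and b: "bessel_family I b B" and g: "g \<in> L2"
    and ball: "\<And>(n :: nat) m. ((\<lambda>i. L2_inner (ball_fun n m) (a i) * L2_inner (b i) g)
        has_sum L2_inner (ball_fun n m) g) I"
    and f: "f \<in> L2"
  shows "((\<lambda>i. L2_inner f (a i) * L2_inner (b i) g) has_sum L2_inner f g) I"
proof -
  define T where "T f = (\<Sum>\<^sub>\<infinity>i\<in>I. L2_inner f (a i) * L2_inner (b i) g)" for f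
  have aL2: "a i \<in> L2" if "i \<in> I" for i using a that by (simp add: bessel_family_def)
  have summ: "(\<lambda>i. L2_inner f (a i) * L2_inner (b i) g) summable_on I" if "f \<in> L2" for f
    by (rule abs_summable_summable[OF bessel_products(1)[OF a b that g]])
  have T_add: "T (\<lambda>x. f x + f' x) = T f + T f'" if "f \<in> L2" "f' \<in> L2" for f f'
  proof -
    have "T (\<lambda>x. f x + f' x)
        = (\<Sum>\<^sub>\<infinity>i\<in>I. L2_inner f (a i) * L2_inner (b i) g + L2_inner f' (a i) * L2_inner (b i) g)"
      unfolding T_def by (intro infsum_cong) (simp add: inner_add_left that aL2 distrib_right)
    then show ?thesis unfolding T_def by (simp add: infsum_add summ that)
  qed
  have T_cmult: "T (\<lambda>x. z * f x) = z * T f" for z f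
    unfolding T_def by (simp add: inner_cmult_left mult.assoc infsum_cmult_right')
  have "T f = L2_inner f g"
    using f
  proof (induction rule: L2_ball_induct)
    case (add f g')
    then show ?case by (simp add: T_add inner_add_left g)
  next
    case (cmult f z)
    then show ?case by (simp add: T_cmult inner_cmult_left)
  next
    case (lim f s)
    have d: "(\<lambda>x. f x - s i x) \<in> L2" for i using lim by (intro L2_diff) auto
    have "cmod (T f - L2_inner f g) \<le> sqrt (A * nsq (\<lambda>x. f x - s i x)) * sqrt (B * nsq g)
        + sqrt (nsq (\<lambda>x. f x - s i x) * nsq g)" for i
    proof -
      have IH: "T (s i) = L2_inner (s i) g" using lim by blast
      have "T f = T (\<lambda>x. f x - s i x) + T (s i)" using T_add[OF d[of i], of "s i"] lim by simp
      moreover have "L2_inner f g = L2_inner (\<lambda>x. f x - s i x) g + L2_inner (s i) g"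
        using inner_add_left[OF d[of i], of "s i" g] lim g by simp
      ultimately have "T f - L2_inner f g = T (\<lambda>x. f x - s i x) - L2_inner (\<lambda>x. f x - s i x) g"
        using IH by simp
      also have "cmod \<dots> \<le> cmod (T (\<lambda>x. f x - s i x)) + cmod (L2_inner (\<lambda>x. f x - s i x) g)"
        by (rule norm_triangle_ineq4)
      also have "cmod (T (\<lambda>x. f x - s i x)) \<le> sqrt (A * nsq (\<lambda>x. f x - s i x)) * sqrt (B * nsq g)"
        unfolding T_def by (rule bessel_products(2)[OF a b d g])
      also have "cmod (L2_inner (\<lambda>x. f x - s i x) g) \<le> sqrt (nsq (\<lambda>x. f x - s i x) * nsq g)"
        by (rule real_le_rsqrt[OF inner_Cauchy_Schwarz[OF d g]])
      finally show ?thesis by simp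
    qed
    moreover have "(\<lambda>i. sqrt (A * nsq (\<lambda>x. f x - s i x)) * sqrt (B * nsq g)
        + sqrt (nsq (\<lambda>x. f x - s i x) * nsq g)) \<longlonglongrightarrow> sqrt (A * 0) * sqrt (B * nsq g) + sqrt (0 * nsq g)"
      by (intro tendsto_intros lim)
    ultimately have "cmod (T f - L2_inner f g) \<le> sqrt (A * 0) * sqrt (B * nsq g) + sqrt (0 * nsq g)"
      by (intro LIMSEQ_le_const) auto
    then show ?case by simp
  next
    case (ball n m)
    show ?case unfolding T_def by (rule infsumI[OF assms(4)])
  qed
  then show ?thesis using has_sum_infsum[OF summ[OF f]] by (simp add: T_def)
qed

text \<open>Complex conjugation exchanges the two families together with f and g, so the extension
  in one variable can be applied twice.\<close>

lemma dual_extend: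
  assumes a: "bessel_family I a A" and b: "bessel_family I b B"
    and ball: "\<And>(n :: nat) m (n' :: nat) m'.
        ((\<lambda>i. L2_inner (ball_fun n m) (a i) * L2_inner (b i) (ball_fun n' m'))
        has_sum L2_inner (ball_fun n m) (ball_fun n' m')) I"
    and f: "f \<in> L2" and g: "g \<in> L2"
  shows "((\<lambda>i. L2_inner f (a i) * L2_inner (b i) g) has_sum L2_inner f g) I"
proof -
  have swap: "((\<lambda>i. L2_inner g (b i) * L2_inner (a i) f) has_sum L2_inner g f) I \<longleftrightarrow>
      ((\<lambda>i. L2_inner f (a i) * L2_inner (b i) g) has_sum L2_inner f g) I" for f g
    unfolding inner_cnj[of g f] has_sum_cnj_iff[of _ _ "L2_inner f g", symmetric]
    by (simp add: inner_cnj[of g "b _"] inner_cnj[of "a _" f] mult.commute)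
  show ?thesis
    unfolding swap[of g f, symmetric]
    by (rule dual_extend_left[OF b a f _ g])
       (unfold swap, rule dual_extend_left[OF a b indicator_Ball_L2 ball f])
qed

subsection \<open>Coefficients and averaging over the lattice\<close>

text \<open>The translation is by the position y in K itself: affine elements sit at \<pp>^j
  \<open>u k\<close>, quasi-affine ones at \<open>u k\<close> for negative j. The coefficients
  become functions of y, which the two systems sample on different lattices.\<close>

definition atom :: "('a \<Rightarrow> complex) \<Rightarrow> int \<Rightarrow> 'a \<Rightarrow> 'a \<Rightarrow> complex" where
  "atom h j y = (\<lambda>x. of_real (real q powr (real_of_int j / 2)) * h (\<pp> powi (- j) * (x - y)))"

definition coef :: "('a \<Rightarrow> complex) \<Rightarrow> ('a \<Rightarrow> complex) \<Rightarrow> int \<Rightarrow> 'a \<Rightarrow> complex" where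
  "coef f h j y = L2_inner f (atom h j y)"

lemma powr_half_sq: "(real q powr (real_of_int j / 2))\<^sup>2 = real q powi j"
proof -
  have "(real q powr (real_of_int j / 2))\<^sup>2 = real q powr real_of_int j"
    by (simp add: power2_eq_square flip: powr_add)
  then show ?thesis using powr_real_of_int'[of "real q" j] q_pos by simp
qed

lemma atom_L2: "h \<in> L2 \<Longrightarrow> atom h j y \<in> L2"
  using L2_cmult[OF L2_affine[of h "\<pp> powi (- j)" "- (\<pp> powi (- j) * y)"]]
  by (simp add: atom_def right_diff_distrib)

lemma affine_elem_eq_atom: "affine_elem h j k = atom h j (\<pp> powi j * u k)"
  using prime_nonzero
  by (simp add: affine_elem_def dilation_def translation_def atom_def right_diff_distrib
      mult.assoc[symmetric] power_int_add[symmetric])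

lemma quasi_affine_elem_eq_atom:
  "quasi_affine_elem h j k = (if j \<ge> 0 then atom h j (\<pp> powi j * u k)
     else (\<lambda>x. of_real (real q powr (real_of_int j / 2)) * atom h j (u k) x))"
  using affine_elem_eq_atom[of h j k]
  by (simp add: quasi_affine_elem_def affine_elem_def) (simp add: dilation_def translation_def atom_def)

lemma affine_elem_L2: "h \<in> L2 \<Longrightarrow> affine_elem h j k \<in> L2"
  by (simp add: affine_elem_eq_atom atom_L2)

lemma quasi_affine_elem_L2: "h \<in> L2 \<Longrightarrow> quasi_affine_elem h j k \<in> L2"
  by (simp add: quasi_affine_elem_eq_atom atom_L2 L2_cmult)

lemma inner_affine_elem: "L2_inner f (affine_elem h j k) = coef f h j (\<pp> powi j * u k)"
  by (simp add: affine_elem_eq_atom coef_def)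

lemma inner_quasi_affine_elem:
  "L2_inner f (quasi_affine_elem h j k) = (if j \<ge> 0 then coef f h j (\<pp> powi j * u k)
     else of_real (real q powr (real_of_int j / 2)) * coef f h j (u k))"
  by (simp add: quasi_affine_elem_eq_atom coef_def inner_cmult_right)

lemma translate_L2: "f \<in> L2 \<Longrightarrow> (\<lambda>x. f (x + z)) \<in> L2"
  using L2_affine[of f 1 z] by simp

lemma nsq_translate: "f \<in> L2 \<Longrightarrow> nsq (\<lambda>x. f (x + z)) = nsq f"
  using nsq_affine[of f 1 z] by simp

lemma inner_translate: "f \<in> L2 \<Longrightarrow> g \<in> L2 \<Longrightarrow> L2_inner (\<lambda>x. f (x + z)) (\<lambda>x. g (x + z)) = L2_inner f g"
  using inner_affine[of f g 1 z] by simp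

lemma coef_translate:
  assumes "f \<in> L2" "h \<in> L2"
  shows "coef (\<lambda>x. f (x + z)) h j y = coef f h j (y + z)"
  using inner_translate[OF assms(1) atom_L2[OF assms(2)], of z j "y + z"]
  by (simp add: coef_def atom_def)

lemma dilation_eq: "dilation j f = (\<lambda>x. of_real (real q powr (real_of_int j / 2)) * f (\<pp> powi (- j) * x + 0))"
  by (simp add: dilation_def)

lemma dilation_L2: "f \<in> L2 \<Longrightarrow> dilation j f \<in> L2"
  unfolding dilation_eq by (intro L2_cmult L2_affine) auto

lemma inner_dilation:
  assumes "f \<in> L2" "g \<in> L2"
  shows "L2_inner (dilation j f) (dilation j g) = L2_inner f g"
proof -
  have "L2_inner (dilation j f) (dilation j g)
      = of_real ((real q powr (real_of_int j / 2))\<^sup>2) * (L2_inner f g / of_real (av (\<pp> powi (- j))))"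
    unfolding dilation_eq inner_cmult_left inner_cmult_right
    by (subst inner_affine) (use assms in \<open>simp_all add: power2_eq_square\<close>)
  also have "\<dots> = L2_inner f g"
    unfolding powr_half_sq av_prime_powi using q_pos by simp
  finally show ?thesis .
qed

lemma atom_dilation: "dilation n (atom h j y) = atom h (j + n) (\<pp> powi n * y)"
proof
  fix x
  have 1: "\<pp> powi (- j) * (\<pp> powi (- n) * x - y) = \<pp> powi (- (j + n)) * (x - \<pp> powi n * y)"
    using prime_nonzero
    by (simp add: right_diff_distrib mult.assoc[symmetric] power_int_add[symmetric])
  have 2: "real q powr (real_of_int n / 2) * real q powr (real_of_int j / 2) = real q powr (real_of_int (j + n) / 2)"
    by (simp add: powr_add[symmetric] add_divide_distrib add.commute)
  have "of_real (real q powr (real_of_int n / 2)) * (of_real (real q powr (real_of_int j / 2)) * w)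
      = of_real (real q powr (real_of_int (j + n) / 2)) * w" for w :: complex
    unfolding 2[symmetric] by (simp add: mult.assoc)
  then show "dilation n (atom h j y) x = atom h (j + n) (\<pp> powi n * y) x"
    unfolding dilation_def atom_def 1 by simp
qed

lemma coef_dilation:
  assumes "f \<in> L2" "h \<in> L2"
  shows "coef (dilation n f) h j y = coef f h (j - n) (\<pp> powi (- n) * y)"
proof -
  have "atom h j y = dilation n (atom h (j - n) (\<pp> powi (- n) * y))"
    unfolding atom_dilation using prime_nonzero by (simp add: mult.assoc[symmetric] power_int_add[symmetric])
  then show ?thesis unfolding coef_def by (simp add: inner_dilation assms atom_L2)
qed

text \<open>The change of variables that undoes the dilation of h carries the ball to one of level n
  - j. All estimates of low levels thereby become estimates of integrals of h over balls. The power
  of q combines q^j from the normalisation with q^(-2j) from the Jacobian.\<close>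

lemma coef_Ball:
  assumes "h \<in> L2"
  shows "(cmod (coef (indicator (Ball n v)) h j y))\<^sup>2 =
    real q powi (- j) * (cmod (L2_inner h (indicator (Ball (n - j) (v - \<pp> powi (- n) * y)))))\<^sup>2"
proof -
  let ?B = "Ball (n - j) (v - \<pp> powi (- n) * y)"
  let ?\<alpha> = "\<pp> powi (- j)" and ?\<beta> = "- (\<pp> powi (- j) * y)"
  have mem: "x \<in> Ball n v \<longleftrightarrow> ?\<alpha> * x + ?\<beta> \<in> ?B" for x
  proof -
    have "\<pp> powi (- (n - j)) * (?\<alpha> * x + ?\<beta>) - (v - \<pp> powi (- n) * y) = \<pp> powi (- n) * x - v"
      using prime_nonzero
      by (simp add: distrib_left right_diff_distrib mult.assoc[symmetric] power_int_add[symmetric])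
    then show ?thesis unfolding Ball_def mem_Collect_eq by (simp only:)
  qed
  have ind: "indicator (Ball n v) = (\<lambda>x. indicator ?B (?\<alpha> * x + ?\<beta>) :: complex)"
    using mem by (auto simp: fun_eq_iff indicator_def)
  have "coef (indicator (Ball n v)) h j y
      = of_real (real q powr (real_of_int j / 2)) * L2_inner (\<lambda>x. indicator ?B (?\<alpha> * x + ?\<beta>)) (\<lambda>x. h (?\<alpha> * x + ?\<beta>))"
    unfolding ind coef_def atom_def inner_cmult_right by (simp add: right_diff_distrib)
  also have "L2_inner (\<lambda>x. indicator ?B (?\<alpha> * x + ?\<beta>)) (\<lambda>x. h (?\<alpha> * x + ?\<beta>))
      = L2_inner (indicator ?B) h / of_real (av ?\<alpha>)"
    by (rule inner_affine[OF indicator_Ball_L2 assms]) simp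
  finally have "(cmod (coef (indicator (Ball n v)) h j y))\<^sup>2
      = (real q powr (real_of_int j / 2))\<^sup>2 * (cmod (L2_inner (indicator ?B) h))\<^sup>2 / (av ?\<alpha>)\<^sup>2"
    by (simp add: norm_mult norm_divide power_mult_distrib power_divide)
  also have "\<dots> = real q powi (- j) * (cmod (L2_inner (indicator ?B) h))\<^sup>2"
    unfolding powr_half_sq av_prime_powi using q_ge_2
    by (simp add: power_int_minus divide_simps power2_eq_square)
  also have "cmod (L2_inner (indicator ?B) h) = cmod (L2_inner h (indicator ?B))"
    by (simp add: inner_cnj[of h])
  finally show ?thesis .
qed

section \<open>Sums over the lattice and its cosets\<close>

lemma u_inv: "x \<in> range u \<Longrightarrow> u (inv u x) = x"
  by (rule f_inv_into_f)

lemma bij_lattice_shift: "bij (\<lambda>k. inv u (u n + u k))"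
proof (rule o_bij[where g = "\<lambda>k. inv u (u k - u n)"])
  have inv: "inv u (u k) = k" for k by (rule inv_f_f[OF inj_u])
  show "(\<lambda>k. inv u (u k - u n)) \<circ> (\<lambda>k. inv u (u n + u k)) = id"
    by (auto simp: fun_eq_iff u_inv u_range_add inv)
  show "(\<lambda>k. inv u (u n + u k)) \<circ> (\<lambda>k. inv u (u k - u n)) = id"
    by (auto simp: fun_eq_iff u_inv u_range_diff inv)
qed

text \<open>Adding \<open>u n\<close> permutes the lattice, so the sum over a coset does not depend
  on the chosen representative.\<close>

lemma infsum_lattice_shift:
  fixes \<Theta> :: "'a \<Rightarrow> 'b :: banach"
  shows "(\<Sum>\<^sub>\<infinity>k. \<Theta> (z + \<pp> powi j * u n + \<pp> powi j * u k)) = (\<Sum>\<^sub>\<infinity>k. \<Theta> (z + \<pp> powi j * u k))"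
proof -
  have "(\<Sum>\<^sub>\<infinity>k. \<Theta> (z + \<pp> powi j * u (inv u (u n + u k)))) = (\<Sum>\<^sub>\<infinity>k. \<Theta> (z + \<pp> powi j * u k))"
    by (rule infsum_reindex_bij_betw[OF bij_lattice_shift])
  then show ?thesis by (simp add: u_inv u_range_add distrib_left add.assoc)
qed

lemma bij_betw_digits: "bij_betw (\<lambda>(r, k). r + q ^ m * k) ({..<q ^ m} \<times> UNIV) UNIV"
proof (rule bij_betw_byWitness[where f' = "\<lambda>n. (n mod q ^ m, n div q ^ m)"])
qed auto

lemma powi_neg_u: "\<pp> powi (- int m) * x = x / \<pp> ^ m"
  by (simp add: power_int_minus divide_inverse mult.commute)

text \<open>Every index is r + q^m k in exactly one way, which \<open>u_split\<close> turns into the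
  decomposition of the lattice into q^m cosets of its sublattice.\<close>

lemma lattice_sum_split:
  fixes \<Theta> :: "'a \<Rightarrow> 'b :: banach"
  assumes summ: "\<And>r. r < q ^ m \<Longrightarrow> (\<lambda>k. norm (\<Theta> (u r + \<pp> powi (- int m) * u k))) summable_on UNIV"
  shows "(\<lambda>k. norm (\<Theta> (u k))) summable_on UNIV"
    and "(\<Sum>\<^sub>\<infinity>k. \<Theta> (u k)) = (\<Sum>r<q ^ m. \<Sum>\<^sub>\<infinity>k. \<Theta> (u r + \<pp> powi (- int m) * u k))"
proof -
  define F where "F = (\<lambda>(r, k). \<Theta> (u (r + q ^ m * k)))"
  have F: "F (r, k) = \<Theta> (u r + \<pp> powi (- int m) * u k)" if "r < q ^ m" for r k
    using u_split[OF that, of k] by (simp add: F_def powi_neg_u)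
  have sF: "(\<lambda>i. norm (F i)) summable_on ({..<q ^ m} \<times> UNIV)"
    by (subst Infinite_Sum.abs_summable_on_Sigma_iff) (auto simp: F summ)
  have eq: "(\<lambda>i. \<Theta> (u ((\<lambda>(r, k). r + q ^ m * k) i))) = F"
    by (auto simp: F_def fun_eq_iff)
  show "(\<lambda>k. norm (\<Theta> (u k))) summable_on UNIV"
    using sF unfolding eq[symmetric]
    using summable_on_reindex_bij_betw[OF bij_betw_digits, of "\<lambda>k. norm (\<Theta> (u k))" m] by simp
  have "(\<Sum>\<^sub>\<infinity>k. \<Theta> (u k)) = infsum F ({..<q ^ m} \<times> UNIV)"
    unfolding eq[symmetric] by (rule infsum_reindex_bij_betw[OF bij_betw_digits, symmetric])
  also have "\<dots> = (\<Sum>\<^sub>\<infinity>r\<in>{..<q ^ m}. \<Sum>\<^sub>\<infinity>k. F (r, k))"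
    by (rule infsum_Sigma_banach[symmetric]) (rule abs_summable_summable[OF sF])
  also have "\<dots> = (\<Sum>r<q ^ m. \<Sum>\<^sub>\<infinity>k. \<Theta> (u r + \<pp> powi (- int m) * u k))"
    by (simp add: F)
  finally show "(\<Sum>\<^sub>\<infinity>k. \<Theta> (u k)) = (\<Sum>r<q ^ m. \<Sum>\<^sub>\<infinity>k. \<Theta> (u r + \<pp> powi (- int m) * u k))" .
qed

text \<open>
  For \<open>-N \<le> j < 0\<close> the lattice \<open>{u k}\<close> is a union of cosets of \<open>\<pp>\<^sup>j{u k}\<close>, so the quasi-affine sum
  at level \<open>j\<close> is the average of the affine sums over the translates by \<open>u r\<close>, \<open>r < q\<^sup>N\<close>.
\<close>

lemma lattice_average_neg:
  fixes \<Theta> :: "'a \<Rightarrow> 'b :: banach"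
  assumes summ: "\<And>z. (\<lambda>k. norm (\<Theta> (z + \<pp> powi (- int m) * u k))) summable_on UNIV" and mN: "m \<le> N"
  shows "(\<Sum>r<q ^ N. \<Sum>\<^sub>\<infinity>k. \<Theta> (u r + \<pp> powi (- int m) * u k)) = real (q ^ (N - m)) *\<^sub>R (\<Sum>\<^sub>\<infinity>k. \<Theta> (u k))"
proof -
  define S where "S z = (\<Sum>\<^sub>\<infinity>k. \<Theta> (z + \<pp> powi (- int m) * u k))" for z
  \<comment> \<open>\<open>S (u r)\<close> depends only on the coset, that is on r mod q^m, and each
    of these residues occurs q^(N - m) times among the r < q^N.\<close>
  have "(\<Sum>r<q ^ N. S (u r)) = (\<Sum>(r, s)\<in>{..<q ^ m} \<times> {..<q ^ (N - m)}. S (u r))"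
  proof (rule sum.reindex_bij_witness[where j = "\<lambda>n. (n mod q ^ m, n div q ^ m)" and i = "\<lambda>(r, s). r + q ^ m * s"])
    fix n assume "n \<in> {..<q ^ N}"
    moreover have "q ^ N = q ^ (N - m) * q ^ m" using mN by (simp flip: power_add)
    ultimately show "(n mod q ^ m, n div q ^ m) \<in> {..<q ^ m} \<times> {..<q ^ (N - m)}"
      by (auto simp: less_mult_imp_div_less)
    have "u n = u (n mod q ^ m) + \<pp> powi (- int m) * u (n div q ^ m)"
      using u_split[of "n mod q ^ m" m "n div q ^ m"] by (simp add: powi_neg_u)
    then show "(case (n mod q ^ m, n div q ^ m) of (r, s) \<Rightarrow> S (u r)) = S (u n)"
      using infsum_lattice_shift[of \<Theta> "u (n mod q ^ m)" "- int m" "n div q ^ m"] by (simp add: S_def)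
  next
    fix p assume p: "p \<in> {..<q ^ m} \<times> {..<q ^ (N - m)}"
    then obtain r s where rs: "p = (r, s)" "r < q ^ m" "s < q ^ (N - m)" by auto
    have "r + q ^ m * s < q ^ m * (s + 1)" using rs by simp
    also have "\<dots> \<le> q ^ m * q ^ (N - m)" using rs by (intro mult_left_mono) auto
    also have "\<dots> = q ^ N" using mN by (simp flip: power_add)
    finally show "(case p of (r, s) \<Rightarrow> r + q ^ m * s) \<in> {..<q ^ N}" using rs by simp
  qed auto
  also have "\<dots> = real (q ^ (N - m)) *\<^sub>R (\<Sum>r<q ^ m. S (u r))"
    by (simp add: sum.cartesian_product[symmetric] sum_constant_scaleR scaleR_sum_right)
  also have "(\<Sum>r<q ^ m. S (u r)) = (\<Sum>\<^sub>\<infinity>k. \<Theta> (u k))"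
    unfolding S_def by (rule lattice_sum_split(2)[symmetric]) (rule summ)
  finally show ?thesis by (simp add: S_def)
qed

text \<open>For j >= 0 the lattice \<pp>^j {u k} contains every \<open>u r\<close>, so each
  translation only permutes it and all q^N terms are equal.\<close>

lemma lattice_average_nonneg:
  fixes \<Theta> :: "'a \<Rightarrow> 'b :: banach"
  shows "(\<Sum>r<q ^ N. \<Sum>\<^sub>\<infinity>k. \<Theta> (u r + \<pp> ^ j * u k)) = real (q ^ N) *\<^sub>R (\<Sum>\<^sub>\<infinity>k. \<Theta> (\<pp> ^ j * u k))"
proof -
  have "(\<Sum>\<^sub>\<infinity>k. \<Theta> (u r + \<pp> ^ j * u k)) = (\<Sum>\<^sub>\<infinity>k. \<Theta> (\<pp> ^ j * u k))" for r
  proof -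
    have "u r = \<pp> ^ j * u (q ^ j * r)" using prime_nonzero by (simp add: u_shift)
    then show ?thesis using infsum_lattice_shift[of \<Theta> 0 "int j" "q ^ j * r"] by simp
  qed
  then show ?thesis by (simp add: sum_constant_scaleR)
qed

subsection \<open>Averaged low affine frequencies\<close>

text \<open>By Cauchy-Schwarz on a ball, the squared integral of h over it is at most its Haar
  measure times its mass under this finite measure, and the masses of disjoint balls add up.\<close>

definition sq_measure :: "('a \<Rightarrow> complex) \<Rightarrow> 'a measure" where
  "sq_measure h = density M (\<lambda>x. ennreal ((cmod (h x))\<^sup>2))"

lemma sets_sq_measure [simp]: "sets (sq_measure h) = sets M"
  and space_sq_measure [simp]: "space (sq_measure h) = UNIV"
  by (simp_all add: sq_measure_def)

lemma emeasure_sq_measure: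
  assumes "h \<in> L2" "S \<in> sets M"
  shows "emeasure (sq_measure h) S = ennreal (nsq (\<lambda>x. indicator S x * h x))"
    and "(\<lambda>x. indicator S x * h x) \<in> L2"
proof -
  have m [measurable]: "h \<in> borel_measurable M" by (rule L2_meas[OF assms(1)])
  note [measurable] = assms(2)
  show L: "(\<lambda>x. indicator S x * h x) \<in> L2"
    by (rule L2_dominated[OF _ L2_int[OF assms(1)]]) (auto simp: indicator_def)
  have "emeasure (sq_measure h) S = (\<integral>\<^sup>+x. ennreal ((cmod (h x))\<^sup>2) * indicator S x \<partial>M)"
    unfolding sq_measure_def by (rule emeasure_density) auto
  also have "\<dots> = (\<integral>\<^sup>+x. ennreal ((cmod (indicator S x * h x))\<^sup>2) \<partial>M)"
    by (intro nn_integral_cong) (auto simp: indicator_def)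
  also have "\<dots> = ennreal (nsq (\<lambda>x. indicator S x * h x))"
    unfolding nsq_def by (rule nn_integral_eq_integral) (use L2_int[OF L] in auto)
  finally show "emeasure (sq_measure h) S = ennreal (nsq (\<lambda>x. indicator S x * h x))" .
qed

lemma measure_sq_measure:
  "h \<in> L2 \<Longrightarrow> S \<in> sets M \<Longrightarrow> measure (sq_measure h) S = nsq (\<lambda>x. indicator S x * h x)"
  by (simp add: measure_def emeasure_sq_measure)

lemma finite_measure_sq_measure: "h \<in> L2 \<Longrightarrow> finite_measure (sq_measure h)"
  by (rule finite_measureI) (use emeasure_sq_measure(1)[of h UNIV] open_sets_M in auto)

lemma measure_sq_measure_le: "h \<in> L2 \<Longrightarrow> measure (sq_measure h) S \<le> nsq h"
  using finite_measure.bounded_measure[OF finite_measure_sq_measure, of h S]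
    measure_sq_measure[of h UNIV] open_sets_M[OF open_UNIV] by simp

lemma inner_indicator_Ball_le:
  assumes "h \<in> L2"
  shows "(cmod (L2_inner h (indicator (Ball n v))))\<^sup>2 \<le> real q powi (- n) * measure (sq_measure h) (Ball n v)"
proof -
  have "L2_inner h (indicator (Ball n v)) = L2_inner (\<lambda>x. indicator (Ball n v) x * h x) (indicator (Ball n v))"
    unfolding L2_inner_def by (intro Bochner_Integration.integral_cong) (auto simp: indicator_def)
  also have "(cmod \<dots>)\<^sup>2 \<le> nsq (\<lambda>x. indicator (Ball n v) x * h x) * nsq (indicator (Ball n v))"
    by (rule inner_Cauchy_Schwarz[OF emeasure_sq_measure(2)[OF assms Ball_sets] indicator_Ball_L2])
  also have "nsq (indicator (Ball n v)) = real q powi (- n)"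
    by (subst indicator_L2(2)) (auto simp: emeasure_Ball measure_Ball)
  finally show ?thesis by (simp add: measure_sq_measure assms mult.commute)
qed

lemma sum_inner_indicator_Ball_le:
  assumes h: "h \<in> L2" and "finite I" and X: "X \<in> sets M"
    and disj: "\<And>i j. i \<in> I \<Longrightarrow> j \<in> I \<Longrightarrow> i \<noteq> j \<Longrightarrow> Ball n (v i) \<inter> Ball n (v j) = {}"
    and sub: "\<And>i. i \<in> I \<Longrightarrow> Ball n (v i) \<subseteq> X"
  shows "(\<Sum>i\<in>I. (cmod (L2_inner h (indicator (Ball n (v i)))))\<^sup>2) \<le> real q powi (- n) * measure (sq_measure h) X"
proof -
  interpret finite_measure "sq_measure h" by (rule finite_measure_sq_measure[OF h])
  have "(\<Sum>i\<in>I. (cmod (L2_inner h (indicator (Ball n (v i)))))\<^sup>2)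
      \<le> real q powi (- n) * (\<Sum>i\<in>I. measure (sq_measure h) (Ball n (v i)))"
    unfolding sum_distrib_left by (intro sum_mono inner_indicator_Ball_le h)
  also have "(\<Sum>i\<in>I. measure (sq_measure h) (Ball n (v i))) = measure (sq_measure h) (\<Union>i\<in>I. Ball n (v i))"
    by (rule finite_measure_finite_Union[symmetric]) (use assms in \<open>auto simp: disjoint_family_on_def\<close>)
  also have "\<dots> \<le> measure (sq_measure h) X"
    by (rule finite_measure_mono) (use sub X in auto)
  finally show ?thesis by (simp add: mult_left_mono)
qed

section \<open>Energy of conditional expectations\<close>

definition ball_energy :: "('a \<Rightarrow> complex) \<Rightarrow> nat \<Rightarrow> nat \<Rightarrow> real" where
  "ball_energy h n a = (cmod (L2_inner h (ball_fun n a)))\<^sup>2"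

lemma ball_energy_nonneg [simp]: "ball_energy h n a \<ge> 0"
  by (simp add: ball_energy_def)

text \<open>
  \<open>martingale_energy h n A\<close> is the squared norm, over the balls of radius \<open>q\<^sup>-\<^sup>n\<close> with index in \<open>A\<close>,
  of the conditional expectation of \<open>h\<close> on the \<open>\<sigma>\<close>-algebra generated by these balls.
\<close>

definition martingale_energy :: "('a \<Rightarrow> complex) \<Rightarrow> nat \<Rightarrow> nat set \<Rightarrow> real" where
  "martingale_energy h n A = real q ^ n * (\<Sum>\<^sub>\<infinity>a\<in>A. ball_energy h n a)"

lemma ball_energy_summable:
  assumes h: "h \<in> L2"
  shows "ball_energy h n summable_on A" and "(\<Sum>\<^sub>\<infinity>a\<in>A. ball_energy h n a) \<le> nsq h / real q ^ n"
proof -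
  have "sum (ball_energy h n) F \<le> nsq h / real q ^ n" if "finite F" for F
  proof -
    have "sum (ball_energy h n) F \<le> real q powi (- int n) * measure (sq_measure h) UNIV"
      unfolding ball_energy_def
      by (rule sum_inner_indicator_Ball_le[OF h that]) (use Ball_u_disjoint open_sets_M in auto)
    also have "\<dots> \<le> real q powi (- int n) * nsq h"
      by (intro mult_left_mono measure_sq_measure_le h) auto
    finally show ?thesis by (simp add: power_int_minus field_simps)
  qed
  from infsum_le_if_finite_sums_le[of A "ball_energy h n", OF _ this]
  show "ball_energy h n summable_on A" "(\<Sum>\<^sub>\<infinity>a\<in>A. ball_energy h n a) \<le> nsq h / real q ^ n"
    by auto
qed

lemma martingale_energy_nonneg: "martingale_energy h n A \<ge> 0"
  by (auto simp: martingale_energy_def ball_energy_def intro!: mult_nonneg_nonneg infsum_nonneg)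

lemma martingale_energy_le: "h \<in> L2 \<Longrightarrow> martingale_energy h n A \<le> nsq h"
  using ball_energy_summable(2)[of h n A] q_pos by (simp add: martingale_energy_def field_simps)

lemma martingale_energy_Compl:
  assumes "h \<in> L2"
  shows "martingale_energy h n A + martingale_energy h n (- A) = martingale_energy h n UNIV"
proof -
  have "(\<Sum>\<^sub>\<infinity>a\<in>A \<union> - A. ball_energy h n a) = (\<Sum>\<^sub>\<infinity>a\<in>A. ball_energy h n a) + (\<Sum>\<^sub>\<infinity>a\<in>- A. ball_energy h n a)"
    by (intro infsum_Un_disjoint ball_energy_summable assms) auto
  then show ?thesis by (simp add: martingale_energy_def distrib_left)
qed

lemma inner_sum_indicator_right:
  assumes "h \<in> L2" "finite I"
  shows "L2_inner h (\<lambda>x. \<Sum>b\<in>I. indicator (Ball n (v b)) x) = (\<Sum>b\<in>I. L2_inner h (indicator (Ball n (v b))))"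
  unfolding L2_inner_def cnj_sum sum_distrib_left
  by (rule Bochner_Integration.integral_sum) (rule L2_prod_integrable[OF assms(1) indicator_Ball_L2])

text \<open>Cauchy-Schwarz over the q children costs a factor q, which is exactly the ratio of the
  weights of consecutive levels in \<open>martingale_energy\<close>.\<close>

lemma ball_energy_refine:
  assumes h: "h \<in> L2"
  shows "ball_energy h n a \<le> real q * (\<Sum>b<q. ball_energy h (Suc n) (b + q * a))"
proof -
  have "ball_fun n a = (\<lambda>x. \<Sum>b<q. indicator (Ball (int (Suc n)) (u (b + q * a))) x :: complex)"
    unfolding Ball_children[of "int n" a] fun_eq_iff
    using indicator_UN_disjoint[of "{..<q}" "\<lambda>b. Ball (int (Suc n)) (u (b + q * a))"] Ball_u_disjoint
    by (auto simp: disjoint_family_on_def add.commute)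
  then have "L2_inner h (ball_fun n a)
      = (\<Sum>b<q. L2_inner h (indicator (Ball (int (Suc n)) (u (b + q * a)))))"
    by (simp only: inner_sum_indicator_right[OF h finite_lessThan])
  then have "ball_energy h n a \<le> (\<Sum>b<q. 1 * cmod (L2_inner h (indicator (Ball (int (Suc n)) (u (b + q * a))))))\<^sup>2"
    unfolding ball_energy_def by (simp only: mult_1) (intro power_mono norm_sum, auto)
  also have "\<dots> \<le> (\<Sum>b<q. 1\<^sup>2) * (\<Sum>b<q. (cmod (L2_inner h (indicator (Ball (int (Suc n)) (u (b + q * a))))))\<^sup>2)"
    by (rule Cauchy_Schwarz_ineq_sum)
  finally show ?thesis by (simp add: ball_energy_def)
qed

lemma martingale_energy_refine:
  assumes h: "h \<in> L2"
  shows "martingale_energy h n A \<le> martingale_energy h (Suc n) {a. a div q \<in> A}"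
proof -
  have "(\<Sum>\<^sub>\<infinity>a\<in>A. ball_energy h n a) \<le> real q * (\<Sum>\<^sub>\<infinity>a\<in>{a. a div q \<in> A}. ball_energy h (Suc n) a)"
  proof (rule infsum_le_finite_sums[OF ball_energy_summable(1)[OF h]])
    fix F assume F: "finite F" "F \<subseteq> A"
    have inj: "inj_on (\<lambda>(a, b). b + q * a) (F \<times> {..<q})"
    proof (rule inj_onI)
      fix p p' assume "p \<in> F \<times> {..<q}" "p' \<in> F \<times> {..<q}" "(\<lambda>(a, b). b + q * a) p = (\<lambda>(a, b). b + q * a) p'"
      then obtain a b a' b' where *: "p = (a, b)" "p' = (a', b')" "b < q" "b' < q" "b + q * a = b' + q * a'" by auto
      have "a = (b + q * a) div q" "b = (b + q * a) mod q" using *(3) by simp_all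
      moreover have "a' = (b + q * a) div q" "b' = (b + q * a) mod q" unfolding *(5) using *(4) by simp_all
      ultimately show "p = p'" using *(1,2) by metis
    qed
    have "(\<Sum>a\<in>F. ball_energy h n a) \<le> (\<Sum>a\<in>F. real q * (\<Sum>b<q. ball_energy h (Suc n) (b + q * a)))"
      by (intro sum_mono ball_energy_refine h)
    also have "\<dots> = real q * (\<Sum>(a, b)\<in>F \<times> {..<q}. ball_energy h (Suc n) (b + q * a))"
      by (simp only: sum_distrib_left[symmetric] sum.cartesian_product)
    also have "(\<Sum>(a, b)\<in>F \<times> {..<q}. ball_energy h (Suc n) (b + q * a))
        = (\<Sum>a\<in>(\<lambda>(a, b). b + q * a) ` (F \<times> {..<q}). ball_energy h (Suc n) a)"
      by (subst sum.reindex[OF inj]) (auto intro!: sum.cong)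
    also have "\<dots> \<le> (\<Sum>\<^sub>\<infinity>a\<in>{a. a div q \<in> A}. ball_energy h (Suc n) a)"
      by (rule finite_sum_le_infsum[OF ball_energy_summable(1)[OF h]])
         (use F in \<open>auto simp: ball_energy_def\<close>)
    finally show "sum (ball_energy h n) F \<le> real q * (\<Sum>\<^sub>\<infinity>a\<in>{a. a div q \<in> A}. ball_energy h (Suc n) a)"
      by (simp add: mult_left_mono)
  qed
  then show ?thesis by (simp add: martingale_energy_def mult.assoc mult_left_mono mult.left_commute)
qed

text \<open>The gain under refinement is nonnegative on the complement of A as well, so the gain on
  A is at most the total gain. The total gain has the advantage that it telescopes.\<close>

lemma martingale_energy_increment:
  assumes h: "h \<in> L2"
  shows "martingale_energy h (Suc n) {a. a div q \<in> A} + martingale_energy h n UNIV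
    \<le> martingale_energy h n A + martingale_energy h (Suc n) UNIV"
proof -
  have "{a. a div q \<in> - A} = - {a. a div q \<in> A}" by auto
  then show ?thesis
    using martingale_energy_refine[OF h, of n "- A"] martingale_energy_Compl[OF h, of n A]
      martingale_energy_Compl[OF h, of "Suc n" "{a. a div q \<in> A}"] by simp
qed

text \<open>The indices of the balls of radius \<open>q\<^sup>-\<^sup>(\<^sup>N\<^sup>+\<^sup>m\<^sup>)\<close> contained in \<open>{u k} + \<pp>\<^sup>m D\<close>.\<close>

definition comb_indices :: "nat \<Rightarrow> nat \<Rightarrow> nat set" where
  "comb_indices N m = {a. a mod q ^ (N + m) < q ^ N}"

text \<open>Division by q drops the lowest digit and leaves the condition on the higher ones intact.
  In this form the set fits \<open>martingale_energy_increment\<close>.\<close>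

lemma comb_indices_Suc: "comb_indices (Suc N) m = {a. a div q \<in> comb_indices N m}"
proof -
  have "a mod q ^ (Suc N + m) < q ^ Suc N \<longleftrightarrow> (a div q) mod q ^ (N + m) < q ^ N" for a
  proof -
    have "a mod (q * q ^ (N + m)) = q * (a div q mod q ^ (N + m)) + a mod q"
      by (rule mod_mult2_eq)
    then have "(a mod q ^ (Suc N + m)) div q = (a div q) mod q ^ (N + m)" by simp
    moreover have "a mod q ^ (Suc N + m) < q ^ Suc N \<longleftrightarrow> (a mod q ^ (Suc N + m)) div q < q ^ N"
      using div_less_iff_less_mult[of q "a mod q ^ (Suc N + m)" "q ^ N"] by (simp add: mult.commute)
    ultimately show ?thesis by simp
  qed
  then show ?thesis by (simp add: comb_indices_def)
qed

text \<open>For N = 0 the energy is an affine coefficient sum of one fixed function, the indicator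
  of D. Through this identity the Bessel hypothesis enters the energy bound.\<close>

lemma infsum_ball_energy_comb_0:
  assumes h: "h \<in> L2"
  shows "martingale_energy h m (comb_indices 0 m)
    = (\<Sum>\<^sub>\<infinity>k. (cmod (L2_inner (indicator (Ball 0 (u 0))) (affine_elem h (- int m) k)))\<^sup>2)"
proof -
  \<comment> \<open>The coefficient at position \<pp>^-m \<open>u k\<close> integrates h over the
    ball of level m centred at the negative of that position; hence the sign and the factor
    q^m.\<close>
  define \<kappa> where "\<kappa> k = q ^ m * inv u (- u k)" for k
  have invu: "inv u (u k) = k" for k by (rule inv_f_f[OF inj_u])
  have inv': "u (inv u (- u k)) = - u k" for k by (intro u_inv u_range_minus) auto
  have bij: "bij_betw \<kappa> UNIV (comb_indices 0 m)"
  proof (rule bij_betw_byWitness[where f' = "\<lambda>a. inv u (- u (a div q ^ m))"])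
    show "\<forall>k\<in>UNIV. inv u (- u (\<kappa> k div q ^ m)) = k" by (simp add: \<kappa>_def inv' invu)
    show "\<forall>a\<in>comb_indices 0 m. \<kappa> (inv u (- u (a div q ^ m))) = a"
      by (auto simp: \<kappa>_def inv' invu comb_indices_def)
  qed (auto simp: \<kappa>_def comb_indices_def)
  have "(cmod (L2_inner (indicator (Ball 0 (u 0))) (affine_elem h (- int m) k)))\<^sup>2 = real q ^ m * ball_energy h m (\<kappa> k)" for k
  proof -
    have "u (\<kappa> k) = u 0 - \<pp> powi (- 0) * (\<pp> powi (- int m) * u k)"
      unfolding \<kappa>_def u_shift inv' by (simp add: powi_neg_u)
    then show ?thesis
      unfolding inner_affine_elem coef_Ball[OF h] ball_energy_def by simp
  qed
  then have "(\<Sum>\<^sub>\<infinity>k. (cmod (L2_inner (indicator (Ball 0 (u 0))) (affine_elem h (- int m) k)))\<^sup>2)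
      = real q ^ m * (\<Sum>\<^sub>\<infinity>k. ball_energy h m (\<kappa> k))"
    by (simp add: infsum_cmult_right')
  also have "(\<Sum>\<^sub>\<infinity>k. ball_energy h m (\<kappa> k)) = (\<Sum>\<^sub>\<infinity>a\<in>comb_indices 0 m. ball_energy h m a)"
    by (rule infsum_reindex_bij_betw[OF bij])
  finally show ?thesis by (simp add: martingale_energy_def)
qed

lemma comb_energy_bound:
  assumes h: "h \<in> L2" and bessel: "bessel_family UNIV (\<lambda>(j, k). affine_elem h j k) B"
  shows "(\<Sum>m=1..m0. martingale_energy h (N + m) (comb_indices N m)) \<le> B + real N * nsq h"
proof (induction N)
  case 0
  let ?f = "indicator (Ball 0 (u 0)) :: 'a \<Rightarrow> complex"
  define t where "t = (\<lambda>(j, k). (cmod (L2_inner ?f (affine_elem h j k)))\<^sup>2)"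
  have t: "t = (\<lambda>i. (cmod (L2_inner ?f ((\<lambda>(j, k). affine_elem h j k) i)))\<^sup>2)"
    by (auto simp: t_def fun_eq_iff)
  let ?J = "(\<lambda>m. - int m) ` {1..m0}"
  have summ: "t summable_on (?J \<times> UNIV)" and le: "infsum t (?J \<times> UNIV) \<le> B * nsq ?f"
    unfolding t by (rule bessel_sum_le[OF bessel indicator_Ball_L2], simp)+
  have "(\<Sum>m=1..m0. martingale_energy h (0 + m) (comb_indices 0 m)) = (\<Sum>m=1..m0. \<Sum>\<^sub>\<infinity>k. t (- int m, k))"
    by (simp add: infsum_ball_energy_comb_0[OF h] t_def)
  also have "\<dots> = (\<Sum>j\<in>?J. \<Sum>\<^sub>\<infinity>k. t (j, k))"
    by (subst sum.reindex) (auto simp: inj_on_def)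
  also have "\<dots> = (\<Sum>\<^sub>\<infinity>j\<in>?J. \<Sum>\<^sub>\<infinity>k. t (j, k))" by simp
  also have "\<dots> = infsum t (?J \<times> UNIV)" by (rule infsum_Sigma_banach[OF summ])
  also note le
  also have "nsq ?f = 1" by (subst indicator_L2(2)) (auto simp: emeasure_Ball measure_Ball)
  finally show ?case by simp
next
  case (Suc N)
  let ?U = "\<lambda>n. martingale_energy h n UNIV"
  have step: "martingale_energy h (Suc N + m) (comb_indices (Suc N) m)
      \<le> martingale_energy h (N + m) (comb_indices N m) + (?U (Suc (N + m)) - ?U (N + m))" for m
    using martingale_energy_increment[OF h, of "N + m" "comb_indices N m"]
    by (simp add: comb_indices_Suc)
  \<comment> \<open>The telescoping runs over m with N fixed. One step in N therefore costs at most
    \<open>nsq h\<close>, however large m0 is.\<close>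
  have tele: "(\<Sum>m=1..m0. ?U (Suc (N + m)) - ?U (N + m)) = ?U (Suc (N + m0)) - ?U (Suc N)"
    by (induction m0) auto
  have "(\<Sum>m=1..m0. martingale_energy h (Suc N + m) (comb_indices (Suc N) m))
      \<le> (\<Sum>m=1..m0. martingale_energy h (N + m) (comb_indices N m) + (?U (Suc (N + m)) - ?U (N + m)))"
    by (intro sum_mono step)
  also have "\<dots> = (\<Sum>m=1..m0. martingale_energy h (N + m) (comb_indices N m)) + (?U (Suc (N + m0)) - ?U (Suc N))"
    by (simp only: sum.distrib tele)
  also have "\<dots> \<le> (B + real N * nsq h) + nsq h"
    using Suc.IH martingale_energy_le[OF h, of "Suc (N + m0)" UNIV] martingale_energy_nonneg[of h "Suc N" UNIV]
    by linarith
  finally show ?case by (simp add: algebra_simps)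
qed

lemma u_diff_level: "a < q ^ N \<Longrightarrow> b < q ^ N \<Longrightarrow> \<exists>d<q ^ N. u d = u a - u b"
  using u_add_level[of a N] u_minus_level[of b N] by (metis diff_conv_add_uminus)

text \<open>Each squared coefficient is q^-j times the squared integral of h over one ball of level
  s - j. Distinct triples give distinct balls, since r and k are recovered as remainder and quotient
  of an index. The hypothesis on a says that the ball on the left lies in \<pp>^-N D; it puts all
  the balls over which h is integrated into the set of \<open>comb_indices\<close> with parameter N
  + s.\<close>

lemma low_frequency_average_le:
  assumes h: "h \<in> L2" and bessel: "bessel_family UNIV (\<lambda>(j, k). affine_elem h j k) B"
    and a: "a < q ^ (N + s)"
    and G: "finite G" "G \<subseteq> {..<q ^ N} \<times> {j. j < - int N} \<times> UNIV"
  shows "(\<Sum>(r, j, k)\<in>G. (cmod (coef (ball_fun s a) h j (u r + \<pp> powi j * u k)))\<^sup>2)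
    \<le> (B + real (N + s) * nsq h) / real q ^ s"
proof -
  \<comment> \<open>The depth of level j below -N, so that j = -(N + \<mu> j).\<close>
  define \<mu> where "\<mu> j = nat (- j) - N" for j :: int
  define \<iota> where "\<iota> r j k = inv u (u a - (u r + \<pp> powi j * u k) / \<pp> ^ s)" for r j k
  define \<Phi> where "\<Phi> = (\<lambda>(r, j, k). (\<mu> j, \<iota> r j k))"
  define g where "g = (\<lambda>(m, d). real q ^ (N + m) * ball_energy h (s + N + m) d)"
  have \<mu>: "j = - int (N + \<mu> j)" "\<mu> j \<ge> 1" if "j < - int N" for j
    using that by (auto simp: \<mu>_def)
  have \<iota>: "u (\<iota> r j k) = u a - u (q ^ s * r + q ^ (s + N + \<mu> j) * k)"
    and \<iota>_comb: "\<iota> r j k \<in> comb_indices (N + s) (\<mu> j)"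
    if r: "r < q ^ N" and j: "j < - int N" for r j k
  proof -
    have j': "\<pp> powi j * u k = u k / \<pp> ^ (N + \<mu> j)"
      using powi_neg_u[of "N + \<mu> j" "u k"] \<mu>(1)[OF j] by simp
    have "q ^ s * r < q ^ s * q ^ N" using r by simp
    then have lt: "q ^ s * r < q ^ (N + s)" by (simp add: power_add mult.commute)
    have "(N + s) \<le> s + N + \<mu> j" by simp
    then have "q ^ (N + s) \<le> q ^ (s + N + \<mu> j)" by (intro power_increasing) (simp_all add: Suc_le_eq)
    then have lt': "q ^ s * r < q ^ (s + N + \<mu> j)" using lt by linarith
    have e: "u (q ^ s * r + q ^ (s + N + \<mu> j) * k) = (u r + \<pp> powi j * u k) / \<pp> ^ s"
      unfolding u_split[OF lt'] u_shift j' by (simp add: add_divide_distrib power_add mult_ac)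
    have range: "u a - u (q ^ s * r + q ^ (s + N + \<mu> j) * k) \<in> range u"
      by (intro u_range_diff) auto
    show \<iota>eq: "u (\<iota> r j k) = u a - u (q ^ s * r + q ^ (s + N + \<mu> j) * k)"
      unfolding \<iota>_def e[symmetric] by (rule u_inv[OF range])
    \<comment> \<open>Both \<open>u a\<close> and \<open>u (q ^ s * r)\<close> use only the lowest N
      + s digits, and so does their difference. The multiple of q^(s + N + \<mu> j) contributed by k
      leaves these digits and the gap above them untouched.\<close>
    obtain d where d: "d < q ^ (N + s)" "u d = u a - u (q ^ s * r)"
      using u_diff_level[OF a lt] by blast
    obtain k' where k': "u k' = - u k" using u_range_minus[of "u k"] by auto
    have dlt: "d < q ^ (s + N + \<mu> j)" using d(1) \<open>q ^ (N + s) \<le> q ^ (s + N + \<mu> j)\<close> by linarith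
    have "u (d + q ^ (s + N + \<mu> j) * k') = u (\<iota> r j k)"
      unfolding \<iota>eq u_split[OF dlt] u_split[OF lt'] d(2) k' by simp
    then have "\<iota> r j k = d + q ^ (s + N + \<mu> j) * k'" using injD[OF inj_u] by metis
    then show "\<iota> r j k \<in> comb_indices (N + s) (\<mu> j)"
      using d(1) dlt by (simp add: comb_indices_def add.commute)
  qed
  have inj: "inj_on \<Phi> G"
  proof (rule inj_onI)
    fix p p' assume "p \<in> G" "p' \<in> G" and eq: "\<Phi> p = \<Phi> p'"
    obtain r j k where p: "p = (r, j, k)" by (cases p) auto
    obtain r' j' k' where p': "p' = (r', j', k')" by (cases p') auto
    have r: "r < q ^ N" "r' < q ^ N" and j: "j < - int N" "j' < - int N"
      using \<open>p \<in> G\<close> \<open>p' \<in> G\<close> G(2) p p' by auto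
    have "\<mu> j = \<mu> j'" "\<iota> r j k = \<iota> r' j' k'" using eq by (auto simp: \<Phi>_def p p')
    then have jj: "j = j'" using \<mu>(1)[OF j(1)] \<mu>(1)[OF j(2)] by simp
    have "u (q ^ s * r + q ^ (s + N + \<mu> j) * k) = u (q ^ s * r' + q ^ (s + N + \<mu> j) * k')"
      using \<iota>[OF r(1) j(1), of k] \<iota>[OF r(2) j(2), of k'] \<open>\<iota> r j k = \<iota> r' j' k'\<close> jj by simp
    then have "q ^ s * r + q ^ (s + N + \<mu> j) * k = q ^ s * r' + q ^ (s + N + \<mu> j) * k'"
      using injD[OF inj_u] by blast
    then have "q ^ s * (r + q ^ (N + \<mu> j) * k) = q ^ s * (r' + q ^ (N + \<mu> j) * k')"
      by (simp add: power_add algebra_simps)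
    then have *: "r + q ^ (N + \<mu> j) * k = r' + q ^ (N + \<mu> j) * k'" using q_ge_2 by auto
    have "q ^ N \<le> q ^ (N + \<mu> j)" by (intro power_increasing) (simp_all add: Suc_le_eq)
    then have lt: "r < q ^ (N + \<mu> j)" "r' < q ^ (N + \<mu> j)" using r by linarith+
    have "r = r'" using arg_cong[OF *, of "\<lambda>x. x mod q ^ (N + \<mu> j)"] lt by simp
    moreover have "k = k'" using arg_cong[OF *, of "\<lambda>x. x div q ^ (N + \<mu> j)"] lt by simp
    ultimately show "p = p'" using p p' jj by simp
  qed
  have coef_g: "(cmod (coef (ball_fun s a) h j (u r + \<pp> powi j * u k)))\<^sup>2 = g (\<Phi> (r, j, k))"
    if rj: "r < q ^ N" "j < - int N" for r j k
  proof -
    have 1: "u a - \<pp> powi (- int s) * (u r + \<pp> powi j * u k) = u (\<iota> r j k)"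
    proof -
      have "u a - (u r + \<pp> powi j * u k) / \<pp> ^ s \<in> range u"
        using \<mu>(1)[OF rj(2)] powi_neg_u[of "N + \<mu> j" "u k"]
        by (intro u_range_diff u_range_shift u_range_add) (metis rangeI u_range_shift)+
      then show ?thesis by (simp add: powi_neg_u \<iota>_def u_inv)
    qed
    have "- j = int (N + \<mu> j)" using \<mu>(1)[OF rj(2)] by simp
    from arg_cong[OF this, of "power_int (real q)"] this
    have 2: "real q powi (- j) = real q ^ (N + \<mu> j)" "int s - j = int (s + N + \<mu> j)"
      by (simp_all only: power_int_of_nat)
    show ?thesis
      unfolding coef_Ball[OF h] 1 2 by (simp add: g_def \<Phi>_def ball_energy_def)
  qed
  \<comment> \<open>Inserting 1 keeps the maximum defined when G is empty.\<close>
  define m0 where "m0 = Max (insert 1 (fst ` \<Phi> ` G))"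
  have sub: "\<Phi> ` G \<subseteq> (SIGMA m:{1..m0}. comb_indices (N + s) m)"
  proof
    fix x assume x: "x \<in> \<Phi> ` G"
    then have "fst x \<le> m0" unfolding m0_def using G(1) by (intro Max_ge) auto
    moreover from x obtain r j k where rjk: "x = (\<mu> j, \<iota> r j k)" "r < q ^ N" "j < - int N"
      using G(2) by (auto simp: \<Phi>_def)
    ultimately show "x \<in> (SIGMA m:{1..m0}. comb_indices (N + s) m)"
      using \<mu>(2) \<iota>_comb by auto
  qed
  define H where "H m = {d. (m, d) \<in> \<Phi> ` G}" for m
  have finH: "finite (H m)" for m
  proof -
    have "H m \<subseteq> snd ` \<Phi> ` G"
    proof
      fix d assume "d \<in> H m"
      then have "snd (m, d) \<in> snd ` \<Phi> ` G" unfolding H_def by (intro imageI) simp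
      then show "d \<in> snd ` \<Phi> ` G" by simp
    qed
    then show ?thesis using G(1) finite_subset by blast
  qed
  have "(\<Sum>(r, j, k)\<in>G. (cmod (coef (ball_fun s a) h j (u r + \<pp> powi j * u k)))\<^sup>2) = (\<Sum>p\<in>G. g (\<Phi> p))"
    using G(2) by (intro sum.cong) (auto simp: coef_g)
  also have "\<dots> = sum g (\<Phi> ` G)" by (simp add: sum.reindex[OF inj])
  also have "\<Phi> ` G = (SIGMA m:{1..m0}. H m)" using sub by (auto simp: H_def)
  also have "sum g (SIGMA m:{1..m0}. H m) = (\<Sum>m=1..m0. \<Sum>d\<in>H m. g (m, d))"
    by (subst sum.Sigma) (auto simp: finH)
  also have "\<dots> \<le> (\<Sum>m=1..m0. martingale_energy h (N + s + m) (comb_indices (N + s) m) / real q ^ s)"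
  proof (rule sum_mono)
    fix m assume m: "m \<in> {1..m0}"
    have "(\<Sum>d\<in>H m. g (m, d)) = real q ^ (N + m) * (\<Sum>d\<in>H m. ball_energy h (N + s + m) d)"
      by (simp add: g_def sum_distrib_left add.commute)
    also have "(\<Sum>d\<in>H m. ball_energy h (N + s + m) d) \<le> (\<Sum>\<^sub>\<infinity>d\<in>comb_indices (N + s) m. ball_energy h (N + s + m) d)"
      by (rule finite_sum_le_infsum[OF ball_energy_summable(1)[OF h] finH])
         (use sub in \<open>auto simp: H_def ball_energy_def\<close>)
    finally show "(\<Sum>d\<in>H m. g (m, d)) \<le> martingale_energy h (N + s + m) (comb_indices (N + s) m) / real q ^ s"
      \<comment> \<open>The weight q^(N + m) from \<open>coef_Ball\<close> is q^(N + s + m), the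
        weight in \<open>martingale_energy\<close>, divided by q^s.\<close>
      using q_ge_2 by (simp add: martingale_energy_def power_add mult_left_mono field_simps)
  qed
  also have "\<dots> \<le> (B + real (N + s) * nsq h) / real q ^ s"
    unfolding sum_divide_distrib[symmetric]
    using comb_energy_bound[OF h bessel, of "N + s" m0] by (intro divide_right_mono) auto
  finally show ?thesis .
qed

subsection \<open>Low quasi-affine frequencies of dilated balls\<close>

text \<open>\<open>lattice_nbhd m i\<close> is \<open>\<pp>\<^sup>m({u k} + \<pp>\<^sup>i D)\<close>; as \<open>i\<close> grows it shrinks to a countable set.\<close>

definition lattice_nbhd :: "nat \<Rightarrow> nat \<Rightarrow> 'a set" where
  "lattice_nbhd m i = (\<Union>k. Ball (int (m + i)) (u (q ^ i * k)))"

lemma lattice_nbhd_sets [measurable]: "lattice_nbhd m i \<in> sets M"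
  unfolding lattice_nbhd_def by (intro sets.countable_UN) auto

lemma lattice_nbhd_Suc: "lattice_nbhd m (Suc i) \<subseteq> lattice_nbhd m i"
proof -
  have "Ball (int (m + Suc i)) (u (q ^ Suc i * k)) \<subseteq> Ball (int (m + i)) (u (q ^ i * k))" for k
  proof -
    have "Ball (int (m + i) + 1) (u (0 + q * (q ^ i * k))) \<subseteq> Ball (int (m + i)) (u (q ^ i * k))"
      unfolding Ball_children[of "int (m + i)"] using q_pos by blast
    then show ?thesis by (simp add: mult.assoc add.commute)
  qed
  then show ?thesis unfolding lattice_nbhd_def by blast
qed

lemma powi_neg_add: "\<pp> powi (- int (m + i)) * x = \<pp> powi (- int m) * x / \<pp> ^ i"
  unfolding powi_neg_u by (simp add: power_add)

lemma mem_lattice_nbhd: "x \<in> lattice_nbhd m i \<longleftrightarrow> (\<exists>k. (\<pp> powi (- int m) * x - u k) / \<pp> ^ i \<in> D)"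
  unfolding lattice_nbhd_def Ball_def powi_neg_add u_shift diff_divide_distrib by blast

text \<open>Lattice points that differ by an element of D coincide, so the lattice point close to y
  is the same at every i, and its distance to y is at most \<open>av \<pp>\<close> ^ i for all
  i.\<close>

lemma lattice_nbhd_Inter: "(\<Inter>i. lattice_nbhd m i) \<subseteq> (\<Union>k. {\<pp> powi int m * u k})"
proof
  fix x assume x: "x \<in> (\<Inter>i. lattice_nbhd m i)"
  define y where "y = \<pp> powi (- int m) * x"
  have "x \<in> lattice_nbhd m 0" using x by blast
  then obtain k where k: "y - u k \<in> D" by (auto simp: mem_lattice_nbhd y_def)
  have "av (y - u k) \<le> av \<pp> ^ i" for i
  proof -
    have "x \<in> lattice_nbhd m i" using x by blast
    then obtain k' where k': "(y - u k') / \<pp> ^ i \<in> D" by (auto simp: mem_lattice_nbhd y_def)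
    have "\<pp> ^ i * ((y - u k') / \<pp> ^ i) \<in> D" by (rule D_mult[OF prime_power_D k'])
    then have "y - u k' \<in> D" by simp
    then have "u k - u k' \<in> D" using D_diff[of "y - u k'" "y - u k"] k by simp
    then have "k = k'" by (rule u_unique)
    then show ?thesis using k' av_pos[OF prime_nonzero] by (simp add: D_iff av_divide av_power divide_le_eq)
  qed
  moreover have "(\<lambda>i. av \<pp> ^ i) \<longlonglongrightarrow> 0"
    by (rule LIMSEQ_realpow_zero) (simp_all add: av_prime_less_1)
  ultimately have "av (y - u k) \<le> 0" by (intro LIMSEQ_le_const) auto
  then have "y = u k" using av_nonneg[of "y - u k"] by (metis antisym av_eq_0_iff eq_iff_diff_eq_0)
  then have "\<pp> ^ m * (x / \<pp> ^ m) = \<pp> ^ m * u k" by (simp add: y_def powi_neg_u)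
  then have "x = \<pp> powi int m * u k" by simp
  then show "x \<in> (\<Union>k. {\<pp> powi int m * u k})" by blast
qed

text \<open>Continuity from above, available because the measure is finite. The intersection is
  contained in a countable set, which is null for Haar measure and hence for the density.\<close>

lemma sq_measure_lattice_nbhd:
  assumes h: "h \<in> L2"
  shows "(\<lambda>i. measure (sq_measure h) (lattice_nbhd m i)) \<longlonglongrightarrow> 0"
proof -
  interpret finite_measure "sq_measure h" by (rule finite_measure_sq_measure[OF h])
  have "(\<lambda>i. measure (sq_measure h) (lattice_nbhd m i)) \<longlonglongrightarrow> measure (sq_measure h) (\<Inter>i. lattice_nbhd m i)"
    by (rule finite_Lim_measure_decseq) (auto intro!: decseq_SucI lattice_nbhd_Suc)
  moreover have "(\<Inter>i. lattice_nbhd m i) \<in> null_sets (sq_measure h)"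
  proof -
    have "{x} \<in> null_sets M" for x by (auto simp: null_sets_def emeasure_singleton sets_M)
    then have "(\<Union>k. {\<pp> powi int m * u k}) \<in> null_sets M" by (intro null_sets_UN) auto
    then have "(\<Inter>i. lattice_nbhd m i) \<in> null_sets M"
      by (rule null_sets_subset[OF _ _ lattice_nbhd_Inter]) (intro sets.countable_INT, auto)
    moreover have "absolutely_continuous M (sq_measure h)"
      unfolding sq_measure_def using L2_meas[OF h] by (intro absolutely_continuousI_density) auto
    ultimately show ?thesis unfolding absolutely_continuous_def by blast
  qed
  ultimately show ?thesis by (simp add: measure_eq_0_null_sets)
qed

lemma sum_half_powers: "m1 \<le> m0 \<Longrightarrow> (\<Sum>m\<in>{m1<..m0}. (1 / 2 :: real) ^ m) \<le> (1 / 2) ^ m1 - (1 / 2) ^ m0"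
proof (induction m0 rule: dec_induct)
  case (step m0)
  have "{m1<..Suc m0} = insert (Suc m0) {m1<..m0}" using step by auto
  then show ?case using step by simp
qed auto

text \<open>The balls belonging to different k are disjoint and lie in the neighbourhood. The
  weights are q^-m from the quasi-affine normalisation, q^(m + N) from \<open>coef_Ball\<close> and
  q^-(s + N + m) from Cauchy-Schwarz. Their product q^-(s + m) is at most 2^-m, so N survives only
  in the shrinking neighbourhood.\<close>

lemma quasi_low_frequency_level:
  assumes h: "h \<in> L2" and H: "finite H" and N: "a \<le> N"
  shows "(\<Sum>k\<in>H. real q powi (- int m) *
      (cmod (coef (dilation (int N) (ball_fun s a)) h (- int m) (u k)))\<^sup>2)
    \<le> (1 / 2) ^ m * measure (sq_measure h) (lattice_nbhd m (s + N - a))"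
proof -
  define n where "n = s + N"
  \<comment> \<open>The offset \<open>u a\<close> displaces the centres from the lattice. As a <
    q^a, \<pp>^a \<open>u a\<close> lies in D, so a levels are given up to absorb the
    offset.\<close>
  define i where "i = s + N - a"
  define v where "v k = u a - u (q ^ n * k)" for k
  have ni: "n = i + a" using N by (simp add: n_def i_def)
  have eq: "real q powi (- int m) * (cmod (coef (dilation (int N) (ball_fun s a)) h (- int m) (u k)))\<^sup>2
      = real q ^ N * (cmod (L2_inner h (indicator (Ball (int (n + m)) (v k)))))\<^sup>2" for k
  proof -
    have 1: "u a - \<pp> powi (- int s) * (\<pp> powi (- int N) * u k) = v k"
      unfolding powi_neg_u v_def n_def u_shift by (simp add: power_add mult.commute)
    have 2: "int s - (- int m - int N) = int (n + m)" by (simp add: n_def)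
    have 3: "real q powi (- int m) * real q powi (- (- int m - int N)) = real q ^ N"
      using q_ge_2 by (subst power_int_add[symmetric]) auto
    show ?thesis
      unfolding coef_dilation[OF indicator_Ball_L2 h] coef_Ball[OF h] 1 2 unfolding mult.assoc[symmetric] 3 ..
  qed
  have v_range: "v k \<in> range u" for k unfolding v_def by (intro u_range_diff) auto
  have "(\<Sum>k\<in>H. (cmod (L2_inner h (indicator (Ball (int (n + m)) (v k)))))\<^sup>2)
      \<le> real q powi (- int (n + m)) * measure (sq_measure h) (lattice_nbhd m i)"
  proof (rule sum_inner_indicator_Ball_le[OF h H lattice_nbhd_sets])
    fix k k' :: nat assume "k \<noteq> k'"
    then have "q ^ n * k \<noteq> q ^ n * k'" using q_ge_2 by simp
    then have "u (q ^ n * k) \<noteq> u (q ^ n * k')" using injD[OF inj_u] by blast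
    then have neq: "v k \<noteq> v k'" by (simp add: v_def)
    obtain b where b: "v k = u b" using v_range[of k] by (rule imageE)
    obtain b' where b': "v k' = u b'" using v_range[of k'] by (rule imageE)
    have "b \<noteq> b'" using neq b b' by auto
    then show "Ball (int (n + m)) (v k) \<inter> Ball (int (n + m)) (v k') = {}"
      unfolding b b' by (rule Ball_u_disjoint)
  next
    fix k :: nat
    show "Ball (int (n + m)) (v k) \<subseteq> lattice_nbhd m i"
    proof
      fix x assume "x \<in> Ball (int (n + m)) (v k)"
      then have "\<pp> powi (- int (m + n)) * x - v k \<in> D" by (simp add: Ball_def add.commute)
      also have "\<pp> powi (- int (m + n)) * x - v k = \<pp> powi (- int m) * x / \<pp> ^ n - u a + u k / \<pp> ^ n"
        unfolding powi_neg_add v_def u_shift by simp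
      finally have "\<pp> ^ a * (\<pp> powi (- int m) * x / \<pp> ^ n - u a + u k / \<pp> ^ n) + \<pp> ^ a * u a \<in> D"
        by (rule D_add[OF D_mult[OF prime_power_D] u_level[OF less_q_power]])
      also have "\<pp> ^ a * (\<pp> powi (- int m) * x / \<pp> ^ n - u a + u k / \<pp> ^ n) + \<pp> ^ a * u a
          = (\<pp> powi (- int m) * x + u k) / \<pp> ^ i"
        by (simp add: ni power_add field_simps)
      finally have D: "(\<pp> powi (- int m) * x + u k) / \<pp> ^ i \<in> D" .
      obtain k' where "u k' = - u k" using u_range_minus[of "u k"] by auto
      then show "x \<in> lattice_nbhd m i" using D unfolding mem_lattice_nbhd by (intro exI[of _ k']) simp
    qed
  qed
  then have "(\<Sum>k\<in>H. real q powi (- int m) *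
      (cmod (coef (dilation (int N) (ball_fun s a)) h (- int m) (u k)))\<^sup>2)
    \<le> real q ^ N * (real q powi (- int (n + m)) * measure (sq_measure h) (lattice_nbhd m i))"
    unfolding eq sum_distrib_left[symmetric] by (intro mult_left_mono) auto
  also have "real q ^ N * (real q powi (- int (n + m)) * measure (sq_measure h) (lattice_nbhd m i))
      = (1 / real q ^ (s + m)) * measure (sq_measure h) (lattice_nbhd m i)"
  proof -
    have "real q powi (- int (n + m)) = 1 / (real q ^ N * real q ^ (s + m))"
      unfolding power_int_minus power_int_of_nat n_def inverse_eq_divide by (simp add: power_add mult_ac)
    then show ?thesis using q_ge_2 by simp
  qed
  also have "\<dots> \<le> (1 / 2 ^ m) * measure (sq_measure h) (lattice_nbhd m i)"
  proof (intro mult_right_mono)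
    have "(2 :: real) ^ m \<le> real q ^ m" using q_ge_2 by (intro power_mono) auto
    also have "\<dots> \<le> real q ^ (s + m)" using q_ge_2 by (intro power_increasing) auto
    finally show "1 / real q ^ (s + m) \<le> 1 / 2 ^ m" by (intro divide_left_mono) (use q_ge_2 in auto)
  qed auto
  finally show ?thesis by (simp add: i_def power_one_over)
qed

text \<open>Dominated convergence by hand: the finitely many levels with m <= m1 tend to 0 with the
  mass of their neighbourhoods, and the deeper ones contribute at most 2^-m1 \<open>nsq h\<close>.
  The threshold is uniform in G, as required for infinite sums.\<close>

lemma quasi_low_frequency_small:
  assumes h: "h \<in> L2" and e: "e > 0"
  shows "\<exists>N0. \<forall>N\<ge>N0. \<forall>G. finite G \<longrightarrow> G \<subseteq> {j. j < 0} \<times> UNIV \<longrightarrow>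
    (\<Sum>(j, k)\<in>G. real q powi j * (cmod (coef (dilation (int N) (ball_fun s a)) h j (u k)))\<^sup>2) \<le> e"
proof -
  \<comment> \<open>Adding 1 to \<open>nsq h\<close> keeps the quotient positive and finite when h
    vanishes almost everywhere.\<close>
  obtain m1 where m1: "(1 / 2) ^ m1 < e / (2 * (nsq h + 1))"
    using real_arch_pow_inv[of "e / (2 * (nsq h + 1))" "1 / 2"] e nsq_nonneg[of h] by (auto simp: add_nonneg_pos)
  have tail: "(1 / 2) ^ m1 * nsq h \<le> e / 2"
  proof -
    have "(1 / 2) ^ m1 * nsq h \<le> (1 / 2) ^ m1 * (nsq h + 1)" by simp
    also have "\<dots> \<le> e / 2" using m1 nsq_nonneg[of h] by (simp add: field_simps)
    finally show ?thesis .
  qed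
  define X where "X N = (\<Sum>m\<in>{1..m1}. (1 / 2) ^ m * measure (sq_measure h) (lattice_nbhd m (s + N - a)))" for N
  have "X \<longlonglongrightarrow> (\<Sum>m\<in>{1..m1}. (1 / 2) ^ m * 0)"
    unfolding X_def
  proof (intro tendsto_intros)
    fix m
    have "filterlim (\<lambda>N. s + N - a) sequentially sequentially"
      by (rule filterlim_at_top_mono[OF filterlim_minus_const_nat_at_top[of a]])
         (intro always_eventually allI diff_le_mono, simp)
    then show "(\<lambda>N. measure (sq_measure h) (lattice_nbhd m (s + N - a))) \<longlonglongrightarrow> 0"
      by (rule filterlim_compose[OF sq_measure_lattice_nbhd[OF h]])
  qed
  then have "\<forall>\<^sub>F N in sequentially. X N < e / 2" using e by (intro order_tendstoD) auto
  then obtain N1 where N1: "\<And>N. N \<ge> N1 \<Longrightarrow> X N < e / 2" unfolding eventually_sequentially by blast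
  show ?thesis
  proof (intro exI allI impI)
    fix N and G :: "(int \<times> nat) set"
    assume N: "N \<ge> max N1 a" and G: "finite G" "G \<subseteq> {j. j < 0} \<times> UNIV"
    define t where "t = (\<lambda>(j, k). real q powi j *
      (cmod (coef (dilation (int N) (ball_fun s a)) h j (u k)))\<^sup>2)"
    define \<mu> where "\<mu> m = measure (sq_measure h) (lattice_nbhd m (s + N - a))" for m
    \<comment> \<open>Inserting m1 ensures m1 <= m0, so the sum can be cut at m1 below.\<close>
    define m0 where "m0 = Max (insert m1 ((\<lambda>p. nat (- fst p)) ` G))"
    define H where "H m = {k. (- int m, k) \<in> G}" for m
    have H: "finite (H m)" for m
    proof -
      have "H m \<subseteq> snd ` G" unfolding H_def by (auto intro: rev_image_eqI)
      then show ?thesis using G(1) finite_subset by blast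
    qed
    have m01: "m1 \<le> m0" unfolding m0_def using G(1) by simp
    have inj: "inj_on (\<lambda>(m, k). (- int m, k)) (SIGMA m:{1..m0}. H m)" by (auto simp: inj_on_def)
    have "G = (\<lambda>(m, k). (- int m, k)) ` (SIGMA m:{1..m0}. H m)"
    proof
      show "G \<subseteq> (\<lambda>(m, k). (- int m, k)) ` (SIGMA m:{1..m0}. H m)"
      proof
        fix p assume p: "p \<in> G"
        then obtain j k where jk: "p = (j, k)" "j < 0" using G(2) by auto
        have "nat (- j) \<in> (\<lambda>p. nat (- fst p)) ` G" using p jk by force
        then have "nat (- j) \<le> m0" unfolding m0_def using G(1) by (intro Max_ge) auto
        then show "p \<in> (\<lambda>(m, k). (- int m, k)) ` (SIGMA m:{1..m0}. H m)"
          using p jk by (intro image_eqI[of _ _ "(nat (- j), k)"]) (auto simp: H_def)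
      qed
    qed (auto simp: H_def)
    then have "sum t G = (\<Sum>(m, k)\<in>(SIGMA m:{1..m0}. H m). t (- int m, k))"
      using sum.reindex[OF inj, of t] by (simp add: case_prod_unfold o_def)
    also have "\<dots> = (\<Sum>m=1..m0. \<Sum>k\<in>H m. t (- int m, k))"
      by (subst sum.Sigma) (auto simp: H)
    also have "\<dots> \<le> (\<Sum>m=1..m0. (1 / 2) ^ m * \<mu> m)"
      using quasi_low_frequency_level[OF h H] N by (intro sum_mono) (auto simp: t_def \<mu>_def)
    also have "\<dots> = (\<Sum>m=1..m1. (1 / 2) ^ m * \<mu> m) + (\<Sum>m\<in>{m1<..m0}. (1 / 2) ^ m * \<mu> m)"
    proof -
      have "{1..m0} = {1..m1} \<union> {m1<..m0}" using m01 by auto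
      then show ?thesis by (simp only: sum.union_disjoint[OF finite_atLeastAtMost finite_greaterThanAtMost]) (subst sum.union_disjoint, auto)
    qed
    also have "(\<Sum>m=1..m1. (1 / 2) ^ m * \<mu> m) \<le> e / 2"
      using N1[of N] N by (simp add: X_def \<mu>_def)
    also have "(\<Sum>m\<in>{m1<..m0}. (1 / 2) ^ m * \<mu> m) \<le> (\<Sum>m\<in>{m1<..m0}. (1 / 2) ^ m * nsq h)"
      unfolding \<mu>_def by (intro sum_mono mult_left_mono measure_sq_measure_le h) auto
    also have "\<dots> = (\<Sum>m\<in>{m1<..m0}. (1 / 2) ^ m) * nsq h" by (simp add: sum_distrib_right)
    also have "\<dots> \<le> (1 / 2) ^ m1 * nsq h"
      using sum_half_powers[OF m01] by (intro mult_right_mono) (auto intro: order_trans)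
    also note tail
    finally show "(\<Sum>(j, k)\<in>G. real q powi j * (cmod (coef (dilation (int N) (ball_fun s a)) h j (u k)))\<^sup>2) \<le> e"
      by (simp add: t_def)
  qed
qed

subsection \<open>Comparison of the two sums\<close>

abbreviation affine_family :: "(nat \<Rightarrow> 'a \<Rightarrow> complex) \<Rightarrow> nat \<times> int \<times> nat \<Rightarrow> 'a \<Rightarrow> complex" where
  "affine_family \<psi> \<equiv> \<lambda>(l, j, k). affine_elem (\<psi> l) j k"

abbreviation quasi_affine_family :: "(nat \<Rightarrow> 'a \<Rightarrow> complex) \<Rightarrow> nat \<times> int \<times> nat \<Rightarrow> 'a \<Rightarrow> complex" where
  "quasi_affine_family \<psi> \<equiv> \<lambda>(l, j, k). quasi_affine_elem (\<psi> l) j k"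

abbreviation index_set :: "nat \<Rightarrow> (nat \<times> int \<times> nat) set" where
  "index_set L \<equiv> {1..L} \<times> UNIV \<times> UNIV"

lemma affine_bessel_imp_bessel_family:
  assumes "affine_bessel L \<psi>" and L2: "\<And>l. l \<in> {1..L} \<Longrightarrow> \<psi> l \<in> L2"
  obtains B where "bessel_family (index_set L) (affine_family \<psi>) B"
proof -
  obtain B where B: "B > 0" "\<And>f. f \<in> L2 \<Longrightarrow>
      (\<Sum>l=1..L. \<Sum>\<^sub>\<infinity>j. \<Sum>\<^sub>\<infinity>k. ennreal ((cmod (L2_inner f (affine_elem (\<psi> l) j k)))\<^sup>2))
        \<le> ennreal (B * (L2_norm f)\<^sup>2)"
    using assms(1) unfolding affine_bessel_def by blast
  have "(\<Sum>i\<in>F. (cmod (L2_inner f (affine_family \<psi> i)))\<^sup>2) \<le> B * nsq f"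
    if f: "f \<in> L2" and F: "finite F" "F \<subseteq> {1..L} \<times> UNIV \<times> UNIV" for f F
  proof -
    define t where "t l j k = (cmod (L2_inner f (affine_elem (\<psi> l) j k)))\<^sup>2" for l j k
    \<comment> \<open>Enclosing F in a box turns the finite sum into an iterated one, comparable
      term by term with the iterated sum in \<open>ennreal\<close>.\<close>
    define J K where "J = (fst \<circ> snd) ` F" and "K = (snd \<circ> snd) ` F"
    have fin: "finite J" "finite K" using F by (auto simp: J_def K_def)
    have sub: "F \<subseteq> {1..L} \<times> J \<times> K"
    proof
      fix x assume x: "x \<in> F"
      have "(fst \<circ> snd) x \<in> J" "(snd \<circ> snd) x \<in> K" unfolding J_def K_def using x by blast+
      then show "x \<in> {1..L} \<times> J \<times> K" using x F(2) by (cases x) auto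
    qed
    have "(\<Sum>i\<in>F. (cmod (L2_inner f (affine_family \<psi> i)))\<^sup>2) = (\<Sum>(l, j, k)\<in>F. t l j k)"
      by (intro sum.cong) (auto simp: t_def)
    also have "\<dots> \<le> (\<Sum>(l, j, k)\<in>{1..L} \<times> J \<times> K. t l j k)"
      by (rule sum_mono2) (use fin sub in \<open>auto simp: t_def\<close>)
    also have "\<dots> = (\<Sum>l=1..L. \<Sum>j\<in>J. \<Sum>k\<in>K. t l j k)"
      by (simp add: sum.cartesian_product)
    finally have le: "(\<Sum>i\<in>F. (cmod (L2_inner f (affine_family \<psi> i)))\<^sup>2)
      \<le> (\<Sum>l=1..L. \<Sum>j\<in>J. \<Sum>k\<in>K. t l j k)" .
    have "ennreal (\<Sum>l=1..L. \<Sum>j\<in>J. \<Sum>k\<in>K. t l j k) = (\<Sum>l=1..L. \<Sum>j\<in>J. \<Sum>k\<in>K. ennreal (t l j k))"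
      by (simp add: sum_ennreal sum_nonneg t_def)
    also have "\<dots> = (\<Sum>l=1..L. \<Sum>\<^sub>\<infinity>j\<in>J. \<Sum>\<^sub>\<infinity>k\<in>K. ennreal (t l j k))"
      using fin by simp
    also have "\<dots> \<le> (\<Sum>l=1..L. \<Sum>\<^sub>\<infinity>j. \<Sum>\<^sub>\<infinity>k. ennreal (t l j k))"
    proof (rule sum_mono, rule infsum_mono_neutral)
      fix l j
      show "(\<Sum>\<^sub>\<infinity>k\<in>K. ennreal (t l j k)) \<le> (\<Sum>\<^sub>\<infinity>k. ennreal (t l j k))"
        by (rule infsum_mono_neutral) (auto intro: nonneg_summable_on_complete)
    qed (auto intro: nonneg_summable_on_complete)
    also have "\<dots> \<le> ennreal (B * nsq f)"
      using B(2)[OF f] by (simp add: t_def L2_norm_sq)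
    finally have "(\<Sum>l=1..L. \<Sum>j\<in>J. \<Sum>k\<in>K. t l j k) \<le> B * nsq f"
      using B(1) by (simp add: ennreal_le_iff)
    then show ?thesis using le by linarith
  qed
  then have "bessel_family (index_set L) (affine_family \<psi>) B"
    unfolding bessel_family_def using B(1) L2 by (auto intro: affine_elem_L2)
  then show ?thesis by (rule that)
qed

lemma bessel_familyD:
  assumes "bessel_family I e B"
  shows "f \<in> L2 \<Longrightarrow> finite F \<Longrightarrow> F \<subseteq> I \<Longrightarrow> (\<Sum>i\<in>F. (cmod (L2_inner f (e i)))\<^sup>2) \<le> B * nsq f"
    and "i \<in> I \<Longrightarrow> e i \<in> L2" and "B \<ge> 0"
  using assms by (simp_all add: bessel_family_def)

lemma bessel_family_slice:
  assumes "bessel_family (index_set L) (affine_family \<psi>) B" "l \<in> {1..L :: nat}"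
  shows "bessel_family UNIV (\<lambda>(j, k). affine_elem (\<psi> l) j k) B"
proof -
  have "(\<Sum>i\<in>F. (cmod (L2_inner f ((\<lambda>(j, k). affine_elem (\<psi> l) j k) i)))\<^sup>2) \<le> B * nsq f"
    if "f \<in> L2" "finite F" for f F
  proof -
    have "(\<Sum>i\<in>F. (cmod (L2_inner f ((\<lambda>(j, k). affine_elem (\<psi> l) j k) i)))\<^sup>2)
        = (\<Sum>i\<in>Pair l ` F. (cmod (L2_inner f (affine_family \<psi> i)))\<^sup>2)"
      by (subst sum.reindex) (auto simp: inj_on_def)
    also have "\<dots> \<le> B * nsq f"
      by (rule bessel_familyD(1)[OF assms(1) that(1)]) (use that(2) assms(2) in auto)
    finally show ?thesis .
  qed
  moreover have "affine_elem (\<psi> l) j k \<in> L2" for j k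
    using bessel_familyD(2)[OF assms(1), of "(l, j, k)"] assms(2) by simp
  ultimately show ?thesis using bessel_familyD(3)[OF assms(1)] unfolding bessel_family_def by auto
qed

text \<open>The weight for negative j is the square of the extra factor q^(j/2), which enters a
  squared coefficient and a product of two coefficients alike. The value type is left general so
  that real squares and complex products share one averaging lemma.\<close>

definition quasi_term :: "('a \<Rightarrow> 'b :: real_vector) \<Rightarrow> int \<Rightarrow> nat \<Rightarrow> 'b" where
  "quasi_term \<theta> j k = (if j \<ge> 0 then \<theta> (\<pp> powi j * u k) else real q powi j *\<^sub>R \<theta> (u k))"

text \<open>The quasi-affine normalisation is what makes both signs of j give the same factor: for j
  = -m each lattice point is counted q^(N - m) = q^N q^j times.\<close>

lemma quasi_term_average:
  fixes \<theta> :: "'a \<Rightarrow> 'b :: banach"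
  assumes summ: "\<And>z. (\<lambda>k. norm (\<theta> (z + \<pp> powi j * u k))) summable_on UNIV" and j: "j \<ge> - int N"
  shows "(\<lambda>k. norm (quasi_term \<theta> j k)) summable_on UNIV"
    and "(\<Sum>r<q ^ N. \<Sum>\<^sub>\<infinity>k. \<theta> (u r + \<pp> powi j * u k)) = real (q ^ N) *\<^sub>R (\<Sum>\<^sub>\<infinity>k. quasi_term \<theta> j k)"
proof -
  have "(\<lambda>k. norm (quasi_term \<theta> j k)) summable_on UNIV \<and>
    (\<Sum>r<q ^ N. \<Sum>\<^sub>\<infinity>k. \<theta> (u r + \<pp> powi j * u k)) = real (q ^ N) *\<^sub>R (\<Sum>\<^sub>\<infinity>k. quasi_term \<theta> j k)"
  proof (cases "j \<ge> 0")
    case True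
    then have "\<pp> powi j = \<pp> ^ nat j" by (simp add: power_int_def)
    then show ?thesis
      using summ[of 0] lattice_average_nonneg[where N = N and \<Theta> = \<theta> and j = "nat j"] True by (simp add: quasi_term_def)
  next
    case False
    define m where "m = nat (- j)"
    have m: "j = - int m" "m \<le> N" using False j by (auto simp: m_def)
    note summ' = summ[unfolded m(1)]
    have tm: "quasi_term \<theta> j k = real q powi j *\<^sub>R \<theta> (u k)" for k
      using False by (simp add: quasi_term_def)
    have s: "(\<lambda>k. norm (\<theta> (u k))) summable_on UNIV"
      by (rule lattice_sum_split(1)[where m = m]) (rule summ')
    have A: "(\<lambda>k. norm (quasi_term \<theta> j k)) summable_on UNIV"
      unfolding tm norm_scaleR by (rule summable_on_cmult_right[OF s])
    have sc: "real (q ^ (N - m)) = real (q ^ N) * real q powi j"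
    proof -
      have "q ^ N = q ^ (N - m) * q ^ m" using m(2) by (simp flip: power_add)
      then have "real (q ^ N) = real (q ^ (N - m)) * real q ^ m" by (simp only: of_nat_mult of_nat_power)
      then show ?thesis unfolding m(1) using q_ge_2 by (simp add: power_int_minus)
    qed
    have "(\<Sum>r<q ^ N. \<Sum>\<^sub>\<infinity>k. \<theta> (u r + \<pp> powi j * u k)) = real (q ^ (N - m)) *\<^sub>R (\<Sum>\<^sub>\<infinity>k. \<theta> (u k))"
      unfolding m(1) by (rule lattice_average_neg[OF summ' m(2)])
    also have "\<dots> = real (q ^ N) *\<^sub>R (\<Sum>\<^sub>\<infinity>k. quasi_term \<theta> j k)"
      unfolding tm infsum_scaleR_right sc by simp
    finally show ?thesis using A by blast
  qed
  then show "(\<lambda>k. norm (quasi_term \<theta> j k)) summable_on UNIV"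
    and "(\<Sum>r<q ^ N. \<Sum>\<^sub>\<infinity>k. \<theta> (u r + \<pp> powi j * u k)) = real (q ^ N) *\<^sub>R (\<Sum>\<^sub>\<infinity>k. quasi_term \<theta> j k)"
    by blast+
qed

lemma inner_affine_translate:
  assumes "f \<in> L2" "h \<in> L2"
  shows "L2_inner (\<lambda>x. f (x + z)) (affine_elem h j k) = coef f h j (z + \<pp> powi j * u k)"
  unfolding inner_affine_elem coef_translate[OF assms] by (simp add: add.commute)

lemma quasi_sq_eq:
  "(cmod (L2_inner f (quasi_affine_elem h j k)))\<^sup>2 = quasi_term (\<lambda>y. (cmod (coef f h j y))\<^sup>2) j k"
  by (simp add: inner_quasi_affine_elem quasi_term_def norm_mult power_mult_distrib powr_half_sq)

lemma quasi_prod_eq: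
  "L2_inner f (quasi_affine_elem h j k) * L2_inner (quasi_affine_elem h' j k) g
    = quasi_term (\<lambda>y. coef f h j y * cnj (coef g h' j y)) j k"
proof -
  have "complex_of_real (real q powr (real_of_int j / 2)) * of_real (real q powr (real_of_int j / 2)) = of_real (real q powi j)"
    by (simp flip: powr_half_sq add: power2_eq_square)
  then have "complex_of_real (real q powr (real_of_int j / 2)) * x * (of_real (real q powr (real_of_int j / 2)) * y)
      = of_real (real q powi j) * (x * y)" for x y
    by (metis mult.assoc mult.left_commute)
  then show ?thesis
    unfolding inner_cnj[of "quasi_affine_elem h' j k" g]
    by (simp add: inner_quasi_affine_elem quasi_term_def scaleR_conv_of_real)
qed

text \<open>Translation preserves the norm, so averaging the affine Bessel inequality over the
  translates by \<open>u r\<close> yields the quasi-affine one with the same constant.\<close>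

lemma quasi_bessel_family:
  assumes bessel: "bessel_family (index_set L) (affine_family \<psi>) B"
    and L2: "\<And>l. l \<in> {1..L} \<Longrightarrow> \<psi> l \<in> L2"
  shows "bessel_family (index_set L) (quasi_affine_family \<psi>) B"
proof -
  have "(\<Sum>i\<in>F. (cmod (L2_inner f (quasi_affine_family \<psi> i)))\<^sup>2) \<le> B * nsq f"
    if f: "f \<in> L2" and F: "finite F" "F \<subseteq> {1..L} \<times> UNIV \<times> UNIV" for f F
  proof -
    define J where "J = (fst \<circ> snd) ` F"
    have finJ: "finite J" using F by (auto simp: J_def)
    have sub: "F \<subseteq> {1..L} \<times> J \<times> UNIV"
    proof
      fix x assume x: "x \<in> F"
      have "(fst \<circ> snd) x \<in> J" unfolding J_def using x by blast
      then show "x \<in> {1..L} \<times> J \<times> UNIV" using x F(2) by (cases x) auto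
    qed
    \<comment> \<open>Deep enough for all levels that occur in the finite set F; 0 is inserted for
      the case of empty J.\<close>
    define N where "N = nat (Max (insert 0 (uminus ` J)))"
    have N: "j \<ge> - int N" if "j \<in> J" for j
    proof -
      have "- j \<le> Max (insert 0 (uminus ` J))" using finJ that by (intro Max_ge) auto
      then show ?thesis by (simp add: N_def)
    qed
    define \<theta> where "\<theta> l j y = (cmod (coef f (\<psi> l) j y))\<^sup>2" for l j y
    define t where "t r = (\<lambda>(l, j, k). \<theta> l j (u r + \<pp> powi j * u k))" for r
    define s where "s = (\<lambda>(l, j, k). quasi_term (\<theta> l j) j k)"
    have tz: "(\<lambda>k. norm (\<theta> l j (z + \<pp> powi j * u k))) summable_on UNIV" if l: "l \<in> {1..L}" for l j z
    proof -
      have "(\<lambda>i. (cmod (L2_inner (\<lambda>x. f (x + z)) (affine_family \<psi> i)))\<^sup>2)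
          summable_on ({l} \<times> {j} \<times> UNIV)"
        by (rule bessel_sum_le(1)[OF bessel translate_L2[OF f]]) (use l in auto)
      then have "(\<lambda>i. norm ((cmod (L2_inner (\<lambda>x. f (x + z)) (affine_family \<psi> i)))\<^sup>2))
          summable_on ({l} \<times> {j} \<times> UNIV)" by simp
      from infsum_triple(3)[OF this, of l j] show ?thesis
        by (simp add: \<theta>_def inner_affine_translate[OF f L2[OF l]])
    qed
    have t_le: "(\<Sum>l=1..L. \<Sum>j\<in>J. \<Sum>\<^sub>\<infinity>k. t r (l, j, k)) \<le> B * nsq f" for r
    proof -
      have t_eq: "t r i = (cmod (L2_inner (\<lambda>x. f (x + u r)) (affine_family \<psi> i)))\<^sup>2"
        if "i \<in> {1..L} \<times> J \<times> UNIV" for i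
        using that by (auto simp: t_def \<theta>_def inner_affine_translate[OF f L2])
      have "(\<lambda>i. norm (t r i)) summable_on ({1..L} \<times> J \<times> UNIV)"
        by (rule summable_on_finite_box) (use finJ tz in \<open>auto simp: t_def\<close>)
      from infsum_triple(1)[OF this]
      have "(\<Sum>l=1..L. \<Sum>j\<in>J. \<Sum>\<^sub>\<infinity>k. t r (l, j, k)) = infsum (t r) ({1..L} \<times> J \<times> UNIV)"
        using finJ by simp
      also have "\<dots> = (\<Sum>\<^sub>\<infinity>i\<in>{1..L} \<times> J \<times> UNIV.
          (cmod (L2_inner (\<lambda>x. f (x + u r)) (affine_family \<psi> i)))\<^sup>2)"
        by (intro infsum_cong t_eq)
      also have "\<dots> \<le> B * nsq (\<lambda>x. f (x + u r))"
        by (rule bessel_sum_le(2)[OF bessel translate_L2[OF f]]) auto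
      finally show ?thesis by (simp add: nsq_translate f)
    qed
    have s_summ: "(\<lambda>i. norm (s i)) summable_on ({1..L} \<times> J \<times> UNIV)"
      by (rule summable_on_finite_box)
         (use finJ quasi_term_average(1)[OF tz N] in \<open>auto simp: s_def\<close>)
    have s_nonneg: "s i \<ge> 0" for i by (auto simp: s_def quasi_term_def \<theta>_def split: prod.split)
    have "(\<Sum>i\<in>F. (cmod (L2_inner f (quasi_affine_family \<psi> i)))\<^sup>2) = sum s F"
      by (intro sum.cong) (auto simp: s_def quasi_sq_eq \<theta>_def[abs_def])
    also have "\<dots> \<le> infsum s ({1..L} \<times> J \<times> UNIV)"
      by (rule finite_sum_le_infsum[OF abs_summable_summable[OF s_summ] F(1) sub s_nonneg])
    also have "\<dots> = (\<Sum>l=1..L. \<Sum>j\<in>J. \<Sum>\<^sub>\<infinity>k. quasi_term (\<theta> l j) j k)"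
      unfolding infsum_triple(1)[OF s_summ] using finJ by (simp add: s_def)
    finally have le: "(\<Sum>i\<in>F. (cmod (L2_inner f (quasi_affine_family \<psi> i)))\<^sup>2)
      \<le> (\<Sum>l=1..L. \<Sum>j\<in>J. \<Sum>\<^sub>\<infinity>k. quasi_term (\<theta> l j) j k)" .
    have "real (q ^ N) * (\<Sum>l=1..L. \<Sum>j\<in>J. \<Sum>\<^sub>\<infinity>k. quasi_term (\<theta> l j) j k)
        = (\<Sum>l=1..L. \<Sum>j\<in>J. \<Sum>r<q ^ N. \<Sum>\<^sub>\<infinity>k. t r (l, j, k))"
      unfolding sum_distrib_left t_def prod.case
      using quasi_term_average(2)[OF tz N] by (intro sum.cong refl) simp
    also have "\<dots> = (\<Sum>r<q ^ N. \<Sum>l=1..L. \<Sum>j\<in>J. \<Sum>\<^sub>\<infinity>k. t r (l, j, k))"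
      by (subst (2) sum.swap) (subst sum.swap, rule refl)
    also have "\<dots> \<le> (\<Sum>r<q ^ N. B * nsq f)" by (intro sum_mono t_le)
    also have "\<dots> = real (q ^ N) * (B * nsq f)" by simp
    finally have "(\<Sum>l=1..L. \<Sum>j\<in>J. \<Sum>\<^sub>\<infinity>k. quasi_term (\<theta> l j) j k) \<le> B * nsq f"
      using q_pos by (subst (asm) mult_le_cancel_left_pos) auto
    then show ?thesis using le by linarith
  qed
  then show ?thesis
    using bessel L2 unfolding bessel_family_def by (auto intro: quasi_affine_elem_L2)
qed

section \<open>From affine to quasi-affine duality\<close>

lemma low_frequency_average_family_le:
  fixes s a N :: nat
  defines "f \<equiv> ball_fun s a"
  assumes bessel: "bessel_family (index_set L) (affine_family \<psi>) B"
    and L2: "\<And>l. l \<in> {1..L} \<Longrightarrow> \<psi> l \<in> L2" and a: "a \<le> N"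
  shows "(\<Sum>r<q ^ N. \<Sum>\<^sub>\<infinity>i\<in>{1..L} \<times> {j. j < - int N} \<times> UNIV.
      (cmod (L2_inner (\<lambda>x. f (x + u r)) (affine_family \<psi> i)))\<^sup>2)
    \<le> (\<Sum>l=1..L. B + real (N + s) * nsq (\<psi> l))"
proof -
  have f: "f \<in> L2" unfolding f_def by (rule indicator_Ball_L2)
  let ?J = "{j. j < - int N}"
  define w where "w l = (\<lambda>(r, j, k). (cmod (coef f (\<psi> l) j (u r + \<pp> powi j * u k)))\<^sup>2)" for l
  define t where "t r = (\<lambda>i. (cmod (L2_inner (\<lambda>x. f (x + u r)) (affine_family \<psi> i)))\<^sup>2)" for r
  \<comment> \<open>A crude sufficient condition: a < q^a, and a <= N.\<close>
  have alt: "a < q ^ (N + s)"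
  proof -
    have "q ^ a \<le> q ^ (N + s)" using a q_ge_2 by (intro power_increasing) auto
    then show ?thesis using less_q_power[of a] by linarith
  qed
  have fin: "sum (w l) G \<le> B + real (N + s) * nsq (\<psi> l)"
    if l: "l \<in> {1..L}" and G: "finite G" "G \<subseteq> {..<q ^ N} \<times> ?J \<times> UNIV" for l G
  proof -
    have "sum (w l) G \<le> (B + real (N + s) * nsq (\<psi> l)) / real q ^ s"
      using low_frequency_average_le[OF L2[OF l] bessel_family_slice[OF bessel l] alt G]
      by (simp add: w_def f_def)
    \<comment> \<open>The gain q^-s is given up, as s is fixed while N tends to infinity.\<close>
    also have "\<dots> \<le> (B + real (N + s) * nsq (\<psi> l)) / 1"
      using bessel q_ge_2 unfolding bessel_family_def by (intro divide_left_mono) auto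
    finally show ?thesis by simp
  qed
  have w0: "w l i \<ge> 0" for l i by (auto simp: w_def split: prod.split)
  have w: "(\<lambda>i. norm (w l i)) summable_on ({..<q ^ N} \<times> ?J \<times> UNIV)"
    and w_le: "infsum (w l) ({..<q ^ N} \<times> ?J \<times> UNIV) \<le> B + real (N + s) * nsq (\<psi> l)" if l: "l \<in> {1..L}" for l
    using infsum_le_if_finite_sums_le[of _ "w l", OF w0 fin[OF l]] w0 by simp_all
  have t: "(\<lambda>i. norm (t r i)) summable_on ({1..L} \<times> ?J \<times> UNIV)" for r
    using bessel_sum_le(1)[OF bessel translate_L2[OF f], of "{1..L} \<times> ?J \<times> UNIV" "u r"]
    by (auto simp: t_def)
  have "(\<Sum>r<q ^ N. infsum (t r) ({1..L} \<times> ?J \<times> UNIV)) = (\<Sum>r<q ^ N. \<Sum>l=1..L. \<Sum>\<^sub>\<infinity>j\<in>?J. \<Sum>\<^sub>\<infinity>k. w l (r, j, k))"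
  proof (intro sum.cong refl)
    fix r
    have "infsum (t r) ({1..L} \<times> ?J \<times> UNIV) = (\<Sum>l=1..L. \<Sum>\<^sub>\<infinity>j\<in>?J. \<Sum>\<^sub>\<infinity>k. t r (l, j, k))"
      unfolding infsum_triple(1)[OF t] by simp
    also have "\<dots> = (\<Sum>l=1..L. \<Sum>\<^sub>\<infinity>j\<in>?J. \<Sum>\<^sub>\<infinity>k. w l (r, j, k))"
      by (intro sum.cong refl infsum_cong) (simp add: t_def w_def inner_affine_translate[OF f L2])
    finally show "infsum (t r) ({1..L} \<times> ?J \<times> UNIV) = (\<Sum>l=1..L. \<Sum>\<^sub>\<infinity>j\<in>?J. \<Sum>\<^sub>\<infinity>k. w l (r, j, k))" .
  qed
  also have "\<dots> = (\<Sum>l=1..L. \<Sum>r<q ^ N. \<Sum>\<^sub>\<infinity>j\<in>?J. \<Sum>\<^sub>\<infinity>k. w l (r, j, k))" by (rule sum.swap)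
  also have "\<dots> = (\<Sum>l=1..L. infsum (w l) ({..<q ^ N} \<times> ?J \<times> UNIV))"
    by (intro sum.cong refl) (simp add: infsum_triple(1)[OF w])
  also have "\<dots> \<le> (\<Sum>l=1..L. B + real (N + s) * nsq (\<psi> l))" by (intro sum_mono w_le)
  finally show ?thesis by (simp add: t_def)
qed

text \<open>Translating f and g by the same \<open>u r\<close> shifts the argument of the product of
  their coefficients, so \<open>quasi_term_average\<close> applies level by level. Absolute
  summability justifies moving the finite sum over r inside.\<close>

lemma affine_quasi_partial_average:
  fixes f g :: "'a \<Rightarrow> complex" and \<psi> \<phi> :: "nat \<Rightarrow> 'a \<Rightarrow> complex"
  defines "aT \<equiv> \<lambda>r. \<lambda>(l, j, k). L2_inner (\<lambda>x. f (x + u r)) (affine_elem (\<psi> l) j k) *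
      L2_inner (affine_elem (\<phi> l) j k) (\<lambda>x. g (x + u r))"
    and "qT \<equiv> \<lambda>(l, j, k). L2_inner f (quasi_affine_elem (\<psi> l) j k) * L2_inner (quasi_affine_elem (\<phi> l) j k) g"
  assumes f: "f \<in> L2" and g: "g \<in> L2"
    and L2: "\<And>l. l \<in> {1..L :: nat} \<Longrightarrow> \<psi> l \<in> L2" "\<And>l. l \<in> {1..L} \<Longrightarrow> \<phi> l \<in> L2"
    and bessel: "bessel_family (index_set L) (affine_family \<psi>) B"
      "bessel_family (index_set L) (affine_family \<phi>) B'"
    and q: "(\<lambda>i. norm (qT i)) summable_on ({1..L} \<times> {- int N..} \<times> UNIV)"
  shows "(\<Sum>r<q ^ N. infsum (aT r) ({1..L} \<times> {- int N..} \<times> UNIV))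
    = of_nat (q ^ N) * infsum qT ({1..L} \<times> {- int N..} \<times> UNIV)"
proof -
  define \<theta> where "\<theta> l j y = coef f (\<psi> l) j y * cnj (coef g (\<phi> l) j y)" for l j y
  have abs: "(\<lambda>i. norm (L2_inner (\<lambda>x. f (x + z)) (affine_family \<psi> i) *
      L2_inner (affine_family \<phi> i) (\<lambda>x. g (x + z)))) summable_on (index_set L)" for z
    by (rule bessel_products(1)[OF bessel translate_L2[OF f] translate_L2[OF g]])
  have prod_eq: "L2_inner (\<lambda>x. f (x + z)) (affine_elem (\<psi> l) j k) * L2_inner (affine_elem (\<phi> l) j k) (\<lambda>x. g (x + z))
      = \<theta> l j (z + \<pp> powi j * u k)" if "l \<in> {1..L}" for l j k z
    unfolding inner_cnj[of "affine_elem (\<phi> l) j k"] \<theta>_def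
    using that by (simp add: inner_affine_translate f g L2)
  have summ: "(\<lambda>k. norm (\<theta> l j (z + \<pp> powi j * u k))) summable_on UNIV" if l: "l \<in> {1..L}" for l j z
    using infsum_triple(3)[OF abs[of z] l UNIV_I[of j]] by (simp only: prod.case prod_eq[OF l])
  have a: "(\<lambda>i. norm (aT r i)) summable_on ({1..L} \<times> {- int N..} \<times> UNIV)" for r
  proof -
    have eq: "aT r = (\<lambda>i. L2_inner (\<lambda>x. f (x + u r)) (affine_family \<psi> i) *
      L2_inner (affine_family \<phi> i) (\<lambda>x. g (x + u r)))"
      by (auto simp: aT_def fun_eq_iff)
    show ?thesis unfolding eq by (rule summable_on_subset_banach[OF abs]) auto
  qed
  have "(\<Sum>r<q ^ N. infsum (aT r) ({1..L} \<times> {- int N..} \<times> UNIV))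
      = (\<Sum>r<q ^ N. \<Sum>l=1..L. \<Sum>\<^sub>\<infinity>j\<in>{- int N..}. \<Sum>\<^sub>\<infinity>k. aT r (l, j, k))"
    by (simp only: infsum_triple(1)[OF a] infsum_finite finite_atLeastAtMost)
  also have "\<dots> = (\<Sum>l=1..L. \<Sum>r<q ^ N. \<Sum>\<^sub>\<infinity>j\<in>{- int N..}. \<Sum>\<^sub>\<infinity>k. aT r (l, j, k))"
    by (rule sum.swap)
  also have "\<dots> = (\<Sum>l=1..L. \<Sum>\<^sub>\<infinity>j\<in>{- int N..}. \<Sum>r<q ^ N. \<Sum>\<^sub>\<infinity>k. aT r (l, j, k))"
    by (intro sum.cong refl infsum_sum_swap(1) infsum_triple_summable[OF a]) auto
  also have "\<dots> = (\<Sum>l=1..L. \<Sum>\<^sub>\<infinity>j\<in>{- int N..}. of_nat (q ^ N) * (\<Sum>\<^sub>\<infinity>k. qT (l, j, k)))"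
  proof (intro sum.cong refl infsum_cong)
    fix l j assume l: "l \<in> {1..L}" and j: "j \<in> {- int N..}"
    have "(\<Sum>r<q ^ N. \<Sum>\<^sub>\<infinity>k. aT r (l, j, k)) = (\<Sum>r<q ^ N. \<Sum>\<^sub>\<infinity>k. \<theta> l j (u r + \<pp> powi j * u k))"
      by (simp only: aT_def prod.case prod_eq[OF l])
    also have "\<dots> = real (q ^ N) *\<^sub>R (\<Sum>\<^sub>\<infinity>k. quasi_term (\<theta> l j) j k)"
      using quasi_term_average(2)[of "\<theta> l j", OF summ[OF l]] j by simp
    also have "\<dots> = of_nat (q ^ N) * (\<Sum>\<^sub>\<infinity>k. qT (l, j, k))"
      by (simp add: qT_def quasi_prod_eq \<theta>_def[abs_def] scaleR_conv_of_real)
    finally show "(\<Sum>r<q ^ N. \<Sum>\<^sub>\<infinity>k. aT r (l, j, k)) = of_nat (q ^ N) * (\<Sum>\<^sub>\<infinity>k. qT (l, j, k))" .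
  qed
  also have "\<dots> = of_nat (q ^ N) * (\<Sum>l=1..L. \<Sum>\<^sub>\<infinity>j\<in>{- int N..}. \<Sum>\<^sub>\<infinity>k. qT (l, j, k))"
    by (simp only: infsum_cmult_right' sum_distrib_left)
  also have "(\<Sum>l=1..L. \<Sum>\<^sub>\<infinity>j\<in>{- int N..}. \<Sum>\<^sub>\<infinity>k. qT (l, j, k)) = infsum qT ({1..L} \<times> {- int N..} \<times> UNIV)"
    by (simp only: infsum_triple(1)[OF q] infsum_finite finite_atLeastAtMost)
  finally show ?thesis .
qed

lemma cmod_infsum_products_le:
  assumes "(\<lambda>i. (cmod (L2_inner f (a i)))\<^sup>2) summable_on J" "(\<lambda>i. (cmod (L2_inner g (b i)))\<^sup>2) summable_on J"
  shows "cmod (\<Sum>\<^sub>\<infinity>i\<in>J. L2_inner f (a i) * L2_inner (b i) g)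
    \<le> ((\<Sum>\<^sub>\<infinity>i\<in>J. (cmod (L2_inner f (a i)))\<^sup>2) + (\<Sum>\<^sub>\<infinity>i\<in>J. (cmod (L2_inner g (b i)))\<^sup>2)) / 2"
proof -
  let ?s = "\<lambda>i. ((cmod (L2_inner f (a i)))\<^sup>2 + (cmod (L2_inner g (b i)))\<^sup>2) * (1 / 2)"
  have s: "?s summable_on J" by (intro summable_on_cmult_left summable_on_add assms)
  have le: "norm (L2_inner f (a i) * L2_inner (b i) g) \<le> ?s i" for i
    using norm_mult_le_half_squares[of "L2_inner f (a i)" "L2_inner (b i) g"]
    by (simp add: inner_cnj[of "b i" g])
  have n: "(\<lambda>i. norm (L2_inner f (a i) * L2_inner (b i) g)) summable_on J"
    by (rule summable_on_comparison_test[OF s]) (use le in auto)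
  have "cmod (\<Sum>\<^sub>\<infinity>i\<in>J. L2_inner f (a i) * L2_inner (b i) g)
      \<le> (\<Sum>\<^sub>\<infinity>i\<in>J. norm (L2_inner f (a i) * L2_inner (b i) g))"
    by (rule norm_infsum_bound[OF n])
  also have "\<dots> \<le> infsum ?s J" by (rule infsum_mono[OF n s le])
  also have "\<dots> = ((\<Sum>\<^sub>\<infinity>i\<in>J. (cmod (L2_inner f (a i)))\<^sup>2) + (\<Sum>\<^sub>\<infinity>i\<in>J. (cmod (L2_inner g (b i)))\<^sup>2)) / 2"
    by (subst infsum_cmult_left') (simp add: infsum_add assms)
  finally show ?thesis .
qed

lemma affine_imp_quasi_Ball:
  fixes s a s' a' :: nat
  defines "f \<equiv> ball_fun s a" and "g \<equiv> ball_fun s' a'"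
  assumes L2: "\<And>l. l \<in> {1..L :: nat} \<Longrightarrow> \<psi> l \<in> L2" "\<And>l. l \<in> {1..L} \<Longrightarrow> \<phi> l \<in> L2"
    and bessel: "bessel_family (index_set L) (affine_family \<psi>) B"
      "bessel_family (index_set L) (affine_family \<phi>) B'"
    and dual: "\<And>f g. f \<in> L2 \<Longrightarrow> g \<in> L2 \<Longrightarrow>
      ((\<lambda>i. L2_inner f (affine_family \<psi> i) * L2_inner (affine_family \<phi> i) g)
        has_sum L2_inner f g) (index_set L)"
  shows "((\<lambda>i. L2_inner f (quasi_affine_family \<psi> i) *
      L2_inner (quasi_affine_family \<phi> i) g) has_sum L2_inner f g) (index_set L)"
proof -
  have f: "f \<in> L2" and g: "g \<in> L2" unfolding f_def g_def by (rule indicator_Ball_L2)+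
  define I where "I = {1..L} \<times> (UNIV :: int set) \<times> (UNIV :: nat set)"
  define T where "T N = {1..L} \<times> {- int N..} \<times> (UNIV :: nat set)" for N
  define R where "R N = {1..L} \<times> {j. j < - int N} \<times> (UNIV :: nat set)" for N
  define eF where "eF \<psi> = (affine_family \<psi>)" for \<psi> :: "nat \<Rightarrow> 'a \<Rightarrow> complex"
  define aT where "aT r i = L2_inner (\<lambda>x. f (x + u r)) (eF \<psi> i) * L2_inner (eF \<phi> i) (\<lambda>x. g (x + u r))" for r i
  define qT where "qT i = L2_inner f (quasi_affine_family \<psi> i) *
      L2_inner (quasi_affine_family \<phi> i) g" for i
  note bessel' = bessel[folded I_def eF_def]
  have ITR: "I = T N \<union> R N" "T N \<inter> R N = {}" "T N \<subseteq> I" "R N \<subseteq> I" for N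
    by (auto simp: I_def T_def R_def)
  have qabs: "(\<lambda>i. norm (qT i)) summable_on I"
    unfolding qT_def I_def
    by (rule bessel_products(1)[OF quasi_bessel_family[OF bessel(1) L2(1)] quasi_bessel_family[OF bessel(2) L2(2)] f g])
  have aabs: "aT r summable_on J" if "J \<subseteq> I" for r J
  proof -
    have "(\<lambda>i. norm (aT r i)) summable_on I"
      unfolding aT_def by (rule bessel_products(1)[OF bessel' translate_L2[OF f] translate_L2[OF g]])
    from summable_on_subset_banach[OF this that] show ?thesis by (rule abs_summable_summable)
  qed
  define c where "c N = ((\<Sum>l=1..L. B + real (N + s) * nsq (\<psi> l)) + (\<Sum>l=1..L. B' + real (N + s') * nsq (\<phi> l))) / 2" for N
  have key: "cmod (L2_inner f g - infsum qT (T N)) \<le> c N / real q ^ N" if N: "N \<ge> max a a'" for N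
  proof -
    have avg: "(\<Sum>r<q ^ N. infsum (aT r) (T N)) = of_nat (q ^ N) * infsum qT (T N)"
    proof -
      have eqs: "aT r = (\<lambda>(l, j, k). L2_inner (\<lambda>x. f (x + u r)) (affine_elem (\<psi> l) j k) *
          L2_inner (affine_elem (\<phi> l) j k) (\<lambda>x. g (x + u r)))"
        "qT = (\<lambda>(l, j, k). L2_inner f (quasi_affine_elem (\<psi> l) j k) * L2_inner (quasi_affine_elem (\<phi> l) j k) g)" for r
        by (auto simp: aT_def qT_def eF_def fun_eq_iff)
      have "(\<lambda>i. norm (qT i)) summable_on (T N)" by (rule summable_on_subset_banach[OF qabs ITR(3)])
      then show ?thesis
        unfolding T_def eqs by (intro affine_quasi_partial_average[OF f g L2 bessel]) (simp_all add: eqs)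
    qed
    \<comment> \<open>Both functions are translated by the same vector, so every translate has the
      same inner product.\<close>
    have "L2_inner f g = infsum (aT r) (T N) + infsum (aT r) (R N)" for r
    proof -
      have "L2_inner f g = L2_inner (\<lambda>x. f (x + u r)) (\<lambda>x. g (x + u r))" by (simp add: inner_translate f g)
      also have "\<dots> = infsum (aT r) I"
        unfolding aT_def[abs_def] eF_def I_def
        by (rule infsumI[OF dual[OF translate_L2[OF f] translate_L2[OF g]], symmetric])
      also have "\<dots> = infsum (aT r) (T N) + infsum (aT r) (R N)"
        unfolding ITR(1)[of N] by (intro infsum_Un_disjoint aabs ITR)
      finally show ?thesis .
    qed
    then have "(\<Sum>r<q ^ N. L2_inner f g) = (\<Sum>r<q ^ N. infsum (aT r) (T N)) + (\<Sum>r<q ^ N. infsum (aT r) (R N))"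
      by (simp only: sum.distrib[symmetric])
    then have eq: "of_nat (q ^ N) * (L2_inner f g - infsum qT (T N)) = (\<Sum>r<q ^ N. infsum (aT r) (R N))"
      unfolding avg by (simp add: algebra_simps)
    have "real q ^ N * cmod (L2_inner f g - infsum qT (T N)) = cmod (\<Sum>r<q ^ N. infsum (aT r) (R N))"
      unfolding eq[symmetric] norm_mult norm_of_nat by simp
    also have "\<dots> \<le> (\<Sum>r<q ^ N. cmod (infsum (aT r) (R N)))" by (rule norm_sum)
    also have "\<dots> \<le> (\<Sum>r<q ^ N. ((\<Sum>\<^sub>\<infinity>i\<in>R N. (cmod (L2_inner (\<lambda>x. f (x + u r)) (eF \<psi> i)))\<^sup>2)
        + (\<Sum>\<^sub>\<infinity>i\<in>R N. (cmod (L2_inner (\<lambda>x. g (x + u r)) (eF \<phi> i)))\<^sup>2)) / 2)"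
      unfolding aT_def
      by (intro sum_mono cmod_infsum_products_le bessel_sum_le(1)[OF bessel'(1) translate_L2[OF f] ITR(4)]
          bessel_sum_le(1)[OF bessel'(2) translate_L2[OF g] ITR(4)])
    also have "\<dots> = ((\<Sum>r<q ^ N. \<Sum>\<^sub>\<infinity>i\<in>R N. (cmod (L2_inner (\<lambda>x. f (x + u r)) (eF \<psi> i)))\<^sup>2)
        + (\<Sum>r<q ^ N. \<Sum>\<^sub>\<infinity>i\<in>R N. (cmod (L2_inner (\<lambda>x. g (x + u r)) (eF \<phi> i)))\<^sup>2)) / 2"
      by (simp only: sum_divide_distrib[symmetric] sum.distrib)
    also have "\<dots> \<le> c N"
      unfolding c_def R_def eF_def f_def g_def
      using low_frequency_average_family_le[OF bessel(1) L2(1), where a = a and N = N and s = s]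
        low_frequency_average_family_le[OF bessel(2) L2(2), where a = a' and N = N and s = s'] N
      by (intro divide_right_mono add_mono) auto
    finally show ?thesis using q_ge_2 by (simp add: field_simps)
  qed
  \<comment> \<open>The numerator is affine in N; its slope \<beta> comes from the
    \<open>nsq\<close> paid at each induction step of \<open>comb_energy_bound\<close>.\<close>
  have "(\<lambda>N. c N / real q ^ N) \<longlonglongrightarrow> 0"
  proof -
    define \<alpha> where "\<alpha> = ((\<Sum>l=1..L. B + real s * nsq (\<psi> l)) + (\<Sum>l=1..L. B' + real s' * nsq (\<phi> l))) / 2"
    define \<beta> where "\<beta> = ((\<Sum>l=1..L. nsq (\<psi> l)) + (\<Sum>l=1..L. nsq (\<phi> l))) / 2"
    have "c N = \<alpha> + \<beta> * real N" for N
      unfolding c_def \<alpha>_def \<beta>_def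
      by (simp add: sum.distrib distrib_right add_divide_distrib sum_distrib_left[symmetric] algebra_simps)
    then have "(\<lambda>N. c N / real q ^ N) = (\<lambda>N. \<alpha> * (1 / real q) ^ N + \<beta> * (real N * (1 / real q) ^ N))"
      by (simp add: add_divide_distrib power_one_over)
    moreover have "(\<lambda>N. \<alpha> * (1 / real q) ^ N + \<beta> * (real N * (1 / real q) ^ N)) \<longlonglongrightarrow> \<alpha> * 0 + \<beta> * 0"
      using q_ge_2 by (intro tendsto_intros LIMSEQ_realpow_zero powser_times_n_limit_0) auto
    ultimately show ?thesis by simp
  qed
  moreover have "\<forall>\<^sub>F N in sequentially. norm (L2_inner f g - infsum qT (T N)) \<le> c N / real q ^ N"
    unfolding eventually_sequentially using key by blast
  ultimately have "(\<lambda>N. L2_inner f g - infsum qT (T N)) \<longlonglongrightarrow> 0"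
    by (rule Lim_null_comparison[rotated])
  moreover have "(\<lambda>N. infsum qT (T N)) \<longlonglongrightarrow> infsum qT I"
  proof (rule infsum_tendsto_exhaustion[OF qabs ITR(3)])
    fix i assume "i \<in> I"
    obtain l j k where i: "i = (l, j, k)" by (cases i) auto
    show "\<forall>\<^sub>F N in sequentially. i \<in> T N"
      using \<open>i \<in> I\<close> unfolding eventually_sequentially
      by (intro exI[of _ "nat (- j)"]) (auto simp: i I_def T_def)
  qed
  ultimately have "(\<lambda>N. (L2_inner f g - infsum qT (T N)) + infsum qT (T N)) \<longlonglongrightarrow> 0 + infsum qT I"
    by (rule tendsto_add)
  then have eq: "L2_inner f g = infsum qT I" by (simp add: LIMSEQ_const_iff)
  from has_sum_infsum[OF abs_summable_summable[OF qabs]] show ?thesis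
    unfolding eq[symmetric] unfolding qT_def[abs_def] I_def .
qed

section \<open>From quasi-affine to affine duality\<close>

lemma quasi_low_frequency_family_small:
  assumes L2: "\<And>l. l \<in> {1..L :: nat} \<Longrightarrow> \<psi> l \<in> L2" and e: "e > 0"
  shows "\<exists>N0. \<forall>N\<ge>N0. (\<Sum>\<^sub>\<infinity>i\<in>{1..L} \<times> {j. j < 0} \<times> UNIV.
    (cmod (L2_inner (dilation (int N) (ball_fun s a)) (quasi_affine_family \<psi> i)))\<^sup>2) \<le> e"
proof -
  define d where "d N = dilation (int N) (ball_fun s a)" for N
  \<comment> \<open>With \<open>Suc L\<close> as denominator the quotient is positive also for L =
    0, and L such terms still add up to at most e.\<close>
  have "e / real (Suc L) > 0" using e by simp
  then have "\<forall>l\<in>{1..L}. \<exists>N0. \<forall>N\<ge>N0. \<forall>G. finite G \<longrightarrow> G \<subseteq> {j. j < 0} \<times> UNIV \<longrightarrow>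
      (\<Sum>(j, k)\<in>G. real q powi j * (cmod (coef (d N) (\<psi> l) j (u k)))\<^sup>2) \<le> e / real (Suc L)"
    using quasi_low_frequency_small[OF L2] unfolding d_def by blast
  from bchoice[OF this] obtain N0 where "\<forall>l\<in>{1..L}. \<forall>N\<ge>N0 l. \<forall>G. finite G \<longrightarrow> G \<subseteq> {j. j < 0} \<times> UNIV \<longrightarrow>
      (\<Sum>(j, k)\<in>G. real q powi j * (cmod (coef (d N) (\<psi> l) j (u k)))\<^sup>2) \<le> e / real (Suc L)" ..
  note N0 = this[rule_format]
  show ?thesis
  proof (intro exI allI impI)
    fix N assume N: "N \<ge> Max (insert 0 (N0 ` {1..L}))"
    define t where "t = (\<lambda>i. (cmod (L2_inner (d N) (quasi_affine_family \<psi> i)))\<^sup>2)"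
    have t: "t (l, j, k) = real q powi j * (cmod (coef (d N) (\<psi> l) j (u k)))\<^sup>2" if "j < 0" for l j k
      using that by (simp add: t_def quasi_sq_eq quasi_term_def)
    have fin: "sum t F \<le> e" if F: "finite F" "F \<subseteq> {1..L} \<times> {j. j < 0} \<times> UNIV" for F
    proof -
      have G: "finite (snd ` F)" "snd ` F \<subseteq> {j. j < 0} \<times> UNIV" using F by auto
      have "F \<subseteq> {1..L} \<times> snd ` F"
      proof
        fix x assume x: "x \<in> F"
        then have "snd x \<in> snd ` F" by (rule imageI)
        then show "x \<in> {1..L} \<times> snd ` F" using x F(2) by (cases x) auto
      qed
      then have "sum t F \<le> sum t ({1..L} \<times> snd ` F)"
        by (intro sum_mono2) (use F in \<open>auto simp: t_def\<close>)
      also have "\<dots> = (\<Sum>l=1..L. \<Sum>p\<in>snd ` F. t (l, p))"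
        by (simp add: sum.cartesian_product)
      also have "\<dots> \<le> (\<Sum>l=1..L. e / real (Suc L))"
      proof (rule sum_mono)
        fix l assume l: "l \<in> {1..L}"
        have "N0 l \<le> Max (insert 0 (N0 ` {1..L}))" using l by (intro Max_ge) auto
        then have "(\<Sum>(j, k)\<in>snd ` F. real q powi j * (cmod (coef (d N) (\<psi> l) j (u k)))\<^sup>2) \<le> e / real (Suc L)"
          by (intro N0[OF l _ G] order_trans[OF _ N])
        also have "(\<Sum>(j, k)\<in>snd ` F. real q powi j * (cmod (coef (d N) (\<psi> l) j (u k)))\<^sup>2) = (\<Sum>p\<in>snd ` F. t (l, p))"
          by (rule sum.cong[OF refl]) (use G(2) in \<open>auto simp: t\<close>)
        finally show "(\<Sum>p\<in>snd ` F. t (l, p)) \<le> e / real (Suc L)" .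
      qed
      also have "\<dots> = real L * e / real (Suc L)" by simp
      also have "\<dots> \<le> e" using e by (simp add: field_simps)
      finally show ?thesis .
    qed
    have "infsum t ({1..L} \<times> {j. j < 0} \<times> UNIV) \<le> e"
      by (rule infsum_le_if_finite_sums_le(2)[OF _ fin]) (auto simp: t_def)
    then show "(\<Sum>\<^sub>\<infinity>i\<in>{1..L} \<times> {j. j < 0} \<times> UNIV.
      (cmod (L2_inner (dilation (int N) (ball_fun s a)) (quasi_affine_family \<psi> i)))\<^sup>2) \<le> e"
      by (simp add: t_def d_def)
  qed
qed

lemma quasi_imp_affine_Ball:
  fixes s a s' a' :: nat
  defines "f \<equiv> ball_fun s a" and "g \<equiv> ball_fun s' a'"
  assumes L2: "\<And>l. l \<in> {1..L :: nat} \<Longrightarrow> \<psi> l \<in> L2" "\<And>l. l \<in> {1..L} \<Longrightarrow> \<phi> l \<in> L2"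
    and bessel: "bessel_family (index_set L) (affine_family \<psi>) B"
      "bessel_family (index_set L) (affine_family \<phi>) B'"
    and dual: "\<And>f g. f \<in> L2 \<Longrightarrow> g \<in> L2 \<Longrightarrow>
      ((\<lambda>i. L2_inner f (quasi_affine_family \<psi> i) * L2_inner (quasi_affine_family \<phi> i) g)
        has_sum L2_inner f g) (index_set L)"
  shows "((\<lambda>i. L2_inner f (affine_family \<psi> i) *
      L2_inner (affine_family \<phi> i) g) has_sum L2_inner f g) (index_set L)"
proof -
  have f: "f \<in> L2" and g: "g \<in> L2" unfolding f_def g_def by (rule indicator_Ball_L2)+
  define I where "I = {1..L} \<times> (UNIV :: int set) \<times> (UNIV :: nat set)"
  define T where "T N = {1..L} \<times> {- int N..} \<times> (UNIV :: nat set)" for N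
  define R where "R = {1..L} \<times> {j :: int. j < 0} \<times> (UNIV :: nat set)"
  define qF where "qF \<psi> = (quasi_affine_family \<psi>)" for \<psi> :: "nat \<Rightarrow> 'a \<Rightarrow> complex"
  define aT where "aT i = L2_inner f (affine_family \<psi> i) *
      L2_inner (affine_family \<phi> i) g" for i
  define qT where "qT N i = L2_inner (dilation (int N) f) (qF \<psi> i) * L2_inner (qF \<phi> i) (dilation (int N) g)" for N i
  note qbessel = quasi_bessel_family[OF bessel(1) L2(1), folded I_def qF_def]
    quasi_bessel_family[OF bessel(2) L2(2), folded I_def qF_def]
  have IR: "I = T 0 \<union> R" "T 0 \<inter> R = {}" "R \<subseteq> I" "T N \<subseteq> I" for N
    by (auto simp: I_def T_def R_def)
  have aabs: "(\<lambda>i. norm (aT i)) summable_on I"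
    unfolding aT_def I_def by (rule bessel_products(1)[OF bessel f g])
  have qabs: "qT N summable_on J" if "J \<subseteq> I" for N J
  proof -
    have "(\<lambda>i. norm (qT N i)) summable_on I"
      unfolding qT_def by (rule bessel_products(1)[OF qbessel dilation_L2[OF f] dilation_L2[OF g]])
    from summable_on_subset_banach[OF this that] show ?thesis by (rule abs_summable_summable)
  qed
  \<comment> \<open>The dilations are unitary, so the hypothesis applied to the dilates still
    produces the inner product of f and g; only the split into levels moves.\<close>
  have split: "L2_inner f g - infsum aT (T N) = infsum (qT N) R" for N
  proof -
    have "L2_inner f g = L2_inner (dilation (int N) f) (dilation (int N) g)" by (simp add: inner_dilation f g)
    also have "\<dots> = infsum (qT N) I"
      unfolding qT_def[abs_def] qF_def I_def
      by (rule infsumI[OF dual[OF dilation_L2[OF f] dilation_L2[OF g]], symmetric])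
    also have "\<dots> = infsum (qT N) (T 0) + infsum (qT N) R"
      unfolding IR(1) by (intro infsum_Un_disjoint qabs IR)
    \<comment> \<open>A level j >= 0 of the dilates is the level j - N >= -N of f and g, and for j
      >= 0 quasi-affine and affine elements coincide.\<close>
    also have "infsum (qT N) (T 0) = infsum (\<lambda>i. qT N ((\<lambda>(l, j, k). (l, j + int N, k)) i)) (T N)"
    proof (rule infsum_reindex_bij_betw[symmetric])
      show "bij_betw (\<lambda>(l, j, k). (l, j + int N, k)) (T N) (T 0)"
        by (rule bij_betw_byWitness[where f' = "\<lambda>(l, j, k). (l, j - int N, k)"]) (auto simp: T_def)
    qed
    also have "\<dots> = infsum aT (T N)"
    proof (rule infsum_cong)
      fix i assume "i \<in> T N"
      then obtain l j k where i: "i = (l, j, k)" "l \<in> {1..L}" "j \<ge> - int N" by (auto simp: T_def)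
      have shift: "coef (dilation (int N) f') h (j + int N) (\<pp> powi (j + int N) * u k) = coef f' h j (\<pp> powi j * u k)"
        if "f' \<in> L2" "h \<in> L2" for f' h
        unfolding coef_dilation[OF that] by (simp add: mult.assoc[symmetric] power_int_add[symmetric])
      show "qT N ((\<lambda>(l, j, k). (l, j + int N, k)) i) = aT i"
        unfolding qT_def aT_def i(1) qF_def prod.case
          inner_cnj[of "quasi_affine_elem (\<phi> l) (j + int N) k"] inner_cnj[of "affine_elem (\<phi> l) j k"]
        using i(2,3) by (simp add: inner_quasi_affine_elem inner_affine_elem shift f g L2)
    qed
    finally show ?thesis by simp
  qed
  have "(\<lambda>N. infsum aT (T N)) \<longlonglongrightarrow> L2_inner f g"
  proof (rule metric_LIMSEQ_I)
    fix e :: real assume e: "e > 0"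
    have e2: "e / 2 > 0" using e by simp
    obtain N1 where N1: "\<And>N. N \<ge> N1 \<Longrightarrow> (\<Sum>\<^sub>\<infinity>i\<in>R. (cmod (L2_inner (dilation (int N) f) (qF \<psi> i)))\<^sup>2) \<le> e / 2"
      using quasi_low_frequency_family_small[where \<psi> = \<psi> and L = L and s = s and a = a, OF L2(1) e2]
      unfolding R_def qF_def f_def by blast
    obtain N2 where N2: "\<And>N. N \<ge> N2 \<Longrightarrow> (\<Sum>\<^sub>\<infinity>i\<in>R. (cmod (L2_inner (dilation (int N) g) (qF \<phi> i)))\<^sup>2) \<le> e / 2"
      using quasi_low_frequency_family_small[where \<psi> = \<phi> and L = L and s = s' and a = a', OF L2(2) e2]
      unfolding R_def qF_def g_def by blast
    show "\<exists>N0. \<forall>N\<ge>N0. dist (infsum aT (T N)) (L2_inner f g) < e"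
    proof (intro exI allI impI)
      fix N assume N: "N \<ge> max N1 N2"
      have "dist (infsum aT (T N)) (L2_inner f g) = cmod (infsum (qT N) R)"
        unfolding split[symmetric] by (simp add: dist_norm norm_minus_commute)
      also have "\<dots> \<le> ((\<Sum>\<^sub>\<infinity>i\<in>R. (cmod (L2_inner (dilation (int N) f) (qF \<psi> i)))\<^sup>2)
          + (\<Sum>\<^sub>\<infinity>i\<in>R. (cmod (L2_inner (dilation (int N) g) (qF \<phi> i)))\<^sup>2)) / 2"
        unfolding qT_def
        by (intro cmod_infsum_products_le bessel_sum_le(1)[OF qbessel(1) dilation_L2[OF f] IR(3)]
            bessel_sum_le(1)[OF qbessel(2) dilation_L2[OF g] IR(3)])
      also have "\<dots> \<le> e / 2" using N1[of N] N2[of N] N by simp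
      finally show "dist (infsum aT (T N)) (L2_inner f g) < e" using e by simp
    qed
  qed
  moreover have "(\<lambda>N. infsum aT (T N)) \<longlonglongrightarrow> infsum aT I"
  proof (rule infsum_tendsto_exhaustion[OF aabs IR(4)])
    fix i assume "i \<in> I"
    obtain l j k where i: "i = (l, j, k)" by (cases i) auto
    show "\<forall>\<^sub>F N in sequentially. i \<in> T N"
      using \<open>i \<in> I\<close> unfolding eventually_sequentially
      by (intro exI[of _ "nat (- j)"]) (auto simp: i I_def T_def)
  qed
  ultimately have eq: "L2_inner f g = infsum aT I" by (rule LIMSEQ_unique)
  from has_sum_infsum[OF abs_summable_summable[OF aabs]] show ?thesis
    unfolding eq[symmetric] unfolding aT_def[abs_def] I_def .
qed

lemma affine_dual_iff_quasi_affine_dual: "affine_dual L \<phi> \<psi> \<longleftrightarrow> quasi_affine_dual L \<phi> \<psi>"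
\<comment> \<open>These conditions are part of both definitions, so outside this case both sides are
  false.\<close>
proof (cases "(\<forall>l\<in>{1..L}. \<psi> l \<in> L2 \<and> \<phi> l \<in> L2) \<and> affine_bessel L \<psi> \<and> affine_bessel L \<phi>")
  case True
  then have L2: "\<And>l. l \<in> {1..L} \<Longrightarrow> \<psi> l \<in> L2" "\<And>l. l \<in> {1..L} \<Longrightarrow> \<phi> l \<in> L2" by auto
  obtain B B' where B: "bessel_family (index_set L) (affine_family \<psi>) B"
      "bessel_family (index_set L) (affine_family \<phi>) B'"
    using affine_bessel_imp_bessel_family[of L \<psi>] affine_bessel_imp_bessel_family[of L \<phi>] True L2 by metis
  have pair: "(\<lambda>(l, j, k). L2_inner f (e (\<psi> l) j k) * L2_inner (e (\<phi> l) j k) g)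
      = (\<lambda>i. L2_inner f ((\<lambda>(l, j, k). e (\<psi> l) j k) i) * L2_inner ((\<lambda>(l, j, k). e (\<phi> l) j k) i) g)"
    for f g and e :: "('a \<Rightarrow> complex) \<Rightarrow> int \<Rightarrow> nat \<Rightarrow> 'a \<Rightarrow> complex"
    by auto
  show ?thesis
    unfolding affine_dual_def quasi_affine_dual_def pair
  proof (intro conj_cong refl iffI ballI)
    fix f g assume *: "\<forall>f\<in>L2. \<forall>g\<in>L2. ((\<lambda>i. L2_inner f (affine_family \<psi> i) *
        L2_inner (affine_family \<phi> i) g) has_sum L2_inner f g) (index_set L)"
      and fg: "f \<in> L2" "g \<in> L2"
    show "((\<lambda>i. L2_inner f (quasi_affine_family \<psi> i) *
        L2_inner (quasi_affine_family \<phi> i) g) has_sum L2_inner f g) (index_set L)"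
      by (rule dual_extend[OF quasi_bessel_family[OF B(1) L2(1)] quasi_bessel_family[OF B(2) L2(2)]
            affine_imp_quasi_Ball[OF L2 B *[rule_format]] fg])
  next
    fix f g assume *: "\<forall>f\<in>L2. \<forall>g\<in>L2. ((\<lambda>i. L2_inner f (quasi_affine_family \<psi> i) *
        L2_inner (quasi_affine_family \<phi> i) g) has_sum L2_inner f g) (index_set L)"
      and fg: "f \<in> L2" "g \<in> L2"
    show "((\<lambda>i. L2_inner f (affine_family \<psi> i) *
        L2_inner (affine_family \<phi> i) g) has_sum L2_inner f g) (index_set L)"
      by (rule dual_extend[OF B quasi_imp_affine_Ball[OF L2 B *[rule_format]] fg])
  qed
qed (auto simp: affine_dual_def quasi_affine_dual_def)

end

theorem theorem4p1:
  fixes M :: "'a :: local_field measure"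
    and av :: "'a \<Rightarrow> real"
    and \<pp> :: 'a
    and c L :: nat
    and \<epsilon> :: "nat \<Rightarrow> 'a"
    and \<psi> \<phi> :: "nat \<Rightarrow> 'a \<Rightarrow> complex"
  assumes "local_field_char_p M av \<pp> c \<epsilon>"
    and "L \<ge> 1"
    and "\<And>l. l \<in> {1..L} \<Longrightarrow> \<psi> l \<in> local_field_char_p.L2 M"
    and "local_field_char_p.affine_bessel M \<pp> c \<epsilon> L \<psi>"
    and "\<And>l. l \<in> {1..L} \<Longrightarrow> \<phi> l \<in> local_field_char_p.L2 M"
  shows "local_field_char_p.affine_dual M \<pp> c \<epsilon> L \<phi> \<psi> \<longleftrightarrow>
         local_field_char_p.quasi_affine_dual M \<pp> c \<epsilon> L \<phi> \<psi>"
  by (rule local_field_char_p.affine_dual_iff_quasi_affine_dual[OF assms(1)])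

end
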